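(* Let $k$ be a commutative ring and let $\mathcal{D}$ be a full subcategory of $\mathcal{T}$, with a distinguished class $\mathcal{D}_{\min}$ of minimal objects, satisfying conditions (C1) and (C2) stated in the context. Then there exists a $k$-linear category $\mathscr{E}$, with the same objects as $\mathcal{D}$, such that there is an equivalence of categories $$\mathcal{D}\text{-}\mathrm{Mod}\simeq\mathscr{E}\text{-}\mathrm{Mod},$$ such that $\mathscr{E}(A,A)\cong k\mathrm{Aut}(A)$ for every object $A$, and such that $$\mathscr{E}(B,A)\neq0\ \Longrightarrow\ |A|=|B|\ \text{ or }\ |A|=|B|+1.$$
   Context: Rooted trees: a finite rooted tree is a finite poset $(A,\leqslant)$ with a unique minimal element (the root) such that for every $x\in A$ the set $\{y\in A\mid y\leqslant x\}$ is a chain. Its edges are the covering relations $a\lessdot b$. An embedding $f:A\to B$ is an injective map with $x\leqslant y\iff f(x)\leqslant f(y)$; it is proper if it is not an isomorphism. For an edge $a\lessdot b$ of $A$, $A/\{a,b\}$ is the rooted tree obtained by contracting the edge. An elementary contraction along $a\lessdot b$ is the quotient map $\pi:A\to A/\{a,b\}$, possibly followed by an isomorphism of posets. The edge $a\lessdot b$, and the elementary contraction, are admissible if $a$ is the root of $A$ or $b$ is the unique immediate successor of $a$. $\mathcal{T}$ is the category of finite rooted trees whose morphisms are the finite composites of embeddings (including isomorphisms) and admissible elementary contractions. Categories are replaced by full skeletons where necessary. Setting for $\mathcal{D}$: $\mathcal{D}$ is a subcategory of $\mathcal{T}$ together with a distinguished class $\mathcal{D}_{\min}$ of objects, called minimal.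 Morphisms in $\mathcal{D}$ are finite composites of embeddings and admissible elementary contractions, with the restriction that admissible contractions may only be applied to non-minimal objects. A vertex $a$ of an object $A$ of $\mathcal{D}$ is flexible if there is a proper embedding $f:B\hookrightarrow A$ with $B\in\mathrm{Ob}(\mathcal{D})$ and $a\notin f(B)$. The conditions are: (C1) for each $A\in\mathrm{Ob}(\mathcal{D})$: if $A$ is minimal, then it admits no proper embedding $B\hookrightarrow A$ in $\mathcal{D}$; if $A$ is not minimal and $a\lessdot b$ is an admissible edge of $A$, then $A/\{a,b\}$ is isomorphic to an object of $\mathcal{D}$. (C2) for every non-minimal object $A$ of $\mathcal{D}$, the flexible vertices of $A$ are connected via admissible edges of $A$ (any two flexible vertices are joined by a path of admissible edges of $A$). $\mathcal{D}\text{-}\mathrm{Mod}$ is the category of covariant functors from $\mathcal{D}$ to $k$-modules; $\mathscr{E}\text{-}\mathrm{Mod}$ is the category of $k$-linear covariant functors from $\mathscr{E}$ to $k$-modules.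
   Formalization: Added assumption: no morphism of D out of a minimal object factors in T through an admissible contraction of that object; without it the claim fails for D = {2-chain, 3-chain} with the 2-chain minimal. *)

theory Defs
  imports "HOL-Algebra.Module" "HOL-Algebra.QuotRing"
begin

section \<open>Categories, functors, equivalences\<close>

text \<open>Hom-sets are indexed by source and target and need not be disjoint, so identities,
  composition and the arrow part of a functor all carry the objects as arguments;
  \<open>Comp C X Y Z g f\<close> is the composite of \<open>f : X \<rightarrow> Y\<close> with \<open>g : Y \<rightarrow> Z\<close>.\<close>

record ('o, 'a) cat =
  Ob :: "'o set"
  Hom :: "'o \<Rightarrow> 'o \<Rightarrow> 'a set"
  Idm :: "'o \<Rightarrow> 'a"
  Comp :: "'o \<Rightarrow> 'o \<Rightarrow> 'o \<Rightarrow> 'a \<Rightarrow> 'a \<Rightarrow> 'a"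

locale category =
  fixes C :: "('o, 'a, 'z) cat_scheme"
  assumes Idm_in: "X \<in> Ob C \<Longrightarrow> Idm C X \<in> Hom C X X"
    and Comp_in: "\<lbrakk>X \<in> Ob C; Y \<in> Ob C; Z \<in> Ob C; f \<in> Hom C X Y; g \<in> Hom C Y Z\<rbrakk>
      \<Longrightarrow> Comp C X Y Z g f \<in> Hom C X Z"
    and Comp_Idm_left: "\<lbrakk>X \<in> Ob C; Y \<in> Ob C; f \<in> Hom C X Y\<rbrakk>
      \<Longrightarrow> Comp C X Y Y (Idm C Y) f = f"
    and Comp_Idm_right: "\<lbrakk>X \<in> Ob C; Y \<in> Ob C; f \<in> Hom C X Y\<rbrakk>
      \<Longrightarrow> Comp C X X Y f (Idm C X) = f"
    and Comp_assoc: "\<lbrakk>W \<in> Ob C; X \<in> Ob C; Y \<in> Ob C; Z \<in> Ob C;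
        f \<in> Hom C W X; g \<in> Hom C X Y; h \<in> Hom C Y Z\<rbrakk>
      \<Longrightarrow> Comp C W X Z (Comp C X Y Z h g) f = Comp C W Y Z h (Comp C W X Y g f)"

record ('o, 'a, 'p, 'b) fctr =
  omap :: "'o \<Rightarrow> 'p"
  amap :: "'o \<Rightarrow> 'o \<Rightarrow> 'a \<Rightarrow> 'b"

text \<open>The values of \<open>omap\<close> and \<open>amap\<close> outside the objects and hom-sets of the source are
  unconstrained; functors that differ only there are naturally isomorphic via identities.\<close>

definition is_functor ::
  "('o, 'a, 'z) cat_scheme \<Rightarrow> ('p, 'b, 'w) cat_scheme \<Rightarrow> ('o, 'a, 'p, 'b) fctr \<Rightarrow> bool" where
  "is_functor C D F \<longleftrightarrow> category C \<and> category D \<and>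
    (\<forall>X\<in>Ob C. omap F X \<in> Ob D) \<and>
    (\<forall>X\<in>Ob C. \<forall>Y\<in>Ob C. \<forall>f\<in>Hom C X Y. amap F X Y f \<in> Hom D (omap F X) (omap F Y)) \<and>
    (\<forall>X\<in>Ob C. amap F X X (Idm C X) = Idm D (omap F X)) \<and>
    (\<forall>X\<in>Ob C. \<forall>Y\<in>Ob C. \<forall>Z\<in>Ob C. \<forall>f\<in>Hom C X Y. \<forall>g\<in>Hom C Y Z.
      amap F X Z (Comp C X Y Z g f) =
        Comp D (omap F X) (omap F Y) (omap F Z) (amap F Y Z g) (amap F X Y f))"

definition id_functor :: "('o, 'a, 'o, 'a) fctr" where
  "id_functor = \<lparr>omap = (\<lambda>X. X), amap = (\<lambda>X Y f. f)\<rparr>"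

definition comp_functor ::
  "('p, 'b, 'q, 'c) fctr \<Rightarrow> ('o, 'a, 'p, 'b) fctr \<Rightarrow> ('o, 'a, 'q, 'c) fctr" where
  "comp_functor G F = \<lparr>omap = (\<lambda>X. omap G (omap F X)),
    amap = (\<lambda>X Y f. amap G (omap F X) (omap F Y) (amap F X Y f))\<rparr>"

definition is_nat_trans ::
  "('o, 'a, 'z) cat_scheme \<Rightarrow> ('p, 'b, 'w) cat_scheme \<Rightarrow>
   ('o, 'a, 'p, 'b) fctr \<Rightarrow> ('o, 'a, 'p, 'b) fctr \<Rightarrow> ('o \<Rightarrow> 'b) \<Rightarrow> bool" where
  "is_nat_trans C D F G \<eta> \<longleftrightarrow>
    (\<forall>X\<in>Ob C. \<eta> X \<in> Hom D (omap F X) (omap G X)) \<and>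
    (\<forall>X\<in>Ob C. \<forall>Y\<in>Ob C. \<forall>f\<in>Hom C X Y.
      Comp D (omap F X) (omap F Y) (omap G Y) (\<eta> Y) (amap F X Y f) =
      Comp D (omap F X) (omap G X) (omap G Y) (amap G X Y f) (\<eta> X))"

definition is_iso_in :: "('o, 'a, 'z) cat_scheme \<Rightarrow> 'o \<Rightarrow> 'o \<Rightarrow> 'a \<Rightarrow> bool" where
  "is_iso_in C X Y f \<longleftrightarrow> f \<in> Hom C X Y \<and>
    (\<exists>g\<in>Hom C Y X. Comp C X Y X g f = Idm C X \<and> Comp C Y X Y f g = Idm C Y)"

definition nat_isomorphic ::
  "('o, 'a, 'z) cat_scheme \<Rightarrow> ('p, 'b, 'w) cat_scheme \<Rightarrow>
   ('o, 'a, 'p, 'b) fctr \<Rightarrow> ('o, 'a, 'p, 'b) fctr \<Rightarrow> bool" where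
  "nat_isomorphic C D F G \<longleftrightarrow>
    (\<exists>\<eta>. is_nat_trans C D F G \<eta> \<and> (\<forall>X\<in>Ob C. is_iso_in D (omap F X) (omap G X) (\<eta> X)))"

definition equivalent_categories ::
  "('o, 'a, 'z) cat_scheme \<Rightarrow> ('p, 'b, 'w) cat_scheme \<Rightarrow> bool" where
  "equivalent_categories C D \<longleftrightarrow>
    (\<exists>F G. is_functor C D F \<and> is_functor D C G \<and>
      nat_isomorphic C C (comp_functor G F) id_functor \<and>
      nat_isomorphic D D (comp_functor F G) id_functor)"

definition functor_category ::
  "('o, 'a, 'z) cat_scheme \<Rightarrow> ('p, 'b, 'w) cat_scheme \<Rightarrow>
   (('o, 'a, 'p, 'b) fctr, 'o \<Rightarrow> 'b) cat" where
  "functor_category C D = \<lparr>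
    Ob = {F. is_functor C D F},
    Hom = (\<lambda>F G. {\<eta> \<in> extensional (Ob C). is_nat_trans C D F G \<eta>}),
    Idm = (\<lambda>F. \<lambda>X\<in>Ob C. Idm D (omap F X)),
    Comp = (\<lambda>F G H \<tau> \<sigma>. \<lambda>X\<in>Ob C. Comp D (omap F X) (omap G X) (omap H X) (\<tau> X) (\<sigma> X))\<rparr>"

definition full_subcategory :: "('o, 'a) cat \<Rightarrow> ('o \<Rightarrow> bool) \<Rightarrow> ('o, 'a) cat" where
  "full_subcategory C P = C\<lparr>Ob := {X \<in> Ob C. P X}\<rparr>"


section \<open>Linear categories and their modules\<close>

record ('o, 'a, 'r) lincat = "('o, 'a) cat" +
  HomMod :: "'o \<Rightarrow> 'o \<Rightarrow> ('r, 'a) module"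

text \<open>The ring multiplication and unit of a \<^typ>\<open>('r, 'a) module\<close> record play no role in the
  locale \<^locale>\<open>module\<close> and are left unconstrained here.\<close>

definition linear_map ::
  "('r, 'x) ring_scheme \<Rightarrow> ('r, 'm, 'y) module_scheme \<Rightarrow> ('r, 'n, 'z) module_scheme \<Rightarrow>
   ('m \<Rightarrow> 'n) \<Rightarrow> bool" where
  "linear_map R M N f \<longleftrightarrow> f \<in> carrier M \<rightarrow> carrier N \<and>
    (\<forall>x\<in>carrier M. \<forall>y\<in>carrier M. f (x \<oplus>\<^bsub>M\<^esub> y) = f x \<oplus>\<^bsub>N\<^esub> f y) \<and>
    (\<forall>r\<in>carrier R. \<forall>x\<in>carrier M. f (r \<odot>\<^bsub>M\<^esub> x) = r \<odot>\<^bsub>N\<^esub> f x)"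

locale linear_category = category E
  for R :: "('r, 'x) ring_scheme" and E :: "('o, 'a, 'r, 'z) lincat_scheme" +
  assumes module_HomMod: "\<lbrakk>X \<in> Ob E; Y \<in> Ob E\<rbrakk> \<Longrightarrow> module R (HomMod E X Y)"
    and carrier_HomMod: "\<lbrakk>X \<in> Ob E; Y \<in> Ob E\<rbrakk> \<Longrightarrow> carrier (HomMod E X Y) = Hom E X Y"
    and linear_Comp_right: "\<lbrakk>X \<in> Ob E; Y \<in> Ob E; Z \<in> Ob E; g \<in> Hom E Y Z\<rbrakk>
      \<Longrightarrow> linear_map R (HomMod E X Y) (HomMod E X Z) (\<lambda>f. Comp E X Y Z g f)"
    and linear_Comp_left: "\<lbrakk>X \<in> Ob E; Y \<in> Ob E; Z \<in> Ob E; f \<in> Hom E X Y\<rbrakk>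
      \<Longrightarrow> linear_map R (HomMod E Y Z) (HomMod E X Z) (\<lambda>g. Comp E X Y Z g f)"

definition is_linear_functor ::
  "('r, 'x) ring_scheme \<Rightarrow> ('o, 'a, 'r, 'z) lincat_scheme \<Rightarrow> ('p, 'b, 'r, 'w) lincat_scheme \<Rightarrow>
   ('o, 'a, 'p, 'b) fctr \<Rightarrow> bool" where
  "is_linear_functor R C D F \<longleftrightarrow> is_functor C D F \<and>
    (\<forall>X\<in>Ob C. \<forall>Y\<in>Ob C.
      linear_map R (HomMod C X Y) (HomMod D (omap F X) (omap F Y)) (amap F X Y))"

definition linear_maps_module ::
  "('r, 'x) ring_scheme \<Rightarrow> ('r, 'm) module \<Rightarrow> ('r, 'n) module \<Rightarrow> ('r, 'm \<Rightarrow> 'n) module" where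
  "linear_maps_module R M N = \<lparr>
    carrier = {f \<in> extensional (carrier M). linear_map R M N f},
    mult = undefined, one = undefined,
    zero = (\<lambda>x\<in>carrier M. \<zero>\<^bsub>N\<^esub>),
    add = (\<lambda>f g. \<lambda>x\<in>carrier M. f x \<oplus>\<^bsub>N\<^esub> g x),
    smult = (\<lambda>r f. \<lambda>x\<in>carrier M. r \<odot>\<^bsub>N\<^esub> f x)\<rparr>"

text \<open>The type \<^typ>\<open>'m\<close> is the universe: the objects are all \<open>R\<close>-modules whose carrier is a
  subset of \<^typ>\<open>'m\<close>.\<close>

definition mod_category ::
  "'m itself \<Rightarrow> ('r, 'x) ring_scheme \<Rightarrow> (('r, 'm) module, 'm \<Rightarrow> 'm, 'r) lincat" where
  "mod_category _ R = \<lparr>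
    Ob = {M. module R M},
    Hom = (\<lambda>M N. {f \<in> extensional (carrier M). linear_map R M N f}),
    Idm = (\<lambda>M. \<lambda>x\<in>carrier M. x),
    Comp = (\<lambda>M N P g f. compose (carrier M) g f),
    HomMod = linear_maps_module R\<rparr>"

definition Mod_over ::
  "'m itself \<Rightarrow> ('r, 'x) ring_scheme \<Rightarrow> ('o, 'a, 'z) cat_scheme \<Rightarrow>
   (('o, 'a, ('r, 'm) module, 'm \<Rightarrow> 'm) fctr, 'o \<Rightarrow> 'm \<Rightarrow> 'm) cat" where
  "Mod_over U R C = functor_category C (mod_category U R)"

definition linear_Mod_over ::
  "'m itself \<Rightarrow> ('r, 'x) ring_scheme \<Rightarrow> ('o, 'a, 'r, 'z) lincat_scheme \<Rightarrow>
   (('o, 'a, ('r, 'm) module, 'm \<Rightarrow> 'm) fctr, 'o \<Rightarrow> 'm \<Rightarrow> 'm) cat" where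
  "linear_Mod_over U R E =
    full_subcategory (functor_category E (mod_category U R))
      (is_linear_functor R E (mod_category U R))"

text \<open>\<^const>\<open>HomMod\<close> supplies the module structure, composition the multiplication.\<close>

definition End_algebra :: "('o, 'a, 'r, 'z) lincat_scheme \<Rightarrow> 'o \<Rightarrow> ('r, 'a) module" where
  "End_algebra E X = (HomMod E X X)\<lparr>mult := Comp E X X X, one := Idm E X\<rparr>"

definition group_algebra ::
  "('r, 'x) ring_scheme \<Rightarrow> ('g, 'y) monoid_scheme \<Rightarrow> ('r, 'g \<Rightarrow> 'r) module" where
  "group_algebra R G = \<lparr>
    carrier = {u \<in> carrier G \<rightarrow>\<^sub>E carrier R. finite {x \<in> carrier G. u x \<noteq> \<zero>\<^bsub>R\<^esub>}},
    mult = (\<lambda>u v. \<lambda>x\<in>carrier G.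
      \<Oplus>\<^bsub>R\<^esub>y\<in>{y \<in> carrier G. u y \<noteq> \<zero>\<^bsub>R\<^esub>}. u y \<otimes>\<^bsub>R\<^esub> v (inv\<^bsub>G\<^esub> y \<otimes>\<^bsub>G\<^esub> x)),
    one = (\<lambda>x\<in>carrier G. if x = \<one>\<^bsub>G\<^esub> then \<one>\<^bsub>R\<^esub> else \<zero>\<^bsub>R\<^esub>),
    zero = (\<lambda>x\<in>carrier G. \<zero>\<^bsub>R\<^esub>),
    add = (\<lambda>u v. \<lambda>x\<in>carrier G. u x \<oplus>\<^bsub>R\<^esub> v x),
    smult = (\<lambda>r u. \<lambda>x\<in>carrier G. r \<otimes>\<^bsub>R\<^esub> u x)\<rparr>"

definition algebra_isomorphic ::
  "('r, 'x) ring_scheme \<Rightarrow> ('r, 'a, 'y) module_scheme \<Rightarrow> ('r, 'b, 'z) module_scheme \<Rightarrow> bool" where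
  "algebra_isomorphic R S T \<longleftrightarrow> (\<exists>h\<in>ring_iso S T. linear_map R S T h)"


section \<open>Finite rooted trees\<close>

text \<open>A poset is its reflexive order relation \<open>A\<close>, with underlying set \<^term>\<open>Field A\<close>;
  \<^term>\<open>(x, y) \<in> A\<close> means \<open>x \<le> y\<close>.\<close>

definition is_root :: "'v rel \<Rightarrow> 'v \<Rightarrow> bool" where
  "is_root A r \<longleftrightarrow> r \<in> Field A \<and> (\<forall>x. (x, r) \<in> A \<longrightarrow> x = r)"

definition rooted_tree :: "'v rel \<Rightarrow> bool" where
  "rooted_tree A \<longleftrightarrow> finite (Field A) \<and> Partial_order A \<and> (\<exists>!r. is_root A r) \<and>
    (\<forall>x\<in>Field A. {y. (y, x) \<in> A} \<in> Chains A)"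

definition covers :: "'v rel \<Rightarrow> 'v \<Rightarrow> 'v \<Rightarrow> bool" where
  "covers A a b \<longleftrightarrow> (a, b) \<in> A \<and> a \<noteq> b \<and>
    (\<forall>c. (a, c) \<in> A \<and> (c, b) \<in> A \<longrightarrow> c = a \<or> c = b)"

definition embedding :: "'v rel \<Rightarrow> 'w rel \<Rightarrow> ('v \<Rightarrow> 'w) \<Rightarrow> bool" where
  "embedding A B f \<longleftrightarrow> f \<in> Field A \<rightarrow>\<^sub>E Field B \<and> inj_on f (Field A) \<and>
    (\<forall>x\<in>Field A. \<forall>y\<in>Field A. (x, y) \<in> A \<longleftrightarrow> (f x, f y) \<in> B)"

definition isomorphism :: "'v rel \<Rightarrow> 'w rel \<Rightarrow> ('v \<Rightarrow> 'w) \<Rightarrow> bool" where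
  "isomorphism A B f \<longleftrightarrow> embedding A B f \<and> f ` Field A = Field B"

definition proper_embedding :: "'v rel \<Rightarrow> 'w rel \<Rightarrow> ('v \<Rightarrow> 'w) \<Rightarrow> bool" where
  "proper_embedding A B f \<longleftrightarrow> embedding A B f \<and> \<not> isomorphism A B f"

definition quotient_map :: "'v \<Rightarrow> 'v \<Rightarrow> 'v \<Rightarrow> 'v set" where
  "quotient_map a b x = (if x = a \<or> x = b then {a, b} else {x})"

text \<open>\<open>A/{a,b}\<close>.  For an edge \<open>a \<lessdot> b\<close> the image of the order is already transitive, so no
  closure is taken.\<close>

definition contract :: "'v rel \<Rightarrow> 'v \<Rightarrow> 'v \<Rightarrow> 'v set rel" where
  "contract A a b = map_prod (quotient_map a b) (quotient_map a b) ` A"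

definition admissible_edge :: "'v rel \<Rightarrow> 'v \<Rightarrow> 'v \<Rightarrow> bool" where
  "admissible_edge A a b \<longleftrightarrow> covers A a b \<and> (is_root A a \<or> (\<forall>c. covers A a c \<longrightarrow> c = b))"

definition admissible_contraction :: "'v rel \<Rightarrow> 'v rel \<Rightarrow> ('v \<Rightarrow> 'v) \<Rightarrow> bool" where
  "admissible_contraction A B p \<longleftrightarrow>
    (\<exists>a b \<phi>. admissible_edge A a b \<and> isomorphism (contract A a b) B \<phi> \<and>
      p = (\<lambda>x\<in>Field A. \<phi> (quotient_map a b x)))"

text \<open>\<open>Obs\<close> is the class of objects and \<open>Mins\<close> the class of minimal ones.  The composites run
  through objects in \<open>Obs\<close>.\<close>

inductive tree_morphism :: "'v rel set \<Rightarrow> 'v rel set \<Rightarrow> 'v rel \<Rightarrow> 'v rel \<Rightarrow> ('v \<Rightarrow> 'v) \<Rightarrow> bool"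
  for Obs Mins where
  emb: "\<lbrakk>A \<in> Obs; B \<in> Obs; embedding A B f\<rbrakk> \<Longrightarrow> tree_morphism Obs Mins A B f"
| contr: "\<lbrakk>A \<in> Obs; A \<notin> Mins; B \<in> Obs; admissible_contraction A B p\<rbrakk>
    \<Longrightarrow> tree_morphism Obs Mins A B p"
| comp: "\<lbrakk>tree_morphism Obs Mins A B f; tree_morphism Obs Mins B C g\<rbrakk>
    \<Longrightarrow> tree_morphism Obs Mins A C (compose (Field A) g f)"

definition tree_category :: "'v rel set \<Rightarrow> 'v rel set \<Rightarrow> ('v rel, 'v \<Rightarrow> 'v) cat" where
  "tree_category Obs Mins = \<lparr>
    Ob = Obs,
    Hom = (\<lambda>A B. {f. tree_morphism Obs Mins A B f}),
    Idm = (\<lambda>A. \<lambda>x\<in>Field A. x),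
    Comp = (\<lambda>A B C g f. compose (Field A) g f)\<rparr>"

text \<open>The category \<open>\<T>\<close> of finite rooted trees with vertices in \<^typ>\<open>'v\<close>.\<close>

definition all_trees :: "('v rel, 'v \<Rightarrow> 'v) cat" where
  "all_trees = tree_category {A. rooted_tree A} {}"

text \<open>Minimal objects are never contracted: no morphism out of a minimal object factors in
  \<open>\<T>\<close> through an admissible contraction of that object.  Restricting the generators alone
  does not guarantee this.  For the chains with two and three vertices, the former minimal,
  embedding the short chain into the long one and then contracting the image yields
  a non-injective endomorphism of the short chain, which also arises by contracting that
  chain to a point.  The condition is vacuous if all minimal objects are single vertices.\<close>

definition minimal_uncontracted :: "'v rel set \<Rightarrow> 'v rel set \<Rightarrow> bool" where
  "minimal_uncontracted Obs Mins \<longleftrightarrow>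
    (\<forall>A\<in>Mins. \<forall>B\<in>Obs. \<forall>f\<in>Hom (tree_category Obs Mins) A B.
      \<not> (\<exists>C p g. admissible_contraction A C p \<and> g \<in> Hom all_trees C B \<and>
          f = compose (Field A) g p))"

definition flexible :: "'v rel set \<Rightarrow> 'v rel \<Rightarrow> 'v \<Rightarrow> bool" where
  "flexible Obs A a \<longleftrightarrow> a \<in> Field A \<and>
    (\<exists>B\<in>Obs. \<exists>f. proper_embedding B A f \<and> a \<notin> f ` Field B)"

definition condition_C1 :: "'v rel set \<Rightarrow> 'v rel set \<Rightarrow> bool" where
  "condition_C1 Obs Mins \<longleftrightarrow> (\<forall>A\<in>Obs.
    (A \<in> Mins \<longrightarrow> \<not> (\<exists>B\<in>Obs. \<exists>f. proper_embedding B A f)) \<and>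
    (A \<notin> Mins \<longrightarrow> (\<forall>a b. admissible_edge A a b \<longrightarrow>
      (\<exists>B\<in>Obs. \<exists>\<phi>. isomorphism (contract A a b) B \<phi>))))"

definition condition_C2 :: "'v rel set \<Rightarrow> 'v rel set \<Rightarrow> bool" where
  "condition_C2 Obs Mins \<longleftrightarrow> (\<forall>A\<in>Obs - Mins. \<forall>x y. flexible Obs A x \<and> flexible Obs A y \<longrightarrow>
    (x, y) \<in> {(a, b). admissible_edge A a b \<or> admissible_edge A b a}\<^sup>*)"

definition Aut_group :: "'v rel \<Rightarrow> ('v \<Rightarrow> 'v) monoid" where
  "Aut_group A = \<lparr>
    carrier = {f. isomorphism A A f},
    mult = (\<lambda>g f. compose (Field A) g f),
    one = (\<lambda>x\<in>Field A. x)\<rparr>"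


section \<open>Well-definedness\<close>

lemma tree_morphism_funcset:
  "tree_morphism Obs Mins A B f \<Longrightarrow> A \<in> Obs \<and> B \<in> Obs \<and> f \<in> Field A \<rightarrow>\<^sub>E Field B"
proof (induction rule: tree_morphism.induct)
  case (contr A B p)
  then obtain a b \<phi> where iso: "isomorphism (contract A a b) B \<phi>"
    and p: "p = (\<lambda>x\<in>Field A. \<phi> (quotient_map a b x))"
    unfolding admissible_contraction_def by blast
  have "quotient_map a b x \<in> Field (contract A a b)" if "x \<in> Field A" for x
    using that unfolding contract_def Field_def by force
  then have "p \<in> Field A \<rightarrow>\<^sub>E Field B"
    using iso unfolding p isomorphism_def embedding_def by auto
  with contr show ?case by simp
next
  case (comp A B f C g)
  then show ?case by (auto simp: compose_def PiE_iff extensional_def)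
qed (auto simp: embedding_def)

lemma category_tree_category: "category (tree_category Obs Mins)"
proof
  show "Idm (tree_category Obs Mins) A \<in> Hom (tree_category Obs Mins) A A"
    if "A \<in> Ob (tree_category Obs Mins)" for A
    using that by (auto simp: tree_category_def embedding_def inj_on_def
        intro!: tree_morphism.emb)
next
  fix W X Y Z f g h
  assume "f \<in> Hom (tree_category Obs Mins) W X"
  then have "f \<in> Field W \<rightarrow>\<^sub>E Field X"
    using tree_morphism_funcset by (fastforce simp: tree_category_def)
  then show "Comp (tree_category Obs Mins) W X Z (Comp (tree_category Obs Mins) X Y Z h g) f =
      Comp (tree_category Obs Mins) W Y Z h (Comp (tree_category Obs Mins) W X Y g f)"
    by (auto simp: tree_category_def compose_def fun_eq_iff PiE_iff extensional_def)
next
  fix X Y f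
  assume "f \<in> Hom (tree_category Obs Mins) X Y"
  then have "f \<in> Field X \<rightarrow>\<^sub>E Field Y"
    using tree_morphism_funcset by (fastforce simp: tree_category_def)
  then show "Comp (tree_category Obs Mins) X Y Y (Idm (tree_category Obs Mins) Y) f = f"
      and "Comp (tree_category Obs Mins) X X Y f (Idm (tree_category Obs Mins) X) = f"
    by (auto simp: tree_category_def compose_def fun_eq_iff PiE_iff extensional_def)
qed (auto simp: tree_category_def intro: tree_morphism.comp)

lemma Hom_tree_category_subset:
  assumes "Obs \<subseteq> {A. rooted_tree A}"
  shows "Hom (tree_category Obs Mins) A B \<subseteq> Hom all_trees A B"
proof -
  have "tree_morphism {A. rooted_tree A} {} A B f" if "tree_morphism Obs Mins A B f" for f
    using that assms
    by (induction rule: tree_morphism.induct)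
       (blast intro: tree_morphism.intros)+
  then show ?thesis by (auto simp: all_trees_def tree_category_def)
qed

lemma category_functor_category:
  assumes "category C" "category D"
  shows "category (functor_category C D)"
proof -
  interpret C: category C by fact
  interpret D: category D by fact
  note defs = functor_category_def is_functor_def is_nat_trans_def
  show ?thesis
  proof
    fix F assume "F \<in> Ob (functor_category C D)"
    then show "Idm (functor_category C D) F \<in> Hom (functor_category C D) F F"
      by (auto simp: defs D.Idm_in D.Comp_Idm_left D.Comp_Idm_right)
  next
    fix F G H \<sigma> \<tau>
    assume FGH: "F \<in> Ob (functor_category C D)" "G \<in> Ob (functor_category C D)"
        "H \<in> Ob (functor_category C D)"
      and st: "\<sigma> \<in> Hom (functor_category C D) F G" "\<tau> \<in> Hom (functor_category C D) G H"
    have nat: "Comp D (omap F X) (omap F Y) (omap H Y)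
          (Comp D (omap F Y) (omap G Y) (omap H Y) (\<tau> Y) (\<sigma> Y)) (amap F X Y f) =
        Comp D (omap F X) (omap H X) (omap H Y) (amap H X Y f)
          (Comp D (omap F X) (omap G X) (omap H X) (\<tau> X) (\<sigma> X))"
      if X: "X \<in> Ob C" and Y: "Y \<in> Ob C" and f: "f \<in> Hom C X Y" for X Y f
    proof -
      have obs: "omap F X \<in> Ob D" "omap G X \<in> Ob D" "omap H X \<in> Ob D"
          "omap F Y \<in> Ob D" "omap G Y \<in> Ob D" "omap H Y \<in> Ob D"
        using FGH X Y by (auto simp: defs)
      have arr: "amap F X Y f \<in> Hom D (omap F X) (omap F Y)"
          "amap G X Y f \<in> Hom D (omap G X) (omap G Y)"
          "amap H X Y f \<in> Hom D (omap H X) (omap H Y)"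
          "\<sigma> X \<in> Hom D (omap F X) (omap G X)" "\<sigma> Y \<in> Hom D (omap F Y) (omap G Y)"
          "\<tau> X \<in> Hom D (omap G X) (omap H X)" "\<tau> Y \<in> Hom D (omap G Y) (omap H Y)"
        using FGH st X Y f by (auto simp: defs)
      have s: "Comp D (omap F X) (omap F Y) (omap G Y) (\<sigma> Y) (amap F X Y f) =
          Comp D (omap F X) (omap G X) (omap G Y) (amap G X Y f) (\<sigma> X)"
        and t: "Comp D (omap G X) (omap G Y) (omap H Y) (\<tau> Y) (amap G X Y f) =
          Comp D (omap G X) (omap H X) (omap H Y) (amap H X Y f) (\<tau> X)"
        using st X Y f by (auto simp: defs)
      show ?thesis
        by (metis obs arr s t D.Comp_assoc)
    qed
    show "Comp (functor_category C D) F G H \<tau> \<sigma> \<in> Hom (functor_category C D) F H"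
      using FGH st nat by (auto simp: defs intro!: D.Comp_in)
  next
    fix F G \<sigma>
    assume "F \<in> Ob (functor_category C D)" "G \<in> Ob (functor_category C D)"
      and "\<sigma> \<in> Hom (functor_category C D) F G"
    then show "Comp (functor_category C D) F G G (Idm (functor_category C D) G) \<sigma> = \<sigma>"
      and "Comp (functor_category C D) F F G \<sigma> (Idm (functor_category C D) F) = \<sigma>"
      by (auto simp: defs fun_eq_iff extensional_def D.Comp_Idm_left D.Comp_Idm_right)
  next
    fix F G H K \<rho> \<sigma> \<tau>
    assume "F \<in> Ob (functor_category C D)" "G \<in> Ob (functor_category C D)"
      "H \<in> Ob (functor_category C D)" "K \<in> Ob (functor_category C D)"
      "\<rho> \<in> Hom (functor_category C D) F G" "\<sigma> \<in> Hom (functor_category C D) G H"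
      "\<tau> \<in> Hom (functor_category C D) H K"
    then show "Comp (functor_category C D) F G K (Comp (functor_category C D) G H K \<tau> \<sigma>) \<rho> =
        Comp (functor_category C D) F H K \<tau> (Comp (functor_category C D) F G H \<sigma> \<rho>)"
      by (auto simp: defs fun_eq_iff D.Comp_assoc)
  qed
qed

lemma category_mod_category: "category (mod_category U R)"
proof
  fix M assume "M \<in> Ob (mod_category U R)"
  then interpret module R M by (simp add: mod_category_def)
  show "Idm (mod_category U R) M \<in> Hom (mod_category U R) M M"
    by (auto simp: mod_category_def linear_map_def)
next
  fix L M N f g
  assume "L \<in> Ob (mod_category U R)"
    and fg: "f \<in> Hom (mod_category U R) L M" "g \<in> Hom (mod_category U R) M N"
  then interpret module R L by (simp add: mod_category_def)
  show "Comp (mod_category U R) L M N g f \<in> Hom (mod_category U R) L N"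
    using fg by (auto simp: mod_category_def linear_map_def compose_def Pi_iff)
qed (auto simp: mod_category_def linear_map_def compose_def fun_eq_iff extensional_def Pi_iff)

lemma category_Mod_over: "category C \<Longrightarrow> category (Mod_over U R C)"
  unfolding Mod_over_def by (intro category_functor_category category_mod_category)

lemma category_linear_Mod_over:
  assumes "linear_category R E"
  shows "category (linear_Mod_over U R E)"
proof -
  interpret linear_category R E by fact
  interpret F: category "functor_category E (mod_category U R)"
    by (intro category_functor_category category_mod_category category_axioms)
  show ?thesis
    unfolding linear_Mod_over_def full_subcategory_def
    by unfold_locales (auto intro: F.Idm_in F.Comp_in F.Comp_Idm_left F.Comp_Idm_right F.Comp_assoc)
qed

end

theory Submission
  imports Defs
begin

text \<open>
  The equivalence is an instance of Morita theory.  Modules over the category of trees are the same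
  as linear modules over its linearization, and the category \<open>\<E>\<close> consists of the arrows \<open>e\<^sub>A f e\<^sub>B\<close>
  of the linearization, for an idempotent \<open>e\<^sub>A\<close> on every object \<open>A\<close>.  For an admissible edge \<open>a \<lessdot> b\<close>
  of a non-minimal tree, let \<open>p\<^sub>b\<close> be the endomorphism that moves \<open>b\<close> to its parent \<open>a\<close> and fixes all
  other vertices: the contraction followed by its section through \<open>a\<close>.  These idempotent maps satisfy
  the relations of Kiselman's semigroup, so the product \<open>e\<^sub>A\<close> of all \<open>1 - p\<^sub>b\<close>, taken in the order of
  the tree, is an idempotent with \<open>p\<^sub>b e\<^sub>A = e\<^sub>A p\<^sub>b = 0\<close> (\<open>push_idem\<close>).  For minimal objects it is \<open>1\<close>.

  A morphism \<open>f : B \<rightarrow> A\<close> that is not an embedding collapses an admissible edge of \<open>B\<close>, and \<open>B\<close> is not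
  minimal (\<open>Hom_cases\<close>).  Then \<open>f = f p\<^sub>b\<close> for the upper end \<open>b\<close> of that edge, and \<open>f e\<^sub>B = 0\<close>.
  Dually, if \<open>f\<close> misses the upper end \<open>b\<close> of an admissible edge of \<open>A\<close>, then \<open>p\<^sub>b f = f\<close> and
  \<open>e\<^sub>A f = 0\<close>.  Vertices missed by an embedding are flexible, and condition (C2) implies that a
  flexible vertex is the root or the upper end of an admissible edge (\<open>flexible_cases\<close>).  So
  \<open>e\<^sub>A f e\<^sub>B \<noteq> 0\<close> is only possible for embeddings that miss at most the root, which gives the
  condition on the numbers of vertices.  The same vanishing, together with the fact that \<open>e\<^sub>A\<close> is \<open>1\<close>
  modulo the ideal spanned by the non-injective endomorphisms, identifies the endomorphisms of \<open>A\<close> in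
  \<open>\<E>\<close> with the group algebra (\<open>End_corner_iso\<close>).

  The identity of \<open>A\<close> is \<open>e\<^sub>A\<close> plus combinations of maps that factor through contractions of \<open>A\<close>, which
  by condition (C1) are objects of the category with fewer vertices.  By induction the identity is a
  sum \<open>\<Sum>\<^sub>i u\<^sub>i w\<^sub>i\<close> of maps through the objects \<open>e\<^sub>B\<close> of \<open>\<E>\<close> (\<open>Idm_in_trace\<close>).  For any linear category
  with idempotents of this kind, restriction of modules to the corner is an equivalence; it is shown to
  be fully faithful and essentially surjective.  A module over the corner is extended by the images of
  idempotent matrices on finite direct sums, and these stay within the given universe because an
  infinite type contains its own finite tuples.
\<close>

section \<open>Linear maps and modules\<close>

lemma linear_mapI:
  assumes "\<And>x. x \<in> carrier M \<Longrightarrow> f x \<in> carrier N"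
    and "\<And>x y. x \<in> carrier M \<Longrightarrow> y \<in> carrier M \<Longrightarrow> f (x \<oplus>\<^bsub>M\<^esub> y) = f x \<oplus>\<^bsub>N\<^esub> f y"
    and "\<And>r x. r \<in> carrier R \<Longrightarrow> x \<in> carrier M \<Longrightarrow> f (r \<odot>\<^bsub>M\<^esub> x) = r \<odot>\<^bsub>N\<^esub> f x"
  shows "linear_map R M N f"
  using assms by (auto simp: linear_map_def)

lemma linear_mapD:
  assumes "linear_map R M N f"
  shows "x \<in> carrier M \<Longrightarrow> f x \<in> carrier N"
    and "x \<in> carrier M \<Longrightarrow> y \<in> carrier M \<Longrightarrow> f (x \<oplus>\<^bsub>M\<^esub> y) = f x \<oplus>\<^bsub>N\<^esub> f y"
    and "r \<in> carrier R \<Longrightarrow> x \<in> carrier M \<Longrightarrow> f (r \<odot>\<^bsub>M\<^esub> x) = r \<odot>\<^bsub>N\<^esub> f x"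
  using assms by (auto simp: linear_map_def)

lemma linear_map_cong:
  assumes "linear_map R M N f" "module R M" "\<And>x. x \<in> carrier M \<Longrightarrow> g x = f x"
  shows "linear_map R M N g"
proof -
  interpret module R M by fact
  show ?thesis
    using assms(1) assms(3) by (intro linear_mapI) (auto simp: linear_mapD)
qed

lemma linear_map_compose:
  assumes "linear_map R M N f" "linear_map R N P g"
  shows "linear_map R M P (\<lambda>x. g (f x))"
  using assms by (intro linear_mapI) (simp_all add: linear_mapD[OF assms(1)] linear_mapD[OF assms(2)])

lemma linear_map_zero:
  assumes "linear_map R M N f" "module R M" "module R N"
  shows "f \<zero>\<^bsub>M\<^esub> = \<zero>\<^bsub>N\<^esub>"
proof -
  interpret M: module R M by fact
  interpret N: module R N by fact
  have "f (\<zero>\<^bsub>R\<^esub> \<odot>\<^bsub>M\<^esub> \<zero>\<^bsub>M\<^esub>) = \<zero>\<^bsub>R\<^esub> \<odot>\<^bsub>N\<^esub> f \<zero>\<^bsub>M\<^esub>"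
    using assms(1) by (simp only: linear_mapD M.R.zero_closed M.M.zero_closed)
  then show ?thesis
    using linear_mapD(1)[OF assms(1) M.M.zero_closed] by simp
qed

lemma linear_map_minus:
  assumes "linear_map R M N f" "module R M" "module R N" "x \<in> carrier M" "y \<in> carrier M"
  shows "f (x \<ominus>\<^bsub>M\<^esub> y) = f x \<ominus>\<^bsub>N\<^esub> f y"
proof -
  interpret M: module R M by fact
  interpret N: module R N by fact
  have neg: "f (\<ominus>\<^bsub>M\<^esub> y) = \<ominus>\<^bsub>N\<^esub> f y"
  proof -
    have "\<ominus>\<^bsub>M\<^esub> y = (\<ominus>\<^bsub>R\<^esub> \<one>\<^bsub>R\<^esub>) \<odot>\<^bsub>M\<^esub> y"
      using assms(5) by (simp add: M.smult_l_minus)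
    then show ?thesis
      using assms(5) linear_mapD[OF assms(1)] by (simp add: N.smult_l_minus)
  qed
  show ?thesis
    using assms(4,5) neg linear_mapD[OF assms(1)] by (simp add: a_minus_def)
qed

lemma linear_map_finsum:
  assumes f: "linear_map R M N f" and M: "module R M" and N: "module R N"
    and x: "\<And>i. i \<in> I \<Longrightarrow> x i \<in> carrier M"
  shows "f (\<Oplus>\<^bsub>M\<^esub>i\<in>I. x i) = (\<Oplus>\<^bsub>N\<^esub>i\<in>I. f (x i))"
proof -
  interpret M: module R M by fact
  interpret N: module R N by fact
  show ?thesis
  proof (cases "finite I")
    case True
    then show ?thesis using x
    proof (induction I rule: finite_induct)
      case empty
      then show ?case using linear_map_zero[OF f M N] by simp
    next
      case (insert i I)
      then have "x \<in> I \<rightarrow> carrier M" "(\<lambda>i. f (x i)) \<in> I \<rightarrow> carrier N"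
        using linear_mapD(1)[OF f] by auto
      then show ?case
        using insert linear_mapD[OF f] by (simp add: M.M.finsum_insert N.M.finsum_insert)
    qed
  next
    case False
    then show ?thesis using linear_map_zero[OF f M N] by (simp add: M.M.finsum_infinite N.M.finsum_infinite)
  qed
qed

lemma linear_map_sum:
  assumes "module R M" "module R N" "finite I" "\<And>i. i \<in> I \<Longrightarrow> linear_map R M N (f i)"
  shows "linear_map R M N (\<lambda>x. \<Oplus>\<^bsub>N\<^esub>i\<in>I. f i x)"
proof -
  interpret M: module R M by fact
  interpret N: module R N by fact
  have cl: "(\<lambda>i. f i x) \<in> I \<rightarrow> carrier N" if "x \<in> carrier M" for x
    using that linear_mapD(1)[OF assms(4)] by auto
  show ?thesis
  proof (intro linear_mapI)
    fix x y assume x: "x \<in> carrier M" and y: "y \<in> carrier M"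
    have "(\<Oplus>\<^bsub>N\<^esub>i\<in>I. f i (x \<oplus>\<^bsub>M\<^esub> y)) = (\<Oplus>\<^bsub>N\<^esub>i\<in>I. f i x \<oplus>\<^bsub>N\<^esub> f i y)"
      using x y cl linear_mapD[OF assms(4)] by (intro N.M.finsum_cong') auto
    then show "(\<Oplus>\<^bsub>N\<^esub>i\<in>I. f i (x \<oplus>\<^bsub>M\<^esub> y)) = (\<Oplus>\<^bsub>N\<^esub>i\<in>I. f i x) \<oplus>\<^bsub>N\<^esub> (\<Oplus>\<^bsub>N\<^esub>i\<in>I. f i y)"
      using x y cl by (simp add: N.M.finsum_addf)
  next
    fix r x assume r: "r \<in> carrier R" and x: "x \<in> carrier M"
    have "(\<Oplus>\<^bsub>N\<^esub>i\<in>I. f i (r \<odot>\<^bsub>M\<^esub> x)) = (\<Oplus>\<^bsub>N\<^esub>i\<in>I. r \<odot>\<^bsub>N\<^esub> f i x)"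
      using x r cl linear_mapD[OF assms(4)] by (intro N.M.finsum_cong') auto
    then show "(\<Oplus>\<^bsub>N\<^esub>i\<in>I. f i (r \<odot>\<^bsub>M\<^esub> x)) = r \<odot>\<^bsub>N\<^esub> (\<Oplus>\<^bsub>N\<^esub>i\<in>I. f i x)"
      using x r cl assms(3) by (simp add: N.finsum_smult_ldistr)
  qed (use cl in auto)
qed

lemma linear_map_smult:
  assumes "module R M" "module R N" "r \<in> carrier R" "linear_map R M N f"
  shows "linear_map R M N (\<lambda>x. r \<odot>\<^bsub>N\<^esub> f x)"
proof -
  interpret M: module R M by fact
  interpret N: module R N by fact
  show ?thesis
    using assms(3) linear_mapD[OF assms(4)]
    by (intro linear_mapI) (simp_all add: N.smult_r_distr N.smult_assoc1[symmetric] M.m_comm)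
qed

lemma module_restrict_carrier:
  assumes "module R M" "S \<subseteq> carrier M" "\<zero>\<^bsub>M\<^esub> \<in> S"
    and "\<And>x y. x \<in> S \<Longrightarrow> y \<in> S \<Longrightarrow> x \<oplus>\<^bsub>M\<^esub> y \<in> S"
    and sm: "\<And>r x. r \<in> carrier R \<Longrightarrow> x \<in> S \<Longrightarrow> r \<odot>\<^bsub>M\<^esub> x \<in> S"
  shows "module R (M\<lparr>carrier := S\<rparr>)"
proof -
  interpret module R M by fact
  have "\<ominus>\<^bsub>M\<^esub> x \<in> S" if "x \<in> S" for x
  proof -
    have "\<ominus>\<^bsub>M\<^esub> x = (\<ominus>\<^bsub>R\<^esub> \<one>\<^bsub>R\<^esub>) \<odot>\<^bsub>M\<^esub> x" using that assms(2) by (auto simp: smult_l_minus)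
    then show ?thesis using that sm[of "\<ominus>\<^bsub>R\<^esub> \<one>\<^bsub>R\<^esub>" x] by simp
  qed
  then have "submodule S R M" using assms by (intro submoduleI)
  then show ?thesis using submodule.submodule_is_module assms(1) by blast
qed

text \<open>Images of idempotents are formed as sets of fixed points, which are submodules for any
  endomorphism.\<close>

lemma module_fixed_points:
  assumes "module R M" "linear_map R M M f"
  shows "module R (M\<lparr>carrier := {x \<in> carrier M. f x = x}\<rparr>)"
proof -
  interpret module R M by fact
  show ?thesis
    using linear_mapD[OF assms(2)] linear_map_zero[OF assms(2) assms(1) assms(1)]
    by (intro module_restrict_carrier assms(1)) auto
qed

lemma finsum_restrict_carrier:
  assumes "module R M" "module R (M\<lparr>carrier := S\<rparr>)" "S \<subseteq> carrier M" "\<And>i. i \<in> I \<Longrightarrow> x i \<in> S"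
  shows "finsum (M\<lparr>carrier := S\<rparr>) x I = finsum M x I"
proof -
  have "linear_map R (M\<lparr>carrier := S\<rparr>) M (\<lambda>x. x)"
    using assms(3) by (auto intro!: linear_mapI)
  from linear_map_finsum[OF this assms(2,1), of I x] assms(4) show ?thesis by simp
qed


section \<open>Free modules on finite sets\<close>

definition free_module :: "('r, 'x) ring_scheme \<Rightarrow> 's set \<Rightarrow> ('r, 's \<Rightarrow> 'r) module" where
  "free_module R S = \<lparr>carrier = S \<rightarrow>\<^sub>E carrier R, mult = undefined, one = undefined,
    zero = (\<lambda>s\<in>S. \<zero>\<^bsub>R\<^esub>), add = (\<lambda>u v. \<lambda>s\<in>S. u s \<oplus>\<^bsub>R\<^esub> v s),
    smult = (\<lambda>r u. \<lambda>s\<in>S. r \<otimes>\<^bsub>R\<^esub> u s)\<rparr>"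

definition single :: "('r, 'x) ring_scheme \<Rightarrow> 's set \<Rightarrow> 's \<Rightarrow> 's \<Rightarrow> 'r" where
  "single R S t = (\<lambda>s\<in>S. if s = t then \<one>\<^bsub>R\<^esub> else \<zero>\<^bsub>R\<^esub>)"

definition lin_ext ::
  "'s set \<Rightarrow> ('r, 'm, 'z) module_scheme \<Rightarrow> ('s \<Rightarrow> 'm) \<Rightarrow> ('s \<Rightarrow> 'r) \<Rightarrow> 'm" where
  "lin_ext S M x u = (\<Oplus>\<^bsub>M\<^esub>s\<in>S. u s \<odot>\<^bsub>M\<^esub> x s)"

lemma module_free_module:
  assumes "cring R" shows "module R (free_module R S)"
proof -
  interpret cring R by fact
  have "abelian_group (free_module R S)"
  proof (intro abelian_groupI)
    show "\<exists>y\<in>carrier (free_module R S). y \<oplus>\<^bsub>free_module R S\<^esub> x = \<zero>\<^bsub>free_module R S\<^esub>"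
      if "x \<in> carrier (free_module R S)" for x
      using that by (intro bexI[of _ "\<lambda>s\<in>S. \<ominus>\<^bsub>R\<^esub> x s"])
        (auto simp: free_module_def l_neg PiE_iff fun_eq_iff)
  qed (auto simp: free_module_def PiE_iff fun_eq_iff extensional_def a_ac)
  then show ?thesis
    using assms
    by (intro moduleI)
      (auto simp: free_module_def PiE_iff fun_eq_iff restrict_def extensional_def l_distr r_distr m_assoc)
qed

lemma single_in: "cring R \<Longrightarrow> single R S t \<in> carrier (free_module R S)"
  by (auto simp: single_def free_module_def cring.cring_simprules)

text \<open>Reading off a coefficient becomes a linear map with values in this module.\<close>

definition ring_module :: "('r, 'x) ring_scheme \<Rightarrow> ('r, 'r) module" where
  "ring_module R = \<lparr>carrier = carrier R, mult = undefined, one = undefined,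
    zero = \<zero>\<^bsub>R\<^esub>, add = (\<oplus>\<^bsub>R\<^esub>), smult = (\<otimes>\<^bsub>R\<^esub>)\<rparr>"

lemma module_ring_module:
  assumes "cring R" shows "module R (ring_module R)"
proof -
  interpret cring R by fact
  have "abelian_group (ring_module R)"
    by (intro abelian_groupI) (auto simp: ring_module_def a_ac intro: l_neg)
  then show ?thesis
    using assms by (intro moduleI) (auto simp: ring_module_def l_distr r_distr m_assoc)
qed

lemma finsum_ring_module: "finsum (ring_module R) f I = finsum R f I"
  by (simp add: finsum_def finprod_def ring_module_def)

lemma linear_map_eval: "s \<in> S \<Longrightarrow> linear_map R (free_module R S) (ring_module R) (\<lambda>u. u s)"
  by (intro linear_mapI) (auto simp: free_module_def ring_module_def)

lemma finsum_free_module_eval: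
  assumes "cring R" "s \<in> S" "\<And>i. i \<in> I \<Longrightarrow> x i \<in> carrier (free_module R S)"
  shows "(\<Oplus>\<^bsub>free_module R S\<^esub>i\<in>I. x i) s = (\<Oplus>\<^bsub>R\<^esub>i\<in>I. x i s)"
  using linear_map_finsum[OF linear_map_eval module_free_module module_ring_module, of s S R I x] assms
  by (simp add: finsum_ring_module)

lemma lin_ext_linear:
  assumes "finite S" "module R M" "\<And>s. s \<in> S \<Longrightarrow> x s \<in> carrier M"
  shows "linear_map R (free_module R S) M (lin_ext S M x)"
proof -
  interpret module R M by fact
  have "linear_map R (free_module R S) M (\<lambda>u. u s \<odot>\<^bsub>M\<^esub> x s)" if "s \<in> S" for s
    using that assms(3)[OF that]
    by (intro linear_mapI) (auto simp: free_module_def smult_l_distr smult_assoc1 dest!: PiE_mem)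
  then have "linear_map R (free_module R S) M (\<lambda>u. \<Oplus>\<^bsub>M\<^esub>s\<in>S. u s \<odot>\<^bsub>M\<^esub> x s)"
    using assms module_free_module[OF R.is_cring] by (intro linear_map_sum) auto
  then show ?thesis by (simp add: lin_ext_def[abs_def])
qed

lemma lin_ext_single:
  assumes "finite S" "module R M" "\<And>s. s \<in> S \<Longrightarrow> x s \<in> carrier M" "t \<in> S"
  shows "lin_ext S M x (single R S t) = x t"
proof -
  interpret module R M by fact
  have "lin_ext S M x (single R S t) = (\<Oplus>\<^bsub>M\<^esub>s\<in>S. if t = s then x s else \<zero>\<^bsub>M\<^esub>)"
    unfolding lin_ext_def using assms by (intro M.finsum_cong') (auto simp: single_def)
  then show ?thesis using assms by (simp add: M.finsum_singleton Pi_iff)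
qed

lemma lin_ext_single_self:
  assumes "cring R" "finite S" "u \<in> carrier (free_module R S)"
  shows "lin_ext S (free_module R S) (single R S) u = u"
proof -
  interpret cring R by fact
  interpret F: module R "free_module R S" by (rule module_free_module) fact
  have "lin_ext S (free_module R S) (single R S) u s = u s" if s: "s \<in> S" for s
  proof -
    have u: "\<And>t. t \<in> S \<Longrightarrow> u t \<in> carrier R" using assms(3) by (auto simp: free_module_def)
    have "lin_ext S (free_module R S) (single R S) u s = (\<Oplus>\<^bsub>R\<^esub>t\<in>S. (u t \<odot>\<^bsub>free_module R S\<^esub> single R S t) s)"
      unfolding lin_ext_def
      using u single_in[OF assms(1)] s by (intro finsum_free_module_eval assms(1) F.smult_closed) auto
    also have "\<dots> = (\<Oplus>\<^bsub>R\<^esub>t\<in>S. if s = t then u t else \<zero>\<^bsub>R\<^esub>)"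
      using u s by (intro finsum_cong') (auto simp: free_module_def single_def)
    also have "\<dots> = u s" using u s assms(2) by (simp add: finsum_singleton Pi_iff)
    finally show ?thesis .
  qed
  moreover have "lin_ext S (free_module R S) (single R S) u \<in> carrier (free_module R S)"
    using assms F.module_axioms by (intro linear_mapD(1)[OF lin_ext_linear[where R = R]] single_in)
  ultimately show ?thesis
    using assms(3) by (intro extensionalityI[of _ S]) (auto simp: free_module_def PiE_def)
qed

text \<open>Multilinear identities (associativity, functoriality, naturality) are proved with this lemma,
  one argument at a time, by reduction to basis elements.\<close>

lemma linear_map_eq_on_single:
  assumes f: "linear_map R (free_module R S) M f" and g: "linear_map R (free_module R S) M g"
    and M: "module R M" and S: "finite S"
    and eq: "\<And>s. s \<in> S \<Longrightarrow> f (single R S s) = g (single R S s)"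
    and u: "u \<in> carrier (free_module R S)"
  shows "f u = g u"
proof -
  interpret M: module R M by fact
  interpret F: module R "free_module R S" by (rule module_free_module) (rule M.R.is_cring)
  let ?F = "free_module R S"
  have us: "\<And>t. t \<in> S \<Longrightarrow> u t \<in> carrier R" using u by (auto simp: free_module_def)
  have expand: "h u = (\<Oplus>\<^bsub>M\<^esub>s\<in>S. u s \<odot>\<^bsub>M\<^esub> h (single R S s))" if h: "linear_map R ?F M h" for h
  proof -
    have "h u = h (\<Oplus>\<^bsub>?F\<^esub>s\<in>S. u s \<odot>\<^bsub>?F\<^esub> single R S s)"
      using lin_ext_single_self[OF M.R.is_cring S u] by (simp add: lin_ext_def)
    also have "\<dots> = (\<Oplus>\<^bsub>M\<^esub>s\<in>S. h (u s \<odot>\<^bsub>?F\<^esub> single R S s))"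
      using us single_in[OF M.R.is_cring] by (intro linear_map_finsum[OF h F.module_axioms M] F.smult_closed) auto
    also have "\<dots> = (\<Oplus>\<^bsub>M\<^esub>s\<in>S. u s \<odot>\<^bsub>M\<^esub> h (single R S s))"
      proof (intro M.M.finsum_cong' refl Pi_I)
      fix s assume "s \<in> S"
      then show "u s \<odot>\<^bsub>M\<^esub> h (single R S s) \<in> carrier M"
        by (intro M.smult_closed us linear_mapD(1)[OF h] single_in M.R.is_cring)
      show "h (u s \<odot>\<^bsub>?F\<^esub> single R S s) = u s \<odot>\<^bsub>M\<^esub> h (single R S s)" if "s \<in> S" for s
        using that by (intro linear_mapD(3)[OF h] us single_in M.R.is_cring)
    qed
    finally show ?thesis .
  qed
  have "(\<Oplus>\<^bsub>M\<^esub>s\<in>S. u s \<odot>\<^bsub>M\<^esub> f (single R S s)) = (\<Oplus>\<^bsub>M\<^esub>s\<in>S. u s \<odot>\<^bsub>M\<^esub> g (single R S s))"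
    using eq by (intro M.M.finsum_cong' refl Pi_I M.smult_closed us linear_mapD(1)[OF g] single_in M.R.is_cring) auto
  then show ?thesis using expand[OF f] expand[OF g] by simp
qed


section \<open>Equivalences from fully faithful, essentially surjective functors\<close>

definition fully_faithful ::
  "('o, 'a, 'z) cat_scheme \<Rightarrow> ('p, 'b, 'w) cat_scheme \<Rightarrow> ('o, 'a, 'p, 'b) fctr \<Rightarrow> bool" where
  "fully_faithful C D F \<longleftrightarrow>
    (\<forall>X\<in>Ob C. \<forall>Y\<in>Ob C. bij_betw (amap F X Y) (Hom C X Y) (Hom D (omap F X) (omap F Y)))"

definition essentially_surjective ::
  "('o, 'a, 'z) cat_scheme \<Rightarrow> ('p, 'b, 'w) cat_scheme \<Rightarrow> ('o, 'a, 'p, 'b) fctr \<Rightarrow> bool" where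
  "essentially_surjective C D F \<longleftrightarrow> (\<forall>Z\<in>Ob D. \<exists>X\<in>Ob C. \<exists>f. is_iso_in D (omap F X) Z f)"

lemma is_functorD:
  assumes "is_functor C D F"
  shows "category C" "category D"
    and "X \<in> Ob C \<Longrightarrow> omap F X \<in> Ob D"
    and "X \<in> Ob C \<Longrightarrow> Y \<in> Ob C \<Longrightarrow> f \<in> Hom C X Y \<Longrightarrow> amap F X Y f \<in> Hom D (omap F X) (omap F Y)"
    and "X \<in> Ob C \<Longrightarrow> amap F X X (Idm C X) = Idm D (omap F X)"
    and "X \<in> Ob C \<Longrightarrow> Y \<in> Ob C \<Longrightarrow> Z \<in> Ob C \<Longrightarrow> f \<in> Hom C X Y \<Longrightarrow> g \<in> Hom C Y Z \<Longrightarrow>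
      amap F X Z (Comp C X Y Z g f) =
        Comp D (omap F X) (omap F Y) (omap F Z) (amap F Y Z g) (amap F X Y f)"
  using assms by (auto simp: is_functor_def)

lemma (in category) cancel_inverse:
  assumes "X \<in> Ob C" "Y \<in> Ob C" "Z \<in> Ob C" "f \<in> Hom C X Y" "g \<in> Hom C Y Z" "h \<in> Hom C Z Y"
    and "Comp C Y Z Y h g = Idm C Y"
  shows "Comp C X Z Y h (Comp C X Y Z g f) = f"
  using assms by (metis Comp_assoc Comp_Idm_left)

text \<open>An inverse functor picks a preimage of every object up to isomorphism, conjugates arrows by the
  chosen isomorphisms and lifts the result, uniquely, along the bijections on hom-sets.  Both
  composites are then isomorphic to the identity by the chosen isomorphisms and their lifts.\<close>

theorem equivalent_categoriesI:
  assumes F: "is_functor C D F" and ff: "fully_faithful C D F"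
    and es: "essentially_surjective C D F"
  shows "equivalent_categories C D"
proof -
  interpret C: category C by (rule is_functorD[OF F])
  interpret D: category D by (rule is_functorD[OF F])
  note F_ob = is_functorD(3)[OF F] and F_in = is_functorD(4)[OF F]
    and F_id = is_functorD(5)[OF F] and F_comp = is_functorD(6)[OF F]
  have "\<forall>Z\<in>Ob D. \<exists>X f g. X \<in> Ob C \<and> f \<in> Hom D (omap F X) Z \<and> g \<in> Hom D Z (omap F X) \<and>
      Comp D (omap F X) Z (omap F X) g f = Idm D (omap F X) \<and> Comp D Z (omap F X) Z f g = Idm D Z"
    using es by (fastforce simp: essentially_surjective_def is_iso_in_def)
  then obtain G0 e e' where e:
    "\<And>Z. Z \<in> Ob D \<Longrightarrow> G0 Z \<in> Ob C"
    "\<And>Z. Z \<in> Ob D \<Longrightarrow> e Z \<in> Hom D (omap F (G0 Z)) Z"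
    "\<And>Z. Z \<in> Ob D \<Longrightarrow> e' Z \<in> Hom D Z (omap F (G0 Z))"
    "\<And>Z. Z \<in> Ob D \<Longrightarrow> Comp D (omap F (G0 Z)) Z (omap F (G0 Z)) (e' Z) (e Z) = Idm D (omap F (G0 Z))"
    "\<And>Z. Z \<in> Ob D \<Longrightarrow> Comp D Z (omap F (G0 Z)) Z (e Z) (e' Z) = Idm D Z"
    by metis
  define lift where "lift X Y = inv_into (Hom C X Y) (amap F X Y)" for X Y
  have lift_in: "lift X Y g \<in> Hom C X Y" and F_lift: "amap F X Y (lift X Y g) = g"
    if "X \<in> Ob C" "Y \<in> Ob C" "g \<in> Hom D (omap F X) (omap F Y)" for X Y g
    using that ff unfolding fully_faithful_def lift_def
    by (auto simp: bij_betw_def intro: inv_into_into f_inv_into_f)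
  have faithful: "f = g" if "X \<in> Ob C" "Y \<in> Ob C" "f \<in> Hom C X Y" "g \<in> Hom C X Y"
    "amap F X Y f = amap F X Y g" for X Y f g
    using that ff unfolding fully_faithful_def bij_betw_def inj_on_def by blast
  define conj where "conj Z W g = Comp D (omap F (G0 Z)) W (omap F (G0 W)) (e' W)
      (Comp D (omap F (G0 Z)) Z W g (e Z))" for Z W g
  define G where "G = \<lparr>omap = G0, amap = (\<lambda>Z W g. lift (G0 Z) (G0 W) (conj Z W g))\<rparr>"
  have conj_in: "conj Z W g \<in> Hom D (omap F (G0 Z)) (omap F (G0 W))"
    if "Z \<in> Ob D" "W \<in> Ob D" "g \<in> Hom D Z W" for Z W g
    unfolding conj_def using that by (intro D.Comp_in F_ob e) auto
  have e_conj: "Comp D (omap F (G0 Z)) (omap F (G0 W)) W (e W) (conj Z W g) =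
      Comp D (omap F (G0 Z)) Z W g (e Z)" if "Z \<in> Ob D" "W \<in> Ob D" "g \<in> Hom D Z W" for Z W g
    unfolding conj_def using that by (intro D.cancel_inverse D.Comp_in F_ob e) auto
  have G_in: "amap G Z W g \<in> Hom C (G0 Z) (G0 W)" and F_G: "amap F (G0 Z) (G0 W) (amap G Z W g) = conj Z W g"
    if "Z \<in> Ob D" "W \<in> Ob D" "g \<in> Hom D Z W" for Z W g
    using lift_in F_lift e(1) conj_in that by (auto simp: G_def)
  have G_ob: "omap G Z = G0 Z" for Z by (simp add: G_def)
  have G: "is_functor D C G"
    unfolding is_functor_def
  proof (intro conjI ballI)
    fix Z assume Z: "Z \<in> Ob D"
    have "conj Z Z (Idm D Z) = Idm D (omap F (G0 Z))"
      unfolding conj_def using Z e F_ob by (simp add: D.Comp_Idm_left)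
    then show "amap G Z Z (Idm D Z) = Idm C (omap G Z)"
      using Z e(1) G_in F_G C.Idm_in D.Idm_in F_id
      by (intro faithful[of "G0 Z" "G0 Z"]) (auto simp: G_ob)
  next
    fix X Y Z f g assume X: "X \<in> Ob D" and Y: "Y \<in> Ob D" and Z: "Z \<in> Ob D"
      and f: "f \<in> Hom D X Y" and g: "g \<in> Hom D Y Z"
    have "Comp D (omap F (G0 X)) (omap F (G0 Y)) (omap F (G0 Z)) (conj Y Z g) (conj X Y f) =
        Comp D (omap F (G0 X)) Z (omap F (G0 Z)) (e' Z)
          (Comp D (omap F (G0 X)) (omap F (G0 Y)) Z (Comp D (omap F (G0 Y)) Y Z g (e Y)) (conj X Y f))"
      unfolding conj_def[of Y Z g]
      using X Y Z f g by (intro D.Comp_assoc F_ob e conj_in D.Comp_in) auto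
    also have "Comp D (omap F (G0 X)) (omap F (G0 Y)) Z (Comp D (omap F (G0 Y)) Y Z g (e Y)) (conj X Y f) =
        Comp D (omap F (G0 X)) Y Z g (Comp D (omap F (G0 X)) X Y f (e X))"
      using X Y Z f g e conj_in F_ob by (simp add: D.Comp_assoc e_conj)
    also have "\<dots> = Comp D (omap F (G0 X)) X Z (Comp D X Y Z g f) (e X)"
      using X Y Z f g e F_ob by (simp add: D.Comp_assoc)
    finally have "Comp D (omap F (G0 X)) (omap F (G0 Y)) (omap F (G0 Z)) (conj Y Z g) (conj X Y f) =
        conj X Z (Comp D X Y Z g f)"
      by (simp add: conj_def)
    then show "amap G X Z (Comp D X Y Z g f) =
        Comp C (omap G X) (omap G Y) (omap G Z) (amap G Y Z g) (amap G X Y f)"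
      using X Y Z f g e(1) G_in F_G D.Comp_in
      by (intro faithful[of "G0 X" "G0 Z"]) (auto simp: G_ob F_comp intro: C.Comp_in)
  qed (use G_in G_ob e(1) C.category_axioms D.category_axioms in auto)
  have "nat_isomorphic D D (comp_functor F G) id_functor"
    unfolding nat_isomorphic_def is_nat_trans_def is_iso_in_def
    using e by (intro exI[of _ e] conjI ballI bexI[of _ "e' _"])
      (auto simp: comp_functor_def id_functor_def G_ob F_G e_conj)
  moreover have "nat_isomorphic C C (comp_functor G F) id_functor"
  proof -
    define h where "h X = lift (G0 (omap F X)) X (e (omap F X))" for X
    define h' where "h' X = lift X (G0 (omap F X)) (e' (omap F X))" for X
    have h: "h X \<in> Hom C (G0 (omap F X)) X" "amap F (G0 (omap F X)) X (h X) = e (omap F X)"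
      and h': "h' X \<in> Hom C X (G0 (omap F X))" "amap F X (G0 (omap F X)) (h' X) = e' (omap F X)"
      if "X \<in> Ob C" for X
      using that lift_in F_lift e F_ob by (auto simp: h_def h'_def)
    have "Comp C (G0 (omap F X)) (G0 (omap F Y)) Y (h Y) (amap G (omap F X) (omap F Y) (amap F X Y f)) =
        Comp C (G0 (omap F X)) X Y f (h X)" if "X \<in> Ob C" "Y \<in> Ob C" "f \<in> Hom C X Y" for X Y f
      using that h e(1) F_ob F_in G_in
      by (intro faithful[of "G0 (omap F X)" Y]) (auto simp: F_comp F_G e_conj intro!: C.Comp_in)
    moreover have "Comp C (G0 (omap F X)) X (G0 (omap F X)) (h' X) (h X) = Idm C (G0 (omap F X))"
      if "X \<in> Ob C" for X
      using that h h' e F_ob F_in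
      by (intro faithful[of "G0 (omap F X)" "G0 (omap F X)"])
        (auto simp: F_comp F_id intro!: C.Comp_in C.Idm_in)
    moreover have "Comp C X (G0 (omap F X)) X (h X) (h' X) = Idm C X" if "X \<in> Ob C" for X
      using that h h' e F_ob F_in
      by (intro faithful[of X X]) (auto simp: F_comp F_id intro!: C.Comp_in C.Idm_in)
    ultimately show ?thesis
      unfolding nat_isomorphic_def is_nat_trans_def is_iso_in_def using h(1) h'(1)
      by (intro exI[of _ h] conjI ballI bexI[of _ "h' _"])
        (auto simp: comp_functor_def id_functor_def G_ob)
  qed
  ultimately show ?thesis
    using F G unfolding equivalent_categories_def by blast
qed

lemma is_functor_comp_functor:
  assumes "is_functor C D F" "is_functor D E G"
  shows "is_functor C E (comp_functor G F)"
  using assms by (auto simp: is_functor_def comp_functor_def)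

lemma fully_faithful_comp_functor:
  assumes "is_functor C D F" "fully_faithful C D F" "fully_faithful D E G"
  shows "fully_faithful C E (comp_functor G F)"
  unfolding fully_faithful_def
proof (intro ballI)
  fix X Y assume "X \<in> Ob C" "Y \<in> Ob C"
  then have "bij_betw (amap F X Y) (Hom C X Y) (Hom D (omap F X) (omap F Y))"
    and "bij_betw (amap G (omap F X) (omap F Y)) (Hom D (omap F X) (omap F Y))
      (Hom E (omap G (omap F X)) (omap G (omap F Y)))"
    using assms by (auto simp: fully_faithful_def is_functor_def)
  from bij_betw_trans[OF this]
  show "bij_betw (amap (comp_functor G F) X Y) (Hom C X Y)
      (Hom E (omap (comp_functor G F) X) (omap (comp_functor G F) Y))"
    by (simp add: comp_functor_def comp_def)
qed

lemma is_functor_preserves_iso: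
  assumes "is_functor C D F" "X \<in> Ob C" "Y \<in> Ob C" "is_iso_in C X Y f"
  shows "is_iso_in D (omap F X) (omap F Y) (amap F X Y f)"
proof -
  obtain g where g: "f \<in> Hom C X Y" "g \<in> Hom C Y X" "Comp C X Y X g f = Idm C X" "Comp C Y X Y f g = Idm C Y"
    using assms(4) by (auto simp: is_iso_in_def)
  have "amap F X X (Comp C X Y X g f) = Comp D (omap F X) (omap F Y) (omap F X) (amap F Y X g) (amap F X Y f)"
    "amap F Y Y (Comp C Y X Y f g) = Comp D (omap F Y) (omap F X) (omap F Y) (amap F X Y f) (amap F Y X g)"
    using g(1,2) assms(2,3) by (auto intro!: is_functorD(6)[OF assms(1)])
  then show ?thesis
    unfolding is_iso_in_def using g assms
    by (intro conjI bexI[of _ "amap F Y X g"]) (auto simp: is_functorD)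
qed

lemma (in category) is_iso_in_Comp:
  assumes "X \<in> Ob C" "Y \<in> Ob C" "Z \<in> Ob C" "is_iso_in C X Y f" "is_iso_in C Y Z g"
  shows "is_iso_in C X Z (Comp C X Y Z g f)"
proof -
  obtain f' g' where fg: "f \<in> Hom C X Y" "f' \<in> Hom C Y X" "Comp C X Y X f' f = Idm C X"
    "Comp C Y X Y f f' = Idm C Y" "g \<in> Hom C Y Z" "g' \<in> Hom C Z Y" "Comp C Y Z Y g' g = Idm C Y"
    "Comp C Z Y Z g g' = Idm C Z"
    using assms(4,5) by (auto simp: is_iso_in_def)
  have "Comp C X Z X (Comp C Z Y X f' g') (Comp C X Y Z g f) = Idm C X"
    "Comp C Z X Z (Comp C X Y Z g f) (Comp C Z Y X f' g') = Idm C Z"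
    using assms(1-3) fg by (auto simp: Comp_assoc Comp_in cancel_inverse)
  then show ?thesis
    unfolding is_iso_in_def using fg assms(1-3)
    by (intro conjI bexI[of _ "Comp C Z Y X f' g'"]) (auto intro: Comp_in)
qed

lemma essentially_surjective_comp_functor:
  assumes F: "is_functor C D F" "essentially_surjective C D F"
    and G: "is_functor D E G" "essentially_surjective D E G"
  shows "essentially_surjective C E (comp_functor G F)"
  unfolding essentially_surjective_def
proof
  interpret E: category E by (rule is_functorD[OF G(1)])
  fix Z assume Z: "Z \<in> Ob E"
  obtain Y g where Y: "Y \<in> Ob D" and g: "is_iso_in E (omap G Y) Z g"
    using G(2) Z by (auto simp: essentially_surjective_def)
  obtain X f where X: "X \<in> Ob C" and f: "is_iso_in D (omap F X) Y f"
    using F(2) Y by (auto simp: essentially_surjective_def)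
  show "\<exists>X\<in>Ob C. \<exists>f. is_iso_in E (omap (comp_functor G F) X) Z f"
    using E.is_iso_in_Comp[OF _ _ Z is_functor_preserves_iso[OF G(1) _ Y f] g] X Y F(1) G(1)
    by (auto simp: comp_functor_def is_functorD(3))
qed

lemma functor_category_iso:
  assumes F: "is_functor C D F" and G: "is_functor C D G"
    and \<eta>: "\<eta> \<in> extensional (Ob C)" "is_nat_trans C D F G \<eta>"
    and iso: "\<And>X. X \<in> Ob C \<Longrightarrow> is_iso_in D (omap F X) (omap G X) (\<eta> X)"
  shows "is_iso_in (functor_category C D) F G \<eta>"
proof -
  interpret D: category D by (rule is_functorD[OF F])
  have "\<forall>X\<in>Ob C. \<exists>t. t \<in> Hom D (omap G X) (omap F X) \<and>
      Comp D (omap F X) (omap G X) (omap F X) t (\<eta> X) = Idm D (omap F X) \<and>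
      Comp D (omap G X) (omap F X) (omap G X) (\<eta> X) t = Idm D (omap G X)"
    using iso by (auto simp: is_iso_in_def)
  then obtain t where t: "\<And>X. X \<in> Ob C \<Longrightarrow> t X \<in> Hom D (omap G X) (omap F X)"
      "\<And>X. X \<in> Ob C \<Longrightarrow> Comp D (omap F X) (omap G X) (omap F X) (t X) (\<eta> X) = Idm D (omap F X)"
      "\<And>X. X \<in> Ob C \<Longrightarrow> Comp D (omap G X) (omap F X) (omap G X) (\<eta> X) (t X) = Idm D (omap G X)"
    by metis
  note obs = is_functorD(3)[OF F] is_functorD(3)[OF G]
  note arr = is_functorD(4)[OF F] is_functorD(4)[OF G]
  have \<eta>_in: "\<And>X. X \<in> Ob C \<Longrightarrow> \<eta> X \<in> Hom D (omap F X) (omap G X)"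
    and nat: "\<And>X Y f. X \<in> Ob C \<Longrightarrow> Y \<in> Ob C \<Longrightarrow> f \<in> Hom C X Y \<Longrightarrow>
      Comp D (omap F X) (omap F Y) (omap G Y) (\<eta> Y) (amap F X Y f) =
      Comp D (omap F X) (omap G X) (omap G Y) (amap G X Y f) (\<eta> X)"
    using \<eta>(2) by (auto simp: is_nat_trans_def)
  have "Comp D (omap G X) (omap G Y) (omap F Y) (t Y) (amap G X Y f) =
      Comp D (omap G X) (omap F X) (omap F Y) (amap F X Y f) (t X)"
    if X: "X \<in> Ob C" and Y: "Y \<in> Ob C" and f: "f \<in> Hom C X Y" for X Y f
  proof -
    have "amap G X Y f = Comp D (omap G X) (omap G X) (omap G Y) (amap G X Y f)
        (Comp D (omap G X) (omap F X) (omap G X) (\<eta> X) (t X))"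
      using X Y f obs arr t by (simp add: D.Comp_Idm_right)
    also have "\<dots> = Comp D (omap G X) (omap F X) (omap G Y)
        (Comp D (omap F X) (omap F Y) (omap G Y) (\<eta> Y) (amap F X Y f)) (t X)"
      using X Y f obs arr t \<eta>_in nat by (metis D.Comp_assoc)
    also have "\<dots> = Comp D (omap G X) (omap F Y) (omap G Y) (\<eta> Y)
        (Comp D (omap G X) (omap F X) (omap F Y) (amap F X Y f) (t X))"
      using X Y f obs arr t \<eta>_in by (intro D.Comp_assoc) auto
    finally have eq: "amap G X Y f = Comp D (omap G X) (omap F Y) (omap G Y) (\<eta> Y)
        (Comp D (omap G X) (omap F X) (omap F Y) (amap F X Y f) (t X))" .
    show ?thesis
      unfolding eq using X Y f obs arr t \<eta>_in by (intro D.cancel_inverse D.Comp_in) auto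
  qed
  then show ?thesis
    unfolding is_iso_in_def using \<eta> t \<eta>_in
    by (intro conjI bexI[of _ "restrict t (Ob C)"])
      (auto simp: functor_category_def is_nat_trans_def fun_eq_iff)
qed


section \<open>Functors to modules, pointwise\<close>

type_synonym ('o, 'a, 'r, 'm) module_functor = "('o, 'a, ('r, 'm) module, 'm \<Rightarrow> 'm) fctr"

lemma mod_category_simps:
  "Ob (mod_category U R) = {M. module R M}"
  "Hom (mod_category U R) M N = {f \<in> extensional (carrier M). linear_map R M N f}"
  "Idm (mod_category U R) M = (\<lambda>x\<in>carrier M. x)"
  "Comp (mod_category U R) M N P g f = compose (carrier M) g f"
  "HomMod (mod_category U R) M N = linear_maps_module R M N"
  by (simp_all add: mod_category_def)

lemma is_functor_modI:
  fixes U :: "'m itself" and F :: "('o, 'a, 'r, 'm) module_functor"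
  assumes "category C"
    and "\<And>X. X \<in> Ob C \<Longrightarrow> module R (omap F X)"
    and "\<And>X Y f. X \<in> Ob C \<Longrightarrow> Y \<in> Ob C \<Longrightarrow> f \<in> Hom C X Y \<Longrightarrow> amap F X Y f \<in> extensional (carrier (omap F X))"
    and "\<And>X Y f. X \<in> Ob C \<Longrightarrow> Y \<in> Ob C \<Longrightarrow> f \<in> Hom C X Y \<Longrightarrow> linear_map R (omap F X) (omap F Y) (amap F X Y f)"
    and "\<And>X x. X \<in> Ob C \<Longrightarrow> x \<in> carrier (omap F X) \<Longrightarrow> amap F X X (Idm C X) x = x"
    and "\<And>X Y Z f g x. X \<in> Ob C \<Longrightarrow> Y \<in> Ob C \<Longrightarrow> Z \<in> Ob C \<Longrightarrow> f \<in> Hom C X Y \<Longrightarrow> g \<in> Hom C Y Z \<Longrightarrow>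
      x \<in> carrier (omap F X) \<Longrightarrow> amap F X Z (Comp C X Y Z g f) x = amap F Y Z g (amap F X Y f x)"
  shows "is_functor C (mod_category U R) F"
  unfolding is_functor_def
proof (intro conjI ballI)
  fix X assume "X \<in> Ob C"
  then show "amap F X X (Idm C X) = Idm (mod_category U R) (omap F X)"
    using assms(3)[of X X "Idm C X"] assms(5)[of X] category.Idm_in[OF assms(1)]
    by (intro extensionalityI[of _ "carrier (omap F X)"]) (auto simp: mod_category_simps)
next
  fix X Y Z f g assume "X \<in> Ob C" "Y \<in> Ob C" "Z \<in> Ob C" "f \<in> Hom C X Y" "g \<in> Hom C Y Z"
  then show "amap F X Z (Comp C X Y Z g f) = Comp (mod_category U R) (omap F X) (omap F Y) (omap F Z)
      (amap F Y Z g) (amap F X Y f)"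
    using assms(3)[of X Z "Comp C X Y Z g f"] assms(6)[of X Y Z f g] category.Comp_in[OF assms(1)]
    by (intro extensionalityI[of _ "carrier (omap F X)"]) (auto simp: mod_category_simps compose_def)
qed (use assms category_mod_category in \<open>auto simp: mod_category_simps\<close>)

lemma is_functor_modD:
  fixes U :: "'m itself" and F :: "('o, 'a, 'r, 'm) module_functor"
  assumes "is_functor C (mod_category U R) F"
  shows "category C"
    and "X \<in> Ob C \<Longrightarrow> module R (omap F X)"
    and "X \<in> Ob C \<Longrightarrow> Y \<in> Ob C \<Longrightarrow> f \<in> Hom C X Y \<Longrightarrow> amap F X Y f \<in> extensional (carrier (omap F X))"
    and "X \<in> Ob C \<Longrightarrow> Y \<in> Ob C \<Longrightarrow> f \<in> Hom C X Y \<Longrightarrow> linear_map R (omap F X) (omap F Y) (amap F X Y f)"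
    and "X \<in> Ob C \<Longrightarrow> x \<in> carrier (omap F X) \<Longrightarrow> amap F X X (Idm C X) x = x"
    and "X \<in> Ob C \<Longrightarrow> Y \<in> Ob C \<Longrightarrow> Z \<in> Ob C \<Longrightarrow> f \<in> Hom C X Y \<Longrightarrow> g \<in> Hom C Y Z \<Longrightarrow>
      x \<in> carrier (omap F X) \<Longrightarrow> amap F X Z (Comp C X Y Z g f) x = amap F Y Z g (amap F X Y f x)"
    and "X \<in> Ob C \<Longrightarrow> Y \<in> Ob C \<Longrightarrow> f \<in> Hom C X Y \<Longrightarrow> x \<in> carrier (omap F X) \<Longrightarrow>
      amap F X Y f x \<in> carrier (omap F Y)"
  using assms linear_mapD(1)[of R "omap F X" "omap F Y" "amap F X Y f" x]
  by (auto simp: is_functor_def mod_category_simps compose_def)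

text \<open>Linearity of the action on arrows is an equation between extensional maps of modules, so it can
  be tested on elements.\<close>

lemma is_linear_functor_modI:
  fixes U :: "'m itself" and F :: "('o, 'a, 'r, 'm) module_functor"
  assumes "linear_category R K" "is_functor K (mod_category U R) F"
    and add: "\<And>X Y f g x. X \<in> Ob K \<Longrightarrow> Y \<in> Ob K \<Longrightarrow> f \<in> Hom K X Y \<Longrightarrow> g \<in> Hom K X Y \<Longrightarrow> x \<in> carrier (omap F X) \<Longrightarrow>
      amap F X Y (f \<oplus>\<^bsub>HomMod K X Y\<^esub> g) x = amap F X Y f x \<oplus>\<^bsub>omap F Y\<^esub> amap F X Y g x"
    and smult: "\<And>X Y r f x. X \<in> Ob K \<Longrightarrow> Y \<in> Ob K \<Longrightarrow> r \<in> carrier R \<Longrightarrow> f \<in> Hom K X Y \<Longrightarrow> x \<in> carrier (omap F X) \<Longrightarrow>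
      amap F X Y (r \<odot>\<^bsub>HomMod K X Y\<^esub> f) x = r \<odot>\<^bsub>omap F Y\<^esub> amap F X Y f x"
  shows "is_linear_functor R K (mod_category U R) F"
  unfolding is_linear_functor_def
proof (intro conjI ballI assms)
  fix X Y assume X: "X \<in> Ob K" and Y: "Y \<in> Ob K"
  interpret K: linear_category R K by fact
  interpret H: module R "HomMod K X Y" by (rule K.module_HomMod[OF X Y])
  note car = K.carrier_HomMod[OF X Y]
  note ext = is_functor_modD(3)[OF assms(2) X Y]
  show "linear_map R (HomMod K X Y) (HomMod (mod_category U R) (omap F X) (omap F Y)) (amap F X Y)"
  proof (intro linear_mapI)
    fix f assume "f \<in> carrier (HomMod K X Y)"
    then show "amap F X Y f \<in> carrier (HomMod (mod_category U R) (omap F X) (omap F Y))"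
      using car X Y is_functor_modD[OF assms(2)]
      by (auto simp: mod_category_simps linear_maps_module_def)
  next
    fix f g assume f: "f \<in> carrier (HomMod K X Y)" and g: "g \<in> carrier (HomMod K X Y)"
    show "amap F X Y (f \<oplus>\<^bsub>HomMod K X Y\<^esub> g) =
        amap F X Y f \<oplus>\<^bsub>HomMod (mod_category U R) (omap F X) (omap F Y)\<^esub> amap F X Y g"
      using ext[of "f \<oplus>\<^bsub>HomMod K X Y\<^esub> g"] f g add[OF X Y] car H.M.a_closed
      by (intro extensionalityI[of _ "carrier (omap F X)"])
        (auto simp: mod_category_simps linear_maps_module_def)
  next
    fix r f assume r: "r \<in> carrier R" and f: "f \<in> carrier (HomMod K X Y)"
    show "amap F X Y (r \<odot>\<^bsub>HomMod K X Y\<^esub> f) =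
        r \<odot>\<^bsub>HomMod (mod_category U R) (omap F X) (omap F Y)\<^esub> amap F X Y f"
      using ext[of "r \<odot>\<^bsub>HomMod K X Y\<^esub> f"] r f smult[OF X Y] car H.smult_closed
      by (intro extensionalityI[of _ "carrier (omap F X)"])
        (auto simp: mod_category_simps linear_maps_module_def)
  qed
qed

lemma is_linear_functor_modD:
  fixes U :: "'m itself" and F :: "('o, 'a, 'r, 'm) module_functor"
  assumes "linear_category R K" "is_linear_functor R K (mod_category U R) F"
  shows "is_functor K (mod_category U R) F"
    and "X \<in> Ob K \<Longrightarrow> Y \<in> Ob K \<Longrightarrow> x \<in> carrier (omap F X) \<Longrightarrow>
      linear_map R (HomMod K X Y) (omap F Y) (\<lambda>f. amap F X Y f x)"
proof -
  interpret K: linear_category R K by fact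
  show F: "is_functor K (mod_category U R) F" using assms(2) by (simp add: is_linear_functor_def)
  assume X: "X \<in> Ob K" and Y: "Y \<in> Ob K" and x: "x \<in> carrier (omap F X)"
  have lin: "linear_map R (HomMod K X Y) (linear_maps_module R (omap F X) (omap F Y)) (amap F X Y)"
    using assms(2) X Y by (auto simp: is_linear_functor_def mod_category_simps)
  show "linear_map R (HomMod K X Y) (omap F Y) (\<lambda>f. amap F X Y f x)"
    using x is_functor_modD(7)[OF F X Y] K.carrier_HomMod[OF X Y]
    by (intro linear_mapI) (auto simp: linear_mapD(2,3)[OF lin] linear_maps_module_def)
qed

lemma is_nat_trans_mod_iff:
  fixes U :: "'m itself"
  shows "is_nat_trans C (mod_category U R) F G \<eta> \<longleftrightarrow>
    (\<forall>X\<in>Ob C. \<eta> X \<in> extensional (carrier (omap F X)) \<and> linear_map R (omap F X) (omap G X) (\<eta> X)) \<and>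
    (\<forall>X\<in>Ob C. \<forall>Y\<in>Ob C. \<forall>f\<in>Hom C X Y. \<forall>x\<in>carrier (omap F X).
      \<eta> Y (amap F X Y f x) = amap G X Y f (\<eta> X x))"
proof -
  have "compose A g f = compose A g' f' \<longleftrightarrow> (\<forall>x\<in>A. g (f x) = g' (f' x))" for A and g f g' f' :: "'m \<Rightarrow> 'm"
    by (auto simp: compose_def fun_eq_iff)
  then show ?thesis by (simp add: is_nat_trans_def mod_category_simps)
qed

lemma linear_Mod_over_simps:
  fixes U :: "'m itself"
  assumes "linear_category R E"
  shows "Ob (linear_Mod_over U R E) = {F. is_linear_functor R E (mod_category U R) F}"
    and "Hom (linear_Mod_over U R E) F G =
      {\<eta> \<in> extensional (Ob E). is_nat_trans E (mod_category U R) F G \<eta>}"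
    and "Idm (linear_Mod_over U R E) F = (\<lambda>X\<in>Ob E. \<lambda>x\<in>carrier (omap F X). x)"
    and "Comp (linear_Mod_over U R E) F G H \<tau> \<sigma> = (\<lambda>X\<in>Ob E. compose (carrier (omap F X)) (\<tau> X) (\<sigma> X))"
  by (auto simp: linear_Mod_over_def full_subcategory_def functor_category_def mod_category_simps
      is_linear_functor_def)

lemma Mod_over_simps:
  fixes U :: "'m itself"
  shows "Ob (Mod_over U R C) = {F. is_functor C (mod_category U R) F}"
    and "Hom (Mod_over U R C) F G =
      {\<eta> \<in> extensional (Ob C). is_nat_trans C (mod_category U R) F G \<eta>}"
    and "Idm (Mod_over U R C) F = (\<lambda>X\<in>Ob C. \<lambda>x\<in>carrier (omap F X). x)"
    and "Comp (Mod_over U R C) F G H \<tau> \<sigma> = (\<lambda>X\<in>Ob C. compose (carrier (omap F X)) (\<tau> X) (\<sigma> X))"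
  by (auto simp: Mod_over_def functor_category_def mod_category_simps)

lemma is_iso_in_modI:
  assumes "f \<in> extensional (carrier M)" "linear_map R M N f" "linear_map R N M g" "module R N"
    and "\<And>x. x \<in> carrier M \<Longrightarrow> g (f x) = x" "\<And>y. y \<in> carrier N \<Longrightarrow> f (g y) = y"
  shows "is_iso_in (mod_category U R) M N f"
  unfolding is_iso_in_def
proof (intro conjI bexI[of _ "restrict g (carrier N)"])
  show "restrict g (carrier N) \<in> Hom (mod_category U R) N M"
    using linear_map_cong[OF assms(3,4), of "restrict g (carrier N)"] by (auto simp: mod_category_simps)
qed (use assms linear_mapD(1)[OF assms(2)] linear_mapD(1)[OF assms(3)] in
    \<open>auto simp: mod_category_simps compose_def fun_eq_iff\<close>)

lemma linear_Mod_over_iso: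
  fixes U :: "'m itself" and F G :: "('o, 'a, 'r, 'm) module_functor"
  assumes K: "linear_category R K"
    and F: "is_linear_functor R K (mod_category U R) F" and G: "is_linear_functor R K (mod_category U R) G"
    and \<eta>: "\<And>X. X \<in> Ob K \<Longrightarrow> linear_map R (omap F X) (omap G X) (\<eta> X)"
    and \<theta>: "\<And>X. X \<in> Ob K \<Longrightarrow> linear_map R (omap G X) (omap F X) (\<theta> X)"
    and inv: "\<And>X x. X \<in> Ob K \<Longrightarrow> x \<in> carrier (omap F X) \<Longrightarrow> \<theta> X (\<eta> X x) = x"
      "\<And>X y. X \<in> Ob K \<Longrightarrow> y \<in> carrier (omap G X) \<Longrightarrow> \<eta> X (\<theta> X y) = y"
    and nat: "\<And>X Y f x. X \<in> Ob K \<Longrightarrow> Y \<in> Ob K \<Longrightarrow> f \<in> Hom K X Y \<Longrightarrow> x \<in> carrier (omap F X) \<Longrightarrow>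
      \<eta> Y (amap F X Y f x) = amap G X Y f (\<eta> X x)"
  shows "\<exists>\<eta>'. is_iso_in (linear_Mod_over U R K) F G \<eta>'"
proof -
  define \<eta>' where "\<eta>' = (\<lambda>X\<in>Ob K. restrict (\<eta> X) (carrier (omap F X)))"
  have F': "is_functor K (mod_category U R) F" and G': "is_functor K (mod_category U R) G"
    using F G by (auto simp: is_linear_functor_def)
  note mods = is_functor_modD(2)[OF F'] is_functor_modD(2)[OF G']
  have lin: "linear_map R (omap F X) (omap G X) (\<eta>' X)" if "X \<in> Ob K" for X
    using that by (intro linear_map_cong[OF \<eta>[OF that] mods(1)[OF that]]) (simp add: \<eta>'_def)
  have "is_iso_in (functor_category K (mod_category U R)) F G \<eta>'"
  proof (intro functor_category_iso F' G')
    show "is_nat_trans K (mod_category U R) F G \<eta>'"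
      using lin nat is_functor_modD(7)[OF F'] by (auto simp: is_nat_trans_mod_iff \<eta>'_def)
    show "is_iso_in (mod_category U R) (omap F X) (omap G X) (\<eta>' X)" if "X \<in> Ob K" for X
      using that lin[OF that] mods(2)[OF that] inv linear_mapD(1)[OF \<theta>[OF that]]
      by (intro is_iso_in_modI[OF _ _ \<theta>]) (auto simp: \<eta>'_def)
  qed (simp add: \<eta>'_def)
  then show ?thesis
    by (auto simp: linear_Mod_over_def full_subcategory_def is_iso_in_def)
qed


section \<open>Corners of linear categories\<close>

context linear_category
begin

lemma Comp_add_right:
  assumes "X \<in> Ob E" "Y \<in> Ob E" "Z \<in> Ob E" "g \<in> Hom E Y Z" "f \<in> Hom E X Y" "f' \<in> Hom E X Y"
  shows "Comp E X Y Z g (f \<oplus>\<^bsub>HomMod E X Y\<^esub> f') = Comp E X Y Z g f \<oplus>\<^bsub>HomMod E X Z\<^esub> Comp E X Y Z g f'"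
  using linear_mapD(2)[OF linear_Comp_right] assms by (simp add: carrier_HomMod)

lemma Comp_add_left:
  assumes "X \<in> Ob E" "Y \<in> Ob E" "Z \<in> Ob E" "f \<in> Hom E X Y" "g \<in> Hom E Y Z" "g' \<in> Hom E Y Z"
  shows "Comp E X Y Z (g \<oplus>\<^bsub>HomMod E Y Z\<^esub> g') f = Comp E X Y Z g f \<oplus>\<^bsub>HomMod E X Z\<^esub> Comp E X Y Z g' f"
  using linear_mapD(2)[OF linear_Comp_left] assms by (simp add: carrier_HomMod)

end

text \<open>A chosen idempotent endomorphism \<open>e X\<close> of every object cuts out the corner category with arrows
  \<open>e\<^sub>Y f e\<^sub>X\<close>: the full subcategory of the idempotent completion on the objects \<open>(X, e X)\<close>.\<close>

locale idempotent_family = linear_category R K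
  for R :: "('r, 'x) ring_scheme" and K :: "('o, 'a, 'r, 'z) lincat_scheme" +
  fixes e :: "'o \<Rightarrow> 'a"
  assumes e_in: "X \<in> Ob K \<Longrightarrow> e X \<in> Hom K X X"
    and e_idem: "X \<in> Ob K \<Longrightarrow> Comp K X X X (e X) (e X) = e X"
begin

definition corner_Hom :: "'o \<Rightarrow> 'o \<Rightarrow> 'a set" where
  "corner_Hom X Y = {f \<in> Hom K X Y. Comp K X X Y f (e X) = f \<and> Comp K X Y Y (e Y) f = f}"

definition corner :: "('o, 'a, 'r) lincat" where
  "corner = \<lparr>Ob = Ob K, Hom = corner_Hom, Idm = e, Comp = Comp K,
    HomMod = (\<lambda>X Y. (HomMod K X Y)\<lparr>carrier := corner_Hom X Y\<rparr>)\<rparr>"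

lemma corner_simps [simp]:
  "Ob corner = Ob K" "Hom corner = corner_Hom" "Idm corner = e" "Comp corner = Comp K"
  "HomMod corner X Y = (HomMod K X Y)\<lparr>carrier := corner_Hom X Y\<rparr>"
  by (simp_all add: corner_def)

lemma corner_HomI:
  "f \<in> Hom K X Y \<Longrightarrow> Comp K X X Y f (e X) = f \<Longrightarrow> Comp K X Y Y (e Y) f = f \<Longrightarrow> f \<in> corner_Hom X Y"
  by (simp add: corner_Hom_def)

lemma corner_HomD:
  assumes "f \<in> corner_Hom X Y"
  shows "f \<in> Hom K X Y" "Comp K X X Y f (e X) = f" "Comp K X Y Y (e Y) f = f"
  using assms by (simp_all add: corner_Hom_def)

lemma corner_Hom_Comp:
  assumes "X \<in> Ob K" "Y \<in> Ob K" "Z \<in> Ob K" "f \<in> Hom K X Y" "g \<in> Hom K Y Z"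
    and "Comp K X X Y f (e X) = f" "Comp K Y Z Z (e Z) g = g"
  shows "Comp K X Y Z g f \<in> corner_Hom X Z"
proof (rule corner_HomI)
  show "Comp K X X Z (Comp K X Y Z g f) (e X) = Comp K X Y Z g f"
    using assms e_in by (simp add: Comp_assoc)
  show "Comp K X Z Z (e Z) (Comp K X Y Z g f) = Comp K X Y Z g f"
    using assms e_in by (simp add: Comp_assoc[symmetric])
qed (use assms in \<open>auto intro: Comp_in\<close>)

lemma corner_Comp:
  assumes "X \<in> Ob K" "Y \<in> Ob K" "Z \<in> Ob K" "f \<in> corner_Hom X Y" "g \<in> corner_Hom Y Z"
  shows "Comp K X Y Z g f \<in> corner_Hom X Z"
  using assms by (intro corner_Hom_Comp) (auto dest: corner_HomD)

lemma e_corner: "X \<in> Ob K \<Longrightarrow> e X \<in> corner_Hom X X"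
  by (intro corner_HomI e_in e_idem)

lemma module_corner_Hom:
  assumes X: "X \<in> Ob K" and Y: "Y \<in> Ob K"
  shows "module R ((HomMod K X Y)\<lparr>carrier := corner_Hom X Y\<rparr>)"
proof -
  interpret H: module R "HomMod K X Y" by (rule module_HomMod[OF X Y])
  note car = carrier_HomMod[OF X Y]
  note l = linear_Comp_right[OF X Y Y e_in[OF Y]] and r = linear_Comp_left[OF X X Y e_in[OF X]]
  have "Comp K X Y Y (e Y) \<zero>\<^bsub>HomMod K X Y\<^esub> = \<zero>\<^bsub>HomMod K X Y\<^esub>"
    "Comp K X X Y \<zero>\<^bsub>HomMod K X Y\<^esub> (e X) = \<zero>\<^bsub>HomMod K X Y\<^esub>"
    using linear_map_zero[OF l] linear_map_zero[OF r] H.module_axioms by auto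
  then show ?thesis
    using linear_mapD[OF l] linear_mapD[OF r] H.M.zero_closed H.M.a_closed H.smult_closed
    by (intro module_restrict_carrier H.module_axioms) (auto simp: corner_Hom_def car)
qed

lemma linear_category_corner: "linear_category R corner"
proof (intro linear_category.intro category.intro linear_category_axioms.intro)
  fix X Y Z g assume X: "X \<in> Ob corner" and Y: "Y \<in> Ob corner" and Z: "Z \<in> Ob corner"
    and g: "g \<in> Hom corner Y Z"
  then show "linear_map R (HomMod corner X Y) (HomMod corner X Z) (\<lambda>f. Comp corner X Y Z g f)"
    using linear_Comp_right[of X Y Z g] corner_HomD(1) carrier_HomMod
    by (intro linear_mapI) (auto simp: corner_Comp linear_map_def)
next
  fix X Y Z f assume X: "X \<in> Ob corner" and Y: "Y \<in> Ob corner" and Z: "Z \<in> Ob corner"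
    and f: "f \<in> Hom corner X Y"
  then show "linear_map R (HomMod corner Y Z) (HomMod corner X Z) (\<lambda>g. Comp corner X Y Z g f)"
    using linear_Comp_left[of X Y Z f] corner_HomD(1) carrier_HomMod
    by (intro linear_mapI) (auto simp: corner_Comp linear_map_def)
qed (auto simp: corner_Comp e_corner module_corner_Hom corner_HomD intro!: Comp_assoc)

text \<open>A linear functor \<open>F\<close> on the whole category restricts to the corner by taking the image of
  \<open>F (e X)\<close>, that is, its fixed points.\<close>

definition corner_points :: "('o, 'a, 'r, 'm) module_functor \<Rightarrow> 'o \<Rightarrow> 'm set" where
  "corner_points F X = {x \<in> carrier (omap F X). amap F X X (e X) x = x}"

definition corner_module ::
  "('o, 'a, 'r, 'm) module_functor \<Rightarrow> ('o, 'a, 'r, 'm) module_functor" where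
  "corner_module F = \<lparr>omap = (\<lambda>X. (omap F X)\<lparr>carrier := corner_points F X\<rparr>),
    amap = (\<lambda>X Y f. restrict (amap F X Y f) (corner_points F X))\<rparr>"

definition corner_functor ::
  "(('o, 'a, 'r, 'm) module_functor, 'o \<Rightarrow> 'm \<Rightarrow> 'm,
    ('o, 'a, 'r, 'm) module_functor, 'o \<Rightarrow> 'm \<Rightarrow> 'm) fctr" where
  "corner_functor = \<lparr>omap = corner_module,
    amap = (\<lambda>F G \<eta>. \<lambda>X\<in>Ob K. restrict (\<eta> X) (corner_points F X))\<rparr>"

context
  fixes U :: "'m itself" and F :: "('o, 'a, 'r, 'm) module_functor"
  assumes lF: "is_linear_functor R K (mod_category U R) F"
begin

lemmas F = is_linear_functor_modD(1)[OF linear_category_axioms lF]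
lemmas F_module = is_functor_modD(2)[OF F]
  and F_ext = is_functor_modD(3)[OF F]
  and F_linear = is_functor_modD(4)[OF F]
  and F_Idm = is_functor_modD(5)[OF F]
  and F_Comp = is_functor_modD(6)[OF F]
  and F_in = is_functor_modD(7)[OF F]
  and F_linear_left = is_linear_functor_modD(2)[OF linear_category_axioms lF]

lemma corner_points_subset: "corner_points F X \<subseteq> carrier (omap F X)"
  by (auto simp: corner_points_def)

lemma module_corner_points: "X \<in> Ob K \<Longrightarrow> module R ((omap F X)\<lparr>carrier := corner_points F X\<rparr>)"
  unfolding corner_points_def by (intro module_fixed_points F_module F_linear e_in)

lemma act_in_corner_points:
  assumes "X \<in> Ob K" "Y \<in> Ob K" "f \<in> Hom K X Y" "Comp K X Y Y (e Y) f = f" "x \<in> carrier (omap F X)"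
  shows "amap F X Y f x \<in> corner_points F Y"
  using assms F_Comp[of X Y Y f "e Y" x] F_in e_in by (simp add: corner_points_def)

lemma linear_corner_module: "is_linear_functor R corner (mod_category U R) (corner_module F)"
proof (intro is_linear_functor_modI linear_category_corner is_functor_modI)
  fix X Y f assume X: "X \<in> Ob corner" and Y: "Y \<in> Ob corner" and f: "f \<in> Hom corner X Y"
  then have "linear_map R ((omap F X)\<lparr>carrier := corner_points F X\<rparr>) ((omap F Y)\<lparr>carrier := corner_points F Y\<rparr>) (amap F X Y f)"
    using linear_mapD[OF F_linear[of X Y f]] act_in_corner_points[of X Y f] corner_HomD[of f X Y]
      subsetD[OF corner_points_subset]
    by (intro linear_mapI) auto
  from linear_map_cong[OF this module_corner_points] X
  show "linear_map R (omap (corner_module F) X) (omap (corner_module F) Y) (amap (corner_module F) X Y f)"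
    by (simp add: corner_module_def)
next
  show "category corner" using linear_category_corner by (simp add: linear_category_def)
next
  fix X Y f g x assume XY: "X \<in> Ob corner" "Y \<in> Ob corner" and fg: "f \<in> Hom corner X Y" "g \<in> Hom corner X Y"
    and x: "x \<in> carrier (omap (corner_module F) X)"
  show "amap (corner_module F) X Y (f \<oplus>\<^bsub>HomMod corner X Y\<^esub> g) x =
      amap (corner_module F) X Y f x \<oplus>\<^bsub>omap (corner_module F) Y\<^esub> amap (corner_module F) X Y g x"
    using XY fg x corner_HomD(1) carrier_HomMod[of X Y] linear_mapD(2)[OF F_linear_left, of X Y x f g]
    by (auto simp: corner_module_def corner_points_def)
next
  fix X Y r f x assume XY: "X \<in> Ob corner" "Y \<in> Ob corner" and f: "f \<in> Hom corner X Y" "r \<in> carrier R"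
    and x: "x \<in> carrier (omap (corner_module F) X)"
  show "amap (corner_module F) X Y (r \<odot>\<^bsub>HomMod corner X Y\<^esub> f) x =
      r \<odot>\<^bsub>omap (corner_module F) Y\<^esub> amap (corner_module F) X Y f x"
    using XY f x corner_HomD(1) carrier_HomMod[of X Y] linear_mapD(3)[OF F_linear_left, of X Y x r f]
    by (auto simp: corner_module_def corner_points_def)
next
  fix X Y Z f g x assume XYZ: "X \<in> Ob corner" "Y \<in> Ob corner" "Z \<in> Ob corner"
    and fg: "f \<in> Hom corner X Y" "g \<in> Hom corner Y Z" and x: "x \<in> carrier (omap (corner_module F) X)"
  then show "amap (corner_module F) X Z (Comp corner X Y Z g f) x =
      amap (corner_module F) Y Z g (amap (corner_module F) X Y f x)"
    using act_in_corner_points[of X Y f x] F_Comp[of X Y Z f g x] corner_HomD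
    by (auto simp: corner_module_def corner_points_def)
qed (auto simp: corner_module_def module_corner_points, auto simp: corner_points_def)

end

lemma corner_module_simps:
  "omap (corner_module F) X = (omap F X)\<lparr>carrier := corner_points F X\<rparr>"
  "x \<in> corner_points F X \<Longrightarrow> amap (corner_module F) X Y f x = amap F X Y f x"
  by (simp_all add: corner_module_def)

lemma nat_trans_in_corner_points:
  fixes U :: "'m itself"
  assumes "is_nat_trans K (mod_category U R) F G \<eta>" "X \<in> Ob K" "x \<in> corner_points F X"
  shows "\<eta> X x \<in> corner_points G X"
proof -
  have "\<eta> X x \<in> carrier (omap G X)" "\<eta> X (amap F X X (e X) x) = amap G X X (e X) (\<eta> X x)"
    using assms(1) assms(2,3) e_in[OF assms(2)] linear_mapD(1)[of R "omap F X" "omap G X" "\<eta> X" x]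
    unfolding is_nat_trans_mod_iff corner_points_def by blast+
  then show ?thesis using assms(3) by (simp add: corner_points_def)
qed

lemma is_functor_corner_functor:
  fixes U :: "'m itself"
  shows "is_functor (linear_Mod_over U R K) (linear_Mod_over U R corner) corner_functor"
proof -
  have K: "linear_category R K" by (rule linear_category_axioms)
  note C = linear_category_corner
  note simps = linear_Mod_over_simps[OF K] linear_Mod_over_simps[OF C]
  have nat: "is_nat_trans corner (mod_category U R) (corner_module F) (corner_module G)
      (\<lambda>X\<in>Ob K. restrict (\<eta> X) (corner_points F X))"
    if F: "is_linear_functor R K (mod_category U R) F"
      and \<eta>: "is_nat_trans K (mod_category U R) F G \<eta>" for F G \<eta>
  proof -
    have lin: "linear_map R (omap F X) (omap G X) (\<eta> X)" if "X \<in> Ob K" for X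
      using \<eta> that by (auto simp: is_nat_trans_mod_iff)
    have l: "linear_map R ((omap F X)\<lparr>carrier := corner_points F X\<rparr>) ((omap G X)\<lparr>carrier := corner_points G X\<rparr>) (\<eta> X)"
      if "X \<in> Ob K" for X
      using nat_trans_in_corner_points[OF \<eta> that] linear_mapD[OF lin[OF that]] subsetD[OF corner_points_subset[OF F]]
      by (intro linear_mapI) auto
    have "linear_map R ((omap F X)\<lparr>carrier := corner_points F X\<rparr>) ((omap G X)\<lparr>carrier := corner_points G X\<rparr>)
        (restrict (\<eta> X) (corner_points F X))" if "X \<in> Ob K" for X
      by (rule linear_map_cong[OF l[OF that] module_corner_points[OF F that]]) simp
    then show ?thesis
      using \<eta> act_in_corner_points[OF F] nat_trans_in_corner_points[OF \<eta>]
      by (auto simp: is_nat_trans_mod_iff corner_module_def corner_HomD corner_points_def)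
  qed
  show ?thesis
    unfolding is_functor_def
  proof (intro conjI ballI)
    fix F G H \<sigma> \<tau> assume "\<sigma> \<in> Hom (linear_Mod_over U R K) F G"
    then have "\<sigma> X x \<in> corner_points G X" if "X \<in> Ob K" "x \<in> corner_points F X" for X x
      using that nat_trans_in_corner_points by (auto simp: simps)
    then show "amap corner_functor F H (Comp (linear_Mod_over U R K) F G H \<tau> \<sigma>) =
        Comp (linear_Mod_over U R corner) (omap corner_functor F) (omap corner_functor G) (omap corner_functor H)
          (amap corner_functor G H \<tau>) (amap corner_functor F G \<sigma>)"
      by (auto simp: simps corner_functor_def corner_module_simps compose_def fun_eq_iff corner_points_def)
  next
    fix F assume "F \<in> Ob (linear_Mod_over U R K)"
    then show "amap corner_functor F F (Idm (linear_Mod_over U R K) F) =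
        Idm (linear_Mod_over U R corner) (omap corner_functor F)"
      by (auto simp: simps corner_functor_def corner_module_simps fun_eq_iff corner_points_def)
  qed (auto simp: simps corner_functor_def linear_corner_module nat
      intro: category_linear_Mod_over[OF K] category_linear_Mod_over[OF C])
qed

end


section \<open>Morita equivalence with a corner\<close>

text \<open>The idempotents are full if every identity is a sum \<open>\<Sum>\<^sub>i u\<^sub>i w\<^sub>i\<close> of arrows through the objects of
  the corner.  This is the hypothesis of Morita theory: a module is then determined by its
  restriction to the corner, and every module over the corner extends.\<close>

locale full_idempotent_family = idempotent_family R K e
  for R :: "('r, 'x) ring_scheme" and K :: "('o, 'a, 'r, 'z) lincat_scheme" and e :: "'o \<Rightarrow> 'a" +
  fixes n :: "'o \<Rightarrow> nat" and B :: "'o \<Rightarrow> nat \<Rightarrow> 'o" and u w :: "'o \<Rightarrow> nat \<Rightarrow> 'a"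
  assumes B_in: "A \<in> Ob K \<Longrightarrow> i < n A \<Longrightarrow> B A i \<in> Ob K"
    and u_in: "A \<in> Ob K \<Longrightarrow> i < n A \<Longrightarrow> u A i \<in> Hom K (B A i) A"
    and w_in: "A \<in> Ob K \<Longrightarrow> i < n A \<Longrightarrow> w A i \<in> Hom K A (B A i)"
    and u_e: "A \<in> Ob K \<Longrightarrow> i < n A \<Longrightarrow> Comp K (B A i) (B A i) A (u A i) (e (B A i)) = u A i"
    and e_w: "A \<in> Ob K \<Longrightarrow> i < n A \<Longrightarrow> Comp K A (B A i) (B A i) (e (B A i)) (w A i) = w A i"
    and sum_uw: "A \<in> Ob K \<Longrightarrow>
      (\<Oplus>\<^bsub>HomMod K A A\<^esub>i\<in>{..<n A}. Comp K A (B A i) A (u A i) (w A i)) = Idm K A"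
begin

abbreviation "uw A i \<equiv> Comp K A (B A i) A (u A i) (w A i)"
abbreviation "pre_u A i C f \<equiv> Comp K (B A i) A C f (u A i)"
abbreviation "post_w C i A f \<equiv> Comp K A C (B C i) (w C i) f"
abbreviation "act_u F A i \<equiv> amap F (B A i) A (u A i)"
abbreviation "act_w F A i \<equiv> amap F A (B A i) (w A i)"

lemma uw_in: "A \<in> Ob K \<Longrightarrow> i < n A \<Longrightarrow> uw A i \<in> Hom K A A"
  by (intro Comp_in B_in u_in w_in)

lemma sum_uw_Comp:
  assumes A: "A \<in> Ob K" and C: "C \<in> Ob K" and f: "f \<in> Hom K A C"
  shows "(\<Oplus>\<^bsub>HomMod K A C\<^esub>i\<in>{..<n A}. Comp K A A C f (uw A i)) = f"
  using linear_map_finsum[OF linear_Comp_right[OF A A C f] module_HomMod[OF A A] module_HomMod[OF A C],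
      of "{..<n A}" "\<lambda>i. uw A i"] uw_in[OF A] A C f
  by (simp add: carrier_HomMod sum_uw Comp_Idm_right)

context
  fixes U :: "'m itself" and F :: "('o, 'a, 'r, 'm) module_functor"
  assumes lF: "is_linear_functor R K (mod_category U R) F"
begin

lemma act_w_in: "A \<in> Ob K \<Longrightarrow> i < n A \<Longrightarrow> x \<in> carrier (omap F A) \<Longrightarrow> act_w F A i x \<in> corner_points F (B A i)"
  by (intro act_in_corner_points[OF lF] B_in w_in e_w)

text \<open>An arrow \<open>f\<close> out of \<open>A\<close> acts as \<open>\<Sum>\<^sub>i (f u\<^sub>i) w\<^sub>i\<close>, so its action is computed from the elements
  \<open>w\<^sub>i x\<close>, which belong to the restriction to the corner.\<close>

lemma act_expand:
  assumes A: "A \<in> Ob K" and C: "C \<in> Ob K" and f: "f \<in> Hom K A C" and x: "x \<in> carrier (omap F A)"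
  shows "(\<Oplus>\<^bsub>omap F C\<^esub>i\<in>{..<n A}. amap F (B A i) C (pre_u A i C f) (act_w F A i x)) =
    amap F A C f x"
proof -
  interpret M: module R "omap F C" by (rule F_module[OF lF C])
  have "amap F A C f x = amap F A C (\<Oplus>\<^bsub>HomMod K A C\<^esub>i\<in>{..<n A}. Comp K A A C f (uw A i)) x"
    by (simp add: sum_uw_Comp[OF A C f])
  also have "\<dots> = (\<Oplus>\<^bsub>omap F C\<^esub>i\<in>{..<n A}. amap F A C (Comp K A A C f (uw A i)) x)"
    using A C f uw_in[OF A] Comp_in
    by (intro linear_map_finsum[OF F_linear_left[OF lF A C x] module_HomMod[OF A C] M.module_axioms])
      (auto simp: carrier_HomMod)
  also have "\<dots> = (\<Oplus>\<^bsub>omap F C\<^esub>i\<in>{..<n A}. amap F (B A i) C (pre_u A i C f) (act_w F A i x))"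
  proof (intro M.M.finsum_cong' refl Pi_I)
    fix i assume "i \<in> {..<n A}"
    then have i: "i < n A" by simp
    show "amap F (B A i) C (pre_u A i C f) (act_w F A i x) \<in> carrier (omap F C)"
      by (intro F_in[OF lF] Comp_in A C B_in w_in u_in f x i)
    have "Comp K A A C f (uw A i) =
        Comp K A (B A i) C (pre_u A i C f) (w A i)"
      by (intro Comp_assoc[symmetric] A C B_in w_in u_in f i)
    then show "amap F A C (Comp K A A C f (uw A i)) x =
        amap F (B A i) C (pre_u A i C f) (act_w F A i x)"
      using A C B_in[OF A i] w_in[OF A i] u_in[OF A i] f x by (simp add: F_Comp[OF lF] Comp_in)
  qed
  finally show ?thesis by simp
qed

lemma act_expand_Idm:
  assumes A: "A \<in> Ob K" and x: "x \<in> carrier (omap F A)"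
  shows "(\<Oplus>\<^bsub>omap F A\<^esub>i\<in>{..<n A}. act_u F A i (act_w F A i x)) = x"
proof -
  interpret M: module R "omap F A" by (rule F_module[OF lF A])
  have "(\<Oplus>\<^bsub>omap F A\<^esub>i\<in>{..<n A}. act_u F A i (act_w F A i x)) =
      (\<Oplus>\<^bsub>omap F A\<^esub>i\<in>{..<n A}. amap F (B A i) A (pre_u A i A (Idm K A)) (act_w F A i x))"
    using A x by (intro M.M.finsum_cong')
      (auto simp: Comp_Idm_left B_in u_in w_in intro!: F_in[OF lF])
  then show ?thesis
    using act_expand[OF A A Idm_in[OF A] x] F_Idm[OF lF A x] by simp
qed

end

text \<open>Writing \<open>x\<close> as \<open>\<Sum>\<^sub>i u\<^sub>i (w\<^sub>i x)\<close> expresses a natural transformation through its values on the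
  corner.\<close>

lemma faithful_corner_functor:
  fixes U :: "'m itself"
  assumes F: "is_linear_functor R K (mod_category U R) F" and G: "is_linear_functor R K (mod_category U R) G"
    and \<eta>: "is_nat_trans K (mod_category U R) F G \<eta>" and A: "A \<in> Ob K" and x: "x \<in> carrier (omap F A)"
  shows "\<eta> A x = (\<Oplus>\<^bsub>omap G A\<^esub>i\<in>{..<n A}. act_u G A i (\<eta> (B A i) (act_w F A i x)))"
proof -
  interpret M: module R "omap G A" by (rule F_module[OF G A])
  have lin: "linear_map R (omap F X) (omap G X) (\<eta> X)" if "X \<in> Ob K" for X
    using \<eta> that by (auto simp: is_nat_trans_mod_iff)
  have "\<eta> A x = \<eta> A (\<Oplus>\<^bsub>omap F A\<^esub>i\<in>{..<n A}. act_u F A i (act_w F A i x))"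
    using act_expand_Idm[OF F A x] by simp
  also have "\<dots> = (\<Oplus>\<^bsub>omap G A\<^esub>i\<in>{..<n A}. \<eta> A (act_u F A i (act_w F A i x)))"
    using A x B_in u_in w_in
    by (intro linear_map_finsum[OF lin[OF A] F_module[OF F A] F_module[OF G A]] F_in[OF F]) auto
  also have "\<dots> = (\<Oplus>\<^bsub>omap G A\<^esub>i\<in>{..<n A}. act_u G A i (\<eta> (B A i) (act_w F A i x)))"
  proof (intro M.M.finsum_cong' refl Pi_I)
    fix i assume "i \<in> {..<n A}"
    then have i: "i < n A" by simp
    have wx: "act_w F A i x \<in> carrier (omap F (B A i))"
      by (intro F_in[OF F] A B_in w_in x i)
    then show "act_u G A i (\<eta> (B A i) (act_w F A i x)) \<in> carrier (omap G A)"
      by (intro F_in[OF G] A B_in u_in i linear_mapD(1)[OF lin])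
    show "\<eta> A (act_u F A i (act_w F A i x)) =
        act_u G A i (\<eta> (B A i) (act_w F A i x))"
      using \<eta> wx A B_in[OF A i] u_in[OF A i] by (auto simp: is_nat_trans_mod_iff)
  qed
  finally show ?thesis .
qed

text \<open>The formula forced by the previous lemma defines an extension of a natural transformation
  \<open>\<zeta>\<close> of corner modules.  For naturality along \<open>f : A \<rightarrow> C\<close>, both sides are rewritten as double sums
  in which \<open>\<zeta>\<close> only meets the arrows \<open>w\<^sub>j f u\<^sub>i\<close>; these lie in the corner, where \<open>\<zeta>\<close> is natural.\<close>

lemma full_corner_functor:
  fixes U :: "'m itself"
  assumes F: "is_linear_functor R K (mod_category U R) F" and G: "is_linear_functor R K (mod_category U R) G"
    and \<zeta>: "is_nat_trans corner (mod_category U R) (corner_module F) (corner_module G) \<zeta>"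
  defines "\<theta> \<equiv> \<lambda>A\<in>Ob K. \<lambda>x\<in>carrier (omap F A). \<Oplus>\<^bsub>omap G A\<^esub>i\<in>{..<n A}.
    act_u G A i (\<zeta> (B A i) (act_w F A i x))"
  shows "is_nat_trans K (mod_category U R) F G \<theta>"
    and "\<And>A x. A \<in> Ob K \<Longrightarrow> x \<in> corner_points F A \<Longrightarrow> \<theta> A x = \<zeta> A x"
proof -
  have \<zeta>_lin: "linear_map R ((omap F X)\<lparr>carrier := corner_points F X\<rparr>) ((omap G X)\<lparr>carrier := corner_points G X\<rparr>) (\<zeta> X)"
    if "X \<in> Ob K" for X using \<zeta> that by (auto simp: is_nat_trans_mod_iff corner_module_simps)
  have \<zeta>_in: "\<zeta> X x \<in> corner_points G X" if "X \<in> Ob K" "x \<in> corner_points F X" for X x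
    using linear_mapD(1)[OF \<zeta>_lin] that by simp
  have \<zeta>_nat: "\<zeta> Y (amap F X Y f x) = amap G X Y f (\<zeta> X x)"
    if "X \<in> Ob K" "Y \<in> Ob K" "f \<in> corner_Hom X Y" "x \<in> corner_points F X" for X Y f x
    using \<zeta> that \<zeta>_in by (auto simp: is_nat_trans_mod_iff corner_module_simps)
  note cF = subsetD[OF corner_points_subset[OF F]] and cG = subsetD[OF corner_points_subset[OF G]]
  have lin: "linear_map R (omap F A) (omap G A) (\<lambda>x. \<Oplus>\<^bsub>omap G A\<^esub>i\<in>{..<n A}.
      act_u G A i (\<zeta> (B A i) (act_w F A i x)))" if A: "A \<in> Ob K" for A
  proof (intro linear_map_sum F_module[OF F A] F_module[OF G A])
    fix i assume "i \<in> {..<n A}"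
    then have i: "i < n A" by simp
    have "linear_map R (omap F A) ((omap F (B A i))\<lparr>carrier := corner_points F (B A i)\<rparr>) (act_w F A i)"
      using act_w_in[OF F A i] linear_mapD[OF F_linear[OF F A B_in[OF A i] w_in[OF A i]]]
      by (intro linear_mapI) auto
    moreover have "linear_map R ((omap G (B A i))\<lparr>carrier := corner_points G (B A i)\<rparr>) (omap G A) (act_u G A i)"
      using linear_mapD[OF F_linear[OF G B_in[OF A i] A u_in[OF A i]]] cG
      by (intro linear_mapI) auto
    ultimately show "linear_map R (omap F A) (omap G A)
        (\<lambda>x. act_u G A i (\<zeta> (B A i) (act_w F A i x)))"
      using linear_map_compose \<zeta>_lin[OF B_in[OF A i]] by metis
  qed simp
  have key: "(\<Oplus>\<^bsub>omap G C\<^esub>j\<in>{..<n C}. act_u G C j (\<zeta> (B C j) (amap F A (B C j) (post_w C j A f) x))) =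
      (\<Oplus>\<^bsub>omap G C\<^esub>i\<in>{..<n A}. amap G (B A i) C (pre_u A i C f) (\<zeta> (B A i) (act_w F A i x)))"
    if A: "A \<in> Ob K" and C: "C \<in> Ob K" and f: "f \<in> Hom K A C" and x: "x \<in> carrier (omap F A)" for A C f x
  proof -
    interpret M: module R "omap G C" by (rule F_module[OF G C])
    note I = A C f x B_in[OF A] B_in[OF C] u_in[OF A] u_in[OF C] w_in[OF A] w_in[OF C]
    define y where "y i = \<zeta> (B A i) (act_w F A i x)" for i
    have wx: "act_w F A i x \<in> corner_points F (B A i)" if "i < n A" for i
      by (intro act_w_in[OF F] A that x)
    have y: "y i \<in> corner_points G (B A i)" if "i < n A" for i
      unfolding y_def by (intro \<zeta>_in wx B_in A that)
    have wf: "post_w C j A f \<in> Hom K A (B C j)" if "j < n C" for j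
      using that I Comp_in by simp
    have wfu: "pre_u A i (B C j) (post_w C j A f) \<in> corner_Hom (B A i) (B C j)"
      if i: "i < n A" and j: "j < n C" for i j
      using I i j u_e[OF A i] e_w[OF C j] wf e_in
      by (intro corner_Hom_Comp) (auto simp: Comp_assoc[symmetric])
    have fu: "pre_u A i C f \<in> Hom K (B A i) C" if "i < n A" for i
      using that I Comp_in by simp
    have "\<zeta> (B C j) (amap F A (B C j) (post_w C j A f) x) =
        act_w G C j (\<Oplus>\<^bsub>omap G C\<^esub>i\<in>{..<n A}. amap G (B A i) C (pre_u A i C f) (y i))"
      (is "?l = ?r") if j: "j < n C" for j
    proof -
      interpret Mj: module R "omap G (B C j)" by (rule F_module[OF G B_in[OF C j]])
      let ?g = "\<lambda>i. pre_u A i (B C j) (post_w C j A f)"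
      let ?P = "(omap F (B C j))\<lparr>carrier := corner_points F (B C j)\<rparr>"
      let ?Q = "(omap G (B C j))\<lparr>carrier := corner_points G (B C j)\<rparr>"
      note Bj = B_in[OF C j]
      have gF: "amap F (B A i) (B C j) (?g i) (act_w F A i x) \<in> corner_points F (B C j)" if "i < n A" for i
        using wfu[OF that j] B_in[OF A that] Bj cF[OF wx[OF that]]
        by (intro act_in_corner_points[OF F]) (auto dest: corner_HomD)
      have gG: "amap G (B A i) (B C j) (?g i) (y i) \<in> corner_points G (B C j)" if "i < n A" for i
        using wfu[OF that j] B_in[OF A that] Bj cG[OF y[OF that]]
        by (intro act_in_corner_points[OF G]) (auto dest: corner_HomD)
      have "?l = \<zeta> (B C j) (\<Oplus>\<^bsub>omap F (B C j)\<^esub>i\<in>{..<n A}. amap F (B A i) (B C j) (?g i) (act_w F A i x))"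
        using act_expand[OF F A Bj wf[OF j] x] by simp
      also have "\<dots> = \<zeta> (B C j) (\<Oplus>\<^bsub>?P\<^esub>i\<in>{..<n A}. amap F (B A i) (B C j) (?g i) (act_w F A i x))"
        by (subst finsum_restrict_carrier[OF F_module[OF F Bj] module_corner_points[OF F Bj] corner_points_subset[OF F]])
          (use gF in auto)
      also have "\<dots> = (\<Oplus>\<^bsub>?Q\<^esub>i\<in>{..<n A}. \<zeta> (B C j) (amap F (B A i) (B C j) (?g i) (act_w F A i x)))"
        using gF by (intro linear_map_finsum[OF \<zeta>_lin[OF Bj] module_corner_points[OF F Bj] module_corner_points[OF G Bj]]) auto
      also have "\<dots> = (\<Oplus>\<^bsub>omap G (B C j)\<^esub>i\<in>{..<n A}. \<zeta> (B C j) (amap F (B A i) (B C j) (?g i) (act_w F A i x)))"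
        using gF \<zeta>_in[OF Bj]
        by (intro finsum_restrict_carrier[OF F_module[OF G Bj] module_corner_points[OF G Bj] corner_points_subset[OF G]]) auto
      also have "\<dots> = (\<Oplus>\<^bsub>omap G (B C j)\<^esub>i\<in>{..<n A}. act_w G C j (amap G (B A i) C (pre_u A i C f) (y i)))"
      proof (intro Mj.M.finsum_cong' refl Pi_I)
        fix i assume "i \<in> {..<n A}"
        then have i: "i < n A" by simp
        have "\<zeta> (B C j) (amap F (B A i) (B C j) (?g i) (act_w F A i x)) = amap G (B A i) (B C j) (?g i) (y i)"
          unfolding y_def by (intro \<zeta>_nat B_in A C i j wfu wx)
        moreover have "?g i = post_w C j (B A i) (pre_u A i C f)"
          using I i j by (intro Comp_assoc) auto
        ultimately show "\<zeta> (B C j) (amap F (B A i) (B C j) (?g i) (act_w F A i x)) =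
            act_w G C j (amap G (B A i) C (pre_u A i C f) (y i))"
          using I i j fu cG[OF y[OF i]] by (simp add: F_Comp[OF G])
        show "act_w G C j (amap G (B A i) C (pre_u A i C f) (y i)) \<in> carrier (omap G (B C j))"
          using I i j fu cG[OF y[OF i]] by (intro F_in[OF G]) auto
      qed
      also have "\<dots> = ?r"
        using I j fu cG[OF y]
        by (intro linear_map_finsum[OF F_linear[OF G C Bj w_in[OF C j]] M.module_axioms Mj.module_axioms, symmetric])
          (auto intro!: F_in[OF G])
      finally show ?thesis .
    qed
    moreover have "(\<Oplus>\<^bsub>omap G C\<^esub>i\<in>{..<n A}. amap G (B A i) C (pre_u A i C f) (y i)) \<in> carrier (omap G C)"
      using I fu cG[OF y] by (intro M.M.finsum_closed Pi_I F_in[OF G]) auto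
    ultimately show ?thesis
      using act_expand_Idm[OF G C] I
      by (subst M.M.finsum_cong'[OF refl, where g = "\<lambda>j. act_u G C j
          (act_w G C j (\<Oplus>\<^bsub>omap G C\<^esub>i\<in>{..<n A}. amap G (B A i) C (pre_u A i C f) (y i)))"])
        (auto simp: y_def[symmetric] intro!: F_in[OF G])
  qed
  show "is_nat_trans K (mod_category U R) F G \<theta>"
    unfolding is_nat_trans_mod_iff
  proof (intro conjI ballI)
    fix A assume A: "A \<in> Ob K"
    then show "\<theta> A \<in> extensional (carrier (omap F A))" by (simp add: \<theta>_def)
    show "linear_map R (omap F A) (omap G A) (\<theta> A)"
      using A by (intro linear_map_cong[OF lin[OF A] F_module[OF F A]]) (simp add: \<theta>_def)
  next
    fix A C f x assume A: "A \<in> Ob K" and C: "C \<in> Ob K" and f: "f \<in> Hom K A C" and x: "x \<in> carrier (omap F A)"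
    interpret M: module R "omap G C" by (rule F_module[OF G C])
    note I = A C f x B_in[OF A] B_in[OF C] u_in[OF A] u_in[OF C] w_in[OF A] w_in[OF C]
    have zin: "\<zeta> (B X i) (act_w F X i y) \<in> carrier (omap G (B X i))"
      if "X \<in> Ob K" "i < n X" "y \<in> carrier (omap F X)" for X i y
      using that by (intro cG \<zeta>_in act_w_in[OF F] B_in) auto
    have "\<theta> C (amap F A C f x) = (\<Oplus>\<^bsub>omap G C\<^esub>j\<in>{..<n C}. act_u G C j
        (\<zeta> (B C j) (act_w F C j (amap F A C f x))))"
      using I by (simp add: \<theta>_def F_in[OF F])
    also have "\<dots> = (\<Oplus>\<^bsub>omap G C\<^esub>j\<in>{..<n C}. act_u G C j
        (\<zeta> (B C j) (amap F A (B C j) (post_w C j A f) x)))"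
      using I zin[OF C _ F_in[OF F A C f x]] by (intro M.M.finsum_cong') (auto simp: F_Comp[OF F] intro!: F_in[OF G])
    also note key[OF A C f x]
    also have "(\<Oplus>\<^bsub>omap G C\<^esub>i\<in>{..<n A}. amap G (B A i) C (pre_u A i C f) (\<zeta> (B A i) (act_w F A i x))) =
      (\<Oplus>\<^bsub>omap G C\<^esub>i\<in>{..<n A}. amap G A C f (act_u G A i (\<zeta> (B A i) (act_w F A i x))))"
      using I zin[OF A _ x] by (intro M.M.finsum_cong') (auto simp: F_Comp[OF G] intro!: F_in[OF G])
    also have "\<dots> = amap G A C f (\<theta> A x)"
      using I zin[OF A _ x]
      by (simp add: \<theta>_def)
        (intro linear_map_finsum[OF F_linear[OF G A C f] F_module[OF G A] F_module[OF G C], symmetric] F_in[OF G], auto)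
    finally show "\<theta> C (amap F A C f x) = amap G A C f (\<theta> A x)" .
  qed
  show "\<theta> A x = \<zeta> A x" if A: "A \<in> Ob K" and x: "x \<in> corner_points F A" for A x
  proof -
    interpret M: module R "omap G A" by (rule F_module[OF G A])
    note xF = cF[OF x] and zG = cG[OF \<zeta>_in[OF A x]]
    have "\<zeta> (B A i) (act_w F A i x) = act_w G A i (\<zeta> A x)" if i: "i < n A" for i
    proof -
      have we: "post_w A i A (e A) \<in> corner_Hom A (B A i)"
        using A i by (intro corner_Hom_Comp A B_in e_in w_in e_idem e_w)
      have "act_w F A i x = amap F A (B A i) (post_w A i A (e A)) x"
        using A i x xF by (simp add: F_Comp[OF F] B_in e_in w_in corner_points_def)
      then have "\<zeta> (B A i) (act_w F A i x) = amap G A (B A i) (post_w A i A (e A)) (\<zeta> A x)"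
        using \<zeta>_nat[OF A B_in[OF A i] we x] by simp
      also have "\<dots> = act_w G A i (\<zeta> A x)"
        using A i \<zeta>_in[OF A x] zG by (simp add: F_Comp[OF G] B_in e_in w_in corner_points_def)
      finally show ?thesis .
    qed
    then have "\<theta> A x = (\<Oplus>\<^bsub>omap G A\<^esub>i\<in>{..<n A}. act_u G A i (act_w G A i (\<zeta> A x)))"
      using A xF zG B_in u_in w_in
      by (simp add: \<theta>_def) (intro M.M.finsum_cong', auto intro!: F_in[OF G])
    then show ?thesis using act_expand_Idm[OF G A zG] by simp
  qed
qed

lemma fully_faithful_corner_functor:
  fixes U :: "'m itself"
  shows "fully_faithful (linear_Mod_over U R K) (linear_Mod_over U R corner) corner_functor"
  unfolding fully_faithful_def
proof (intro ballI)
  note simps = linear_Mod_over_simps[OF linear_category_axioms] linear_Mod_over_simps[OF linear_category_corner]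
  fix F G assume "F \<in> Ob (linear_Mod_over U R K)" "G \<in> Ob (linear_Mod_over U R K)"
  then have F: "is_linear_functor R K (mod_category U R) F" and G: "is_linear_functor R K (mod_category U R) G"
    by (auto simp: simps)
  show "bij_betw (amap corner_functor F G) (Hom (linear_Mod_over U R K) F G)
    (Hom (linear_Mod_over U R corner) (omap corner_functor F) (omap corner_functor G))"
  proof (rule bij_betw_imageI)
    show "inj_on (amap corner_functor F G) (Hom (linear_Mod_over U R K) F G)"
    proof (rule inj_onI)
      fix \<eta> \<eta>' assume \<eta>: "\<eta> \<in> Hom (linear_Mod_over U R K) F G" and \<eta>': "\<eta>' \<in> Hom (linear_Mod_over U R K) F G"
        and eq: "amap corner_functor F G \<eta> = amap corner_functor F G \<eta>'"
      have n: "is_nat_trans K (mod_category U R) F G \<eta>" "is_nat_trans K (mod_category U R) F G \<eta>'"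
        using \<eta> \<eta>' by (auto simp: simps)
      have eq': "\<eta> X x = \<eta>' X x" if "X \<in> Ob K" "x \<in> corner_points F X" for X x
        using fun_cong[OF fun_cong[OF eq], of X x] that by (simp add: corner_functor_def)
      have "\<eta> A x = \<eta>' A x" if A: "A \<in> Ob K" and x: "x \<in> carrier (omap F A)" for A x
      proof -
        interpret M: module R "omap G A" by (rule F_module[OF G A])
        show ?thesis
          unfolding faithful_corner_functor[OF F G n(1) A x] faithful_corner_functor[OF F G n(2) A x]
          using A eq'[OF B_in[OF A] act_w_in[OF F A _ x]] nat_trans_in_corner_points[OF n(2) B_in[OF A] act_w_in[OF F A _ x]]
            subsetD[OF corner_points_subset[OF G]]
          by (intro M.M.finsum_cong') (auto intro!: F_in[OF G] B_in u_in)
      qed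
      then have "\<eta> A = \<eta>' A" if "A \<in> Ob K" for A
        using n that by (intro extensionalityI[of _ "carrier (omap F A)"]) (auto simp: is_nat_trans_mod_iff)
      then show "\<eta> = \<eta>'"
        using \<eta> \<eta>' by (intro extensionalityI[of _ "Ob K"]) (auto simp: simps)
    qed
    show "amap corner_functor F G ` Hom (linear_Mod_over U R K) F G =
      Hom (linear_Mod_over U R corner) (omap corner_functor F) (omap corner_functor G)" (is "?L = ?R")
    proof
      show "?L \<subseteq> ?R"
        using is_functorD(4)[OF is_functor_corner_functor] F G by (auto simp: simps)
      show "?R \<subseteq> ?L"
      proof
        fix \<zeta> assume "\<zeta> \<in> ?R"
        then have \<zeta>: "\<zeta> \<in> extensional (Ob K)"
          "is_nat_trans corner (mod_category U R) (corner_module F) (corner_module G) \<zeta>"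
          by (auto simp: simps corner_functor_def)
        define \<theta> where "\<theta> = (\<lambda>A\<in>Ob K. \<lambda>x\<in>carrier (omap F A). \<Oplus>\<^bsub>omap G A\<^esub>i\<in>{..<n A}.
          act_u G A i (\<zeta> (B A i) (act_w F A i x)))"
        note \<theta> = full_corner_functor[OF F G \<zeta>(2), folded \<theta>_def]
        have "\<theta> \<in> Hom (linear_Mod_over U R K) F G"
          using \<theta>(1) by (simp add: simps \<theta>_def)
        moreover have "amap corner_functor F G \<theta> = \<zeta>"
        proof (rule extensionalityI[of _ "Ob K"])
          fix A assume A: "A \<in> Ob K"
          show "amap corner_functor F G \<theta> A = \<zeta> A"
            using A \<theta>(2)[OF A] \<zeta>(2)
            by (intro extensionalityI[of _ "corner_points F A"])
              (auto simp: corner_functor_def is_nat_trans_mod_iff corner_module_simps)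
        qed (auto simp: corner_functor_def \<zeta>)
        ultimately show "\<zeta> \<in> ?L" by blast
      qed
    qed
  qed
qed

end


section \<open>Products and transport of modules\<close>

definition product_module :: "'i set \<Rightarrow> ('i \<Rightarrow> ('r, 'm) module) \<Rightarrow> ('r, 'i \<Rightarrow> 'm) module" where
  "product_module I M = \<lparr>carrier = (\<Pi>\<^sub>E i\<in>I. carrier (M i)), mult = undefined, one = undefined,
    zero = (\<lambda>i\<in>I. \<zero>\<^bsub>M i\<^esub>), add = (\<lambda>x y. \<lambda>i\<in>I. x i \<oplus>\<^bsub>M i\<^esub> y i),
    smult = (\<lambda>r x. \<lambda>i\<in>I. r \<odot>\<^bsub>M i\<^esub> x i)\<rparr>"

lemma module_product_module:
  assumes R: "cring R" and M: "\<And>i. i \<in> I \<Longrightarrow> module R (M i)"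
  shows "module R (product_module I M)"
proof -
  have g: "abelian_group (M i)" if "i \<in> I" for i using M[OF that] by (simp add: module_def)
  note m = abelian_group.axioms(1)[OF g]
  note smult = module.smult_closed[OF M] module.smult_l_distr[OF M] module.smult_r_distr[OF M]
    module.smult_assoc1[OF M] module.smult_one[OF M]
  have "abelian_group (product_module I M)"
  proof (intro abelian_groupI)
    show "\<exists>y\<in>carrier (product_module I M). y \<oplus>\<^bsub>product_module I M\<^esub> x = \<zero>\<^bsub>product_module I M\<^esub>"
      if "x \<in> carrier (product_module I M)" for x
      using that g by (intro bexI[of _ "\<lambda>i\<in>I. \<ominus>\<^bsub>M i\<^esub> x i"])
        (auto simp: product_module_def PiE_iff fun_eq_iff abelian_group.l_neg abelian_group.a_inv_closed)
  qed (auto simp: product_module_def PiE_iff fun_eq_iff extensional_def abelian_monoid.a_closed[OF m]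
      abelian_monoid.a_assoc[OF m] abelian_monoid.a_comm[OF m] abelian_monoid.zero_closed[OF m]
      abelian_monoid.l_zero[OF m] abelian_monoid.r_zero[OF m] abelian_monoid.a_lcomm[OF m])
  then show ?thesis
    using R smult
    by (intro moduleI) (auto simp: product_module_def PiE_iff fun_eq_iff extensional_def)
qed

lemma linear_map_proj: "i \<in> I \<Longrightarrow> linear_map R (product_module I M) (M i) (\<lambda>x. x i)"
  by (auto intro!: linear_mapI simp: product_module_def)

text \<open>Structure is moved along an injection so that a module built from tuples of elements of a
  universe can be realized inside that universe again.\<close>

definition transport_module :: "('m \<Rightarrow> 'n) \<Rightarrow> ('r, 'm) module \<Rightarrow> ('r, 'n) module" where
  "transport_module h M = (let h' = inv_into (carrier M) h in
    \<lparr>carrier = h ` carrier M, mult = undefined, one = undefined,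
    zero = h \<zero>\<^bsub>M\<^esub>, add = (\<lambda>x y. h (h' x \<oplus>\<^bsub>M\<^esub> h' y)), smult = (\<lambda>r x. h (r \<odot>\<^bsub>M\<^esub> h' x))\<rparr>)"

lemma linear_transport_module:
  assumes "module R M" "inj_on h (carrier M)"
  shows "linear_map R M (transport_module h M) h"
    and "linear_map R (transport_module h M) M (inv_into (carrier M) h)"
proof -
  interpret module R M by fact
  show "linear_map R M (transport_module h M) h"
    using assms(2) by (auto intro!: linear_mapI simp: transport_module_def Let_def)
  show "linear_map R (transport_module h M) M (inv_into (carrier M) h)"
    using assms(2) smult_closed by (auto intro!: linear_mapI simp: transport_module_def Let_def)
qed

lemma module_transport_module:
  assumes "module R M" "inj_on h (carrier M)"
  shows "module R (transport_module h M)"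
proof -
  interpret module R M by fact
  note simps = transport_module_def Let_def inv_into_f_f[OF assms(2)]
  have "abelian_group (transport_module h M)"
  proof (intro abelian_groupI)
    show "\<exists>y\<in>carrier (transport_module h M). y \<oplus>\<^bsub>transport_module h M\<^esub> x = \<zero>\<^bsub>transport_module h M\<^esub>"
      if "x \<in> carrier (transport_module h M)" for x
      using that by (intro bexI[of _ "h (\<ominus>\<^bsub>M\<^esub> inv_into (carrier M) h x)"]) (auto simp: simps M.l_neg)
  qed (auto simp: simps M.a_ac)
  then show ?thesis
    using smult_closed by (intro moduleI R.is_cring)
      (auto simp: simps smult_l_distr smult_r_distr smult_assoc1)
qed

text \<open>Since pairs over an infinite type embed into it, so do tuples of any fixed finite length.\<close>

lemma infinite_inj_tuples:
  assumes "infinite (UNIV :: 'm set)" "finite I"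
  shows "\<exists>h :: ('i \<Rightarrow> 'm) \<Rightarrow> 'm. inj_on h (extensional I)"
  using assms(2)
proof (induction I rule: finite_induct)
  case empty
  then show ?case by (auto simp: inj_on_def)
next
  case (insert i I)
  then obtain h :: "('i \<Rightarrow> 'm) \<Rightarrow> 'm" where h: "inj_on h (extensional I)" by blast
  have "(card_of (UNIV \<times> UNIV :: ('m \<times> 'm) set), card_of (UNIV :: 'm set)) \<in> ordLeq"
    using assms(1) card_of_Times_same_infinite ordIso_imp_ordLeq by blast
  then obtain p :: "'m \<times> 'm \<Rightarrow> 'm" where p: "inj p"
    by (auto simp: card_of_ordLeq[symmetric])
  have "inj_on (\<lambda>x. p (x i, h (restrict x I))) (extensional (insert i I))"
  proof (rule inj_onI)
    fix x y :: "'i \<Rightarrow> 'm"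
    assume x: "x \<in> extensional (insert i I)" and y: "y \<in> extensional (insert i I)"
      and "p (x i, h (restrict x I)) = p (y i, h (restrict y I))"
    then have "x i = y i" and "h (restrict x I) = h (restrict y I)"
      using p by (auto dest: injD)
    then have "restrict x I = restrict y I" using h by (auto dest: inj_onD)
    then show "x = y"
      using x y \<open>x i = y i\<close> by (intro extensionalityI[OF x y]) (metis insert_iff restrict_apply')
  qed
  then show ?case by blast
qed

definition transport_functor ::
  "('o \<Rightarrow> 'm \<Rightarrow> 'n) \<Rightarrow> ('o, 'a, 'r, 'm) module_functor \<Rightarrow> ('o, 'a, ('r, 'n) module, 'n \<Rightarrow> 'n) fctr" where
  "transport_functor h F = \<lparr>omap = (\<lambda>X. transport_module (h X) (omap F X)),
    amap = (\<lambda>X Y f. \<lambda>x\<in>h X ` carrier (omap F X). h Y (amap F X Y f (inv_into (carrier (omap F X)) (h X) x)))\<rparr>"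

lemma linear_transport_functor:
  fixes F :: "('o, 'a, 'r, 'm) module_functor" and U :: "'m itself" and V :: "'n itself"
    and h :: "'o \<Rightarrow> 'm \<Rightarrow> 'n"
  assumes K: "linear_category R K" and F: "is_linear_functor R K (mod_category U R) F"
    and h: "\<And>X. X \<in> Ob K \<Longrightarrow> inj_on (h X) (carrier (omap F X))"
  shows "is_linear_functor R K (mod_category V R) (transport_functor h F)"
proof -
  interpret K: linear_category R K by fact
  note F' = is_linear_functor_modD[OF K F]
  note F'' = is_functor_modD[OF F'(1)]
  have car: "carrier (transport_module (h X) (omap F X)) = h X ` carrier (omap F X)" for X
    by (simp add: transport_module_def Let_def)
  note inv = inv_into_f_f[OF h]
  show ?thesis
  proof (intro is_linear_functor_modI K is_functor_modI K.category_axioms)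
    fix X assume X: "X \<in> Ob K"
    show "module R (omap (transport_functor h F) X)"
      using module_transport_module[OF F''(2)[OF X] h[OF X]] by (simp add: transport_functor_def)
  next
    fix X Y f assume X: "X \<in> Ob K" and Y: "Y \<in> Ob K" and f: "f \<in> Hom K X Y"
    have "linear_map R (transport_module (h X) (omap F X)) (transport_module (h Y) (omap F Y))
        (\<lambda>x. h Y (amap F X Y f (inv_into (carrier (omap F X)) (h X) x)))"
      by (intro linear_map_compose[OF linear_transport_module(2)[OF F''(2)[OF X] h[OF X]]]
          linear_map_compose[OF F''(4)[OF X Y f]] linear_transport_module(1)[OF F''(2)[OF Y] h[OF Y]])
    from linear_map_cong[OF this module_transport_module[OF F''(2)[OF X] h[OF X]]]
    show "linear_map R (omap (transport_functor h F) X) (omap (transport_functor h F) Y)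
        (amap (transport_functor h F) X Y f)"
      by (simp add: transport_functor_def car)
  next
    fix X Y f g x assume I: "X \<in> Ob K" "Y \<in> Ob K" "f \<in> Hom K X Y" "g \<in> Hom K X Y"
      and x: "x \<in> carrier (omap (transport_functor h F) X)"
    then obtain y where y: "y \<in> carrier (omap F X)" "x = h X y" by (auto simp: transport_functor_def car)
    show "amap (transport_functor h F) X Y (f \<oplus>\<^bsub>HomMod K X Y\<^esub> g) x =
        amap (transport_functor h F) X Y f x \<oplus>\<^bsub>omap (transport_functor h F) Y\<^esub> amap (transport_functor h F) X Y g x"
      using I y linear_mapD(2)[OF F'(2)[OF I(1,2) y(1)], of f g]
        linear_mapD(2)[OF linear_transport_module(1)[OF F''(2)[OF I(2)] h[OF I(2)]]] F''(7)
      by (simp add: transport_functor_def inv K.carrier_HomMod)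
  next
    fix X Y r f x assume I: "X \<in> Ob K" "Y \<in> Ob K" "r \<in> carrier R" "f \<in> Hom K X Y"
      and x: "x \<in> carrier (omap (transport_functor h F) X)"
    then obtain y where y: "y \<in> carrier (omap F X)" "x = h X y" by (auto simp: transport_functor_def car)
    show "amap (transport_functor h F) X Y (r \<odot>\<^bsub>HomMod K X Y\<^esub> f) x =
        r \<odot>\<^bsub>omap (transport_functor h F) Y\<^esub> amap (transport_functor h F) X Y f x"
      using I y linear_mapD(3)[OF F'(2)[OF I(1,2) y(1)], of r f]
        linear_mapD(3)[OF linear_transport_module(1)[OF F''(2)[OF I(2)] h[OF I(2)]]] F''(7)
      by (simp add: transport_functor_def inv K.carrier_HomMod)
  next
    fix X Y Z f g x assume I: "X \<in> Ob K" "Y \<in> Ob K" "Z \<in> Ob K" "f \<in> Hom K X Y" "g \<in> Hom K Y Z"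
      and x: "x \<in> carrier (omap (transport_functor h F) X)"
    then obtain y where y: "y \<in> carrier (omap F X)" "x = h X y" by (auto simp: transport_functor_def car)
    show "amap (transport_functor h F) X Z (Comp K X Y Z g f) x =
        amap (transport_functor h F) Y Z g (amap (transport_functor h F) X Y f x)"
      using I y F''(6,7) by (simp add: transport_functor_def inv)
  qed (auto simp: transport_functor_def car inv F''(5))
qed


section \<open>Extending modules from a corner\<close>

context full_idempotent_family
begin

text \<open>A module \<open>M\<close> over the corner extends to \<open>A\<close> as the image of the idempotent matrix
  \<open>(M (w\<^sub>i u\<^sub>j))\<close> acting on \<open>\<Oplus>\<^sub>i M (B\<^sub>i)\<close>; an arrow \<open>f\<close> acts by the matrix \<open>(M (w\<^sub>i f u\<^sub>j))\<close>.  All entries lie in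
  the corner.  A single row of such a matrix is the covector \<open>(M (z u\<^sub>j))\<^sub>j\<close>.\<close>

definition row :: "('o, 'a, 'r, 'm) module_functor \<Rightarrow> 'o \<Rightarrow> 'o \<Rightarrow> 'a \<Rightarrow> (nat \<Rightarrow> 'm) \<Rightarrow> 'm" where
  "row M A C z t = (\<Oplus>\<^bsub>omap M C\<^esub>j\<in>{..<n A}. amap M (B A j) C (pre_u A j C z) (t j))"

definition tuples :: "('o, 'a, 'r, 'm) module_functor \<Rightarrow> 'o \<Rightarrow> ('r, nat \<Rightarrow> 'm) module" where
  "tuples M A = product_module {..<n A} (\<lambda>i. omap M (B A i))"

definition matrix ::
  "('o, 'a, 'r, 'm) module_functor \<Rightarrow> 'o \<Rightarrow> 'o \<Rightarrow> 'a \<Rightarrow> (nat \<Rightarrow> 'm) \<Rightarrow> nat \<Rightarrow> 'm" where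
  "matrix M A C f t = (\<lambda>i\<in>{..<n C}. row M A (B C i) (post_w C i A f) t)"

definition extended_module ::
  "('o, 'a, 'r, 'm) module_functor \<Rightarrow> ('o, 'a, ('r, nat \<Rightarrow> 'm) module, (nat \<Rightarrow> 'm) \<Rightarrow> (nat \<Rightarrow> 'm)) fctr" where
  "extended_module M = \<lparr>omap = (\<lambda>A. (tuples M A)\<lparr>carrier :=
      {t \<in> carrier (tuples M A). matrix M A A (Idm K A) t = t}\<rparr>),
    amap = (\<lambda>A C f. restrict (matrix M A C f) {t \<in> carrier (tuples M A). matrix M A A (Idm K A) t = t})\<rparr>"

text \<open>The column \<open>(w\<^sub>i y)\<^sub>i\<close> of an element \<open>y\<close> of \<open>M A\<close>.  The factor \<open>e A\<close> turns \<open>w\<^sub>i\<close> into an arrow of the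
  corner, on which \<open>M\<close> is defined.\<close>

definition col :: "('o, 'a, 'r, 'm) module_functor \<Rightarrow> 'o \<Rightarrow> 'm \<Rightarrow> nat \<Rightarrow> 'm" where
  "col M A y = (\<lambda>i\<in>{..<n A}. amap M A (B A i) (post_w A i A (e A)) y)"

context
  fixes U :: "'m itself" and M :: "('o, 'a, 'r, 'm) module_functor"
  assumes lM: "is_linear_functor R corner (mod_category U R) M" and R: "cring R"
begin

lemmas M_functor = is_linear_functor_modD(1)[OF linear_category_corner lM]
lemmas M_module = is_functor_modD(2)[OF M_functor, simplified]
  and M_linear = is_functor_modD(4)[OF M_functor, simplified]
  and M_Idm = is_functor_modD(5)[OF M_functor, simplified]
  and M_Comp = is_functor_modD(6)[OF M_functor, simplified]
  and M_in = is_functor_modD(7)[OF M_functor, simplified]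
  and M_linear_left = is_linear_functor_modD(2)[OF linear_category_corner lM, simplified]

lemma tuples_in: "t \<in> carrier (tuples M A) \<Longrightarrow> i < n A \<Longrightarrow> t i \<in> carrier (omap M (B A i))"
  by (auto simp: tuples_def product_module_def)

lemma module_tuples: "A \<in> Ob K \<Longrightarrow> module R (tuples M A)"
  unfolding tuples_def by (intro module_product_module R M_module) (auto intro: B_in)

lemma zu_corner:
  assumes "A \<in> Ob K" "C \<in> Ob K" "z \<in> Hom K A C" "Comp K A C C (e C) z = z" "j < n A"
  shows "pre_u A j C z \<in> corner_Hom (B A j) C"
  by (intro corner_Hom_Comp assms B_in u_in u_e)

lemma row_linear:
  assumes "A \<in> Ob K" "C \<in> Ob K" "z \<in> Hom K A C" "Comp K A C C (e C) z = z"
  shows "linear_map R (tuples M A) (omap M C) (row M A C z)"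
proof -
  have "linear_map R (tuples M A) (omap M C) (\<lambda>t. \<Oplus>\<^bsub>omap M C\<^esub>j\<in>{..<n A}.
      amap M (B A j) C (pre_u A j C z) (t j))"
  proof (intro linear_map_sum module_tuples M_module assms finite_lessThan)
    fix j assume "j \<in> {..<n A}"
    then show "linear_map R (tuples M A) (omap M C) (\<lambda>t. amap M (B A j) C (pre_u A j C z) (t j))"
      unfolding tuples_def using assms
      by (intro linear_map_compose[where f = "\<lambda>t. t j", OF linear_map_proj M_linear] zu_corner B_in) auto
  qed
  then show ?thesis by (simp add: row_def[abs_def])
qed

lemma row_in:
  assumes "A \<in> Ob K" "C \<in> Ob K" "z \<in> Hom K A C" "Comp K A C C (e C) z = z" "t \<in> carrier (tuples M A)"
  shows "row M A C z t \<in> carrier (omap M C)"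
  using linear_mapD(1)[OF row_linear] assms by blast

lemma row_linear_left:
  assumes A: "A \<in> Ob K" and C: "C \<in> Ob K" and D: "D \<in> Ob K" and z: "z \<in> Hom K C D"
    and ez: "Comp K C D D (e D) z = z" and t: "t \<in> carrier (tuples M A)"
  shows "linear_map R (HomMod K A C) (omap M D) (\<lambda>f. row M A D (Comp K A C D z f) t)"
proof -
  have "linear_map R (HomMod K A C) (omap M D) (\<lambda>f. \<Oplus>\<^bsub>omap M D\<^esub>j\<in>{..<n A}.
      amap M (B A j) D (pre_u A j D (Comp K A C D z f)) (t j))"
  proof (intro linear_map_sum module_HomMod M_module A C D finite_lessThan)
    fix j assume "j \<in> {..<n A}"
    then have j: "j < n A" by simp
    have "linear_map R (HomMod K A C) (HomMod K (B A j) D) (\<lambda>f. pre_u A j D (Comp K A C D z f))"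
      by (intro linear_map_compose[OF linear_Comp_right linear_Comp_left] A C D z B_in u_in j)
    moreover have "pre_u A j D (Comp K A C D z f) \<in> corner_Hom (B A j) D" if "f \<in> Hom K A C" for f
      using that A C D z ez e_in by (intro zu_corner j Comp_in) (auto simp: Comp_assoc[symmetric])
    ultimately have "linear_map R (HomMod K A C) ((HomMod K (B A j) D)\<lparr>carrier := corner_Hom (B A j) D\<rparr>)
        (\<lambda>f. pre_u A j D (Comp K A C D z f))"
      using A C by (intro linear_mapI) (auto simp: carrier_HomMod linear_map_def)
    from linear_map_compose[OF this M_linear_left[OF B_in[OF A j] D tuples_in[OF t j]]]
    show "linear_map R (HomMod K A C) (omap M D)
        (\<lambda>f. amap M (B A j) D (pre_u A j D (Comp K A C D z f)) (t j))" .
  qed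
  then show ?thesis by (simp add: row_def)
qed

lemma act_row:
  assumes A: "A \<in> Ob K" and C: "C \<in> Ob K" and D: "D \<in> Ob K" and z: "z \<in> Hom K A C"
    and ez: "Comp K A C C (e C) z = z" and y: "y \<in> corner_Hom C D" and t: "t \<in> carrier (tuples M A)"
  shows "amap M C D y (row M A C z t) = row M A D (Comp K A C D y z) t"
proof -
  interpret D: module R "omap M D" by (rule M_module[OF D])
  note zu = zu_corner[OF A C z ez] and tin = tuples_in[OF t]
  have "amap M C D y (row M A C z t) = (\<Oplus>\<^bsub>omap M D\<^esub>j\<in>{..<n A}.
      amap M C D y (amap M (B A j) C (pre_u A j C z) (t j)))"
    unfolding row_def using A C
    by (intro linear_map_finsum[OF M_linear[OF C D y] M_module[OF C] M_module[OF D]] M_in B_in zu tin) auto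
  also have "\<dots> = row M A D (Comp K A C D y z) t"
    unfolding row_def
  proof (intro D.M.finsum_cong' refl Pi_I)
    fix j assume "j \<in> {..<n A}"
    then have j: "j < n A" by simp
    have eq: "pre_u A j D (Comp K A C D y z) = Comp K (B A j) C D y (pre_u A j C z)"
      by (intro Comp_assoc A C D B_in u_in z j corner_HomD(1)[OF y])
    show "amap M C D y (amap M (B A j) C (pre_u A j C z) (t j)) =
        amap M (B A j) D (pre_u A j D (Comp K A C D y z)) (t j)"
      unfolding eq using A C D j y zu[OF j] tin[OF j] by (simp add: M_Comp B_in)
    show "amap M (B A j) D (pre_u A j D (Comp K A C D y z)) (t j) \<in> carrier (omap M D)"
      unfolding eq by (intro M_in B_in A D C j tin corner_Comp[OF _ C] zu y)
  qed
  finally show ?thesis .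
qed

lemma w_Comp:
  assumes "A \<in> Ob K" "C \<in> Ob K" "f \<in> Hom K A C" "i < n C"
  shows "post_w C i A f \<in> Hom K A (B C i)"
    and "Comp K A (B C i) (B C i) (e (B C i)) (post_w C i A f) = post_w C i A f"
  using assms B_in w_in e_w e_in by (auto simp: Comp_in Comp_assoc[symmetric])

text \<open>All the matrix identities below come from inserting \<open>\<Sum>\<^sub>j u\<^sub>j w\<^sub>j = 1\<close> between \<open>z\<close> and \<open>f\<close>, under an
  additive operation \<open>T\<close>.\<close>

lemma sum_row:
  assumes A: "A \<in> Ob K" and C: "C \<in> Ob K" and D: "D \<in> Ob K" and z: "z \<in> Hom K C D"
    and ez: "Comp K C D D (e D) z = z" and f: "f \<in> Hom K A C"
    and T: "linear_map R (HomMod K A C) (omap M D) (\<lambda>g. T (Comp K A C D z g))"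
  shows "(\<Oplus>\<^bsub>omap M D\<^esub>j\<in>{..<n C}. T (Comp K A (B C j) D (pre_u C j D z) (post_w C j A f))) =
    T (Comp K A C D z f)"
proof -
  interpret D: module R "omap M D" by (rule M_module[OF D])
  let ?g = "\<lambda>j. Comp K A C C (uw C j) f"
  have g: "?g j \<in> Hom K A C" if "j < n C" for j
    by (intro Comp_in[OF A C C] f uw_in C that)
  have sum: "(\<Oplus>\<^bsub>HomMod K A C\<^esub>j\<in>{..<n C}. ?g j) = f"
    using linear_map_finsum[OF linear_Comp_left[OF A C C f] module_HomMod[OF C C] module_HomMod[OF A C],
        of "{..<n C}" "uw C"] uw_in[OF C] A C f
    by (simp add: carrier_HomMod sum_uw Comp_Idm_left)
  have "T (Comp K A C D z f) = T (Comp K A C D z (\<Oplus>\<^bsub>HomMod K A C\<^esub>j\<in>{..<n C}. ?g j))" by (simp add: sum)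
  also have "\<dots> = (\<Oplus>\<^bsub>omap M D\<^esub>j\<in>{..<n C}. T (Comp K A C D z (?g j)))"
    using g A C by (intro linear_map_finsum[OF T module_HomMod[OF A C] M_module[OF D]]) (auto simp: carrier_HomMod)
  also have "\<dots> = (\<Oplus>\<^bsub>omap M D\<^esub>j\<in>{..<n C}. T (Comp K A (B C j) D (pre_u C j D z) (post_w C j A f)))"
  proof (intro D.M.finsum_cong' refl Pi_I)
    fix j assume "j \<in> {..<n C}"
    then have j: "j < n C" by simp
    note I = A C D z f B_in[OF C j] u_in[OF C j] w_in[OF C j]
    have "Comp K A C D z (?g j) = Comp K A (B C j) D (pre_u C j D z) (post_w C j A f)"
      using I by (simp add: Comp_assoc Comp_in)
    then show "T (Comp K A C D z (?g j)) = T (Comp K A (B C j) D (pre_u C j D z) (post_w C j A f))"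
      by simp
    then show "T (Comp K A (B C j) D (pre_u C j D z) (post_w C j A f)) \<in> carrier (omap M D)"
      using linear_mapD(1)[OF T, of "?g j"] g[OF j] A C by (simp add: carrier_HomMod)
  qed
  finally show ?thesis by simp
qed

lemma matrix_in:
  assumes "A \<in> Ob K" "C \<in> Ob K" "f \<in> Hom K A C" "t \<in> carrier (tuples M A)"
  shows "matrix M A C f t \<in> carrier (tuples M C)"
  using assms w_Comp by (auto simp: matrix_def tuples_def[of M C] product_module_def intro!: row_in B_in)

lemma row_matrix:
  assumes A: "A \<in> Ob K" and C: "C \<in> Ob K" and D: "D \<in> Ob K" and z: "z \<in> Hom K C D"
    and ez: "Comp K C D D (e D) z = z" and f: "f \<in> Hom K A C" and t: "t \<in> carrier (tuples M A)"
  shows "row M C D z (matrix M A C f t) = row M A D (Comp K A C D z f) t"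
proof -
  interpret D: module R "omap M D" by (rule M_module[OF D])
  have "row M C D z (matrix M A C f t) = (\<Oplus>\<^bsub>omap M D\<^esub>j\<in>{..<n C}.
      row M A D (Comp K A (B C j) D (pre_u C j D z) (post_w C j A f)) t)"
    unfolding row_def[of M C]
  proof (intro D.M.finsum_cong' refl Pi_I)
    fix j assume "j \<in> {..<n C}"
    then have j: "j < n C" by simp
    show "amap M (B C j) D (pre_u C j D z) (matrix M A C f t j) =
        row M A D (Comp K A (B C j) D (pre_u C j D z) (post_w C j A f)) t" (is "?l = ?r")
      using act_row[OF A B_in[OF C j] D w_Comp[OF A C f j] zu_corner[OF C D z ez j] t] j
      by (simp add: matrix_def)
    moreover have "?l \<in> carrier (omap M D)"
      by (intro M_in B_in C D j zu_corner z ez tuples_in matrix_in A f t)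
    ultimately show "?r \<in> carrier (omap M D)" by simp
  qed
  also have "\<dots> = row M A D (Comp K A C D z f) t"
    using sum_row[OF A C D z ez f row_linear_left[OF A C D z ez t]] .
  finally show ?thesis .
qed

lemma row_col:
  assumes A: "A \<in> Ob K" and D: "D \<in> Ob K" and z: "z \<in> Hom K A D"
    and ez: "Comp K A D D (e D) z = z" and y: "y \<in> carrier (omap M A)"
  shows "row M A D z (col M A y) = amap M A D (Comp K A A D z (e A)) y"
proof -
  interpret D: module R "omap M D" by (rule M_module[OF D])
  have we: "post_w A j A (e A) \<in> corner_Hom A (B A j)" if "j < n A" for j
    by (intro corner_Hom_Comp A B_in that e_in w_in e_w e_idem)
  define T where "T g = amap M A D (Comp K A A D g (e A)) y" for g
  have T: "linear_map R (HomMod K A A) (omap M D) (\<lambda>g. T (Comp K A A D z g))"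
  proof -
    have "linear_map R (HomMod K A A) (HomMod K A D) (\<lambda>g. Comp K A A D (Comp K A A D z g) (e A))"
      by (intro linear_map_compose[OF linear_Comp_right linear_Comp_left] A D z e_in)
    moreover have "Comp K A A D (Comp K A A D z g) (e A) \<in> corner_Hom A D" if "g \<in> Hom K A A" for g
      using that A D z ez e_in e_idem by (intro corner_Hom_Comp) (auto simp: Comp_in Comp_assoc[symmetric])
    ultimately have "linear_map R (HomMod K A A) ((HomMod K A D)\<lparr>carrier := corner_Hom A D\<rparr>)
        (\<lambda>g. Comp K A A D (Comp K A A D z g) (e A))"
      using A by (intro linear_mapI) (auto simp: carrier_HomMod linear_map_def)
    from linear_map_compose[OF this M_linear_left[OF A D y]] show ?thesis by (simp add: T_def)
  qed
  have Tc: "T (Comp K A (B A j) D (pre_u A j D z) (post_w A j A (e A))) =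
      amap M (B A j) D (pre_u A j D z) (col M A y j)" if j: "j < n A" for j
  proof -
    have "Comp K A A D (Comp K A (B A j) D (pre_u A j D z) (post_w A j A (e A))) (e A) =
        Comp K A (B A j) D (pre_u A j D z) (post_w A j A (e A))"
      using corner_Comp[OF A B_in[OF A j] D we[OF j] zu_corner[OF A D z ez j]] by (rule corner_HomD(2))
    then show ?thesis
      using M_Comp[OF A B_in[OF A j] D we[OF j] zu_corner[OF A D z ez j] y] j
      by (simp add: T_def col_def)
  qed
  have "row M A D z (col M A y) = (\<Oplus>\<^bsub>omap M D\<^esub>j\<in>{..<n A}.
      T (Comp K A (B A j) D (pre_u A j D z) (post_w A j A (e A))))"
    unfolding row_def
  proof (intro D.M.finsum_cong' refl Pi_I)
    fix j assume "j \<in> {..<n A}"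
    then have j: "j < n A" by simp
    show "amap M (B A j) D (pre_u A j D z) (col M A y j) =
        T (Comp K A (B A j) D (pre_u A j D z) (post_w A j A (e A)))"
      by (simp add: Tc j)
    show "T (Comp K A (B A j) D (pre_u A j D z) (post_w A j A (e A))) \<in> carrier (omap M D)"
      unfolding Tc[OF j] using j A D z ez y we[OF j]
      by (auto simp: col_def intro!: M_in B_in zu_corner)
  qed
  also have "\<dots> = T (Comp K A A D z (e A))"
    by (rule sum_row[OF A A D z ez e_in[OF A] T])
  also have "\<dots> = amap M A D (Comp K A A D z (e A)) y"
    using A D z e_in e_idem by (simp add: T_def Comp_assoc)
  finally show ?thesis .
qed

lemma matrix_matrix:
  assumes "A \<in> Ob K" "C \<in> Ob K" "D \<in> Ob K" "f \<in> Hom K A C" "g \<in> Hom K C D" "t \<in> carrier (tuples M A)"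
  shows "matrix M C D g (matrix M A C f t) = matrix M A D (Comp K A C D g f) t"
  unfolding matrix_def[of M C D] matrix_def[of M A D]
proof (rule restrict_ext)
  fix i assume "i \<in> {..<n D}"
  then have i: "i < n D" by simp
  show "row M C (B D i) (post_w D i C g) (matrix M A C f t) =
      row M A (B D i) (post_w D i A (Comp K A C D g f)) t"
    using row_matrix[OF assms(1,2) B_in[OF assms(3) i] w_Comp[OF assms(2,3,5) i] assms(4,6)] i assms B_in w_in
    by (simp add: Comp_assoc)
qed

abbreviation (input) "fixed_tuples A \<equiv> {t \<in> carrier (tuples M A). matrix M A A (Idm K A) t = t}"

lemma matrix_fixed:
  assumes "A \<in> Ob K" "C \<in> Ob K" "f \<in> Hom K A C" "t \<in> carrier (tuples M A)"
  shows "matrix M A C f t \<in> fixed_tuples C"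
  using assms by (simp add: matrix_in matrix_matrix Idm_in Comp_Idm_left)

lemma matrix_linear:
  assumes A: "A \<in> Ob K" and C: "C \<in> Ob K" and f: "f \<in> Hom K A C"
  shows "linear_map R (tuples M A) (tuples M C) (matrix M A C f)"
proof (intro linear_mapI)
  note lin = row_linear[OF A B_in[OF C] w_Comp[OF A C f]]
  show "matrix M A C f (x \<oplus>\<^bsub>tuples M A\<^esub> y) = matrix M A C f x \<oplus>\<^bsub>tuples M C\<^esub> matrix M A C f y"
    if "x \<in> carrier (tuples M A)" "y \<in> carrier (tuples M A)" for x y
    using that linear_mapD(2)[OF lin]
    by (auto simp: matrix_def fun_eq_iff tuples_def[of M C] product_module_def)
  show "matrix M A C f (r \<odot>\<^bsub>tuples M A\<^esub> x) = r \<odot>\<^bsub>tuples M C\<^esub> matrix M A C f x"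
    if "r \<in> carrier R" "x \<in> carrier (tuples M A)" for r x
    using that linear_mapD(3)[OF lin]
    by (auto simp: matrix_def fun_eq_iff tuples_def[of M C] product_module_def)
qed (intro matrix_in A C f)

lemma module_fixed_tuples: "A \<in> Ob K \<Longrightarrow> module R ((tuples M A)\<lparr>carrier := fixed_tuples A\<rparr>)"
  by (intro module_fixed_points module_tuples matrix_linear Idm_in)

lemma matrix_linear_left:
  assumes A: "A \<in> Ob K" and C: "C \<in> Ob K" and t: "t \<in> carrier (tuples M A)"
  shows "linear_map R (HomMod K A C) (tuples M C) (\<lambda>f. matrix M A C f t)"
proof (intro linear_mapI)
  note lin = row_linear_left[OF A C B_in[OF C] w_in[OF C] e_w[OF C] t]
  show "matrix M A C (x \<oplus>\<^bsub>HomMod K A C\<^esub> y) t = matrix M A C x t \<oplus>\<^bsub>tuples M C\<^esub> matrix M A C y t"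
    if "x \<in> carrier (HomMod K A C)" "y \<in> carrier (HomMod K A C)" for x y
    using that linear_mapD(2)[OF lin]
    by (auto simp: matrix_def fun_eq_iff tuples_def[of M C] product_module_def)
  show "matrix M A C (r \<odot>\<^bsub>HomMod K A C\<^esub> x) t = r \<odot>\<^bsub>tuples M C\<^esub> matrix M A C x t"
    if "r \<in> carrier R" "x \<in> carrier (HomMod K A C)" for r x
    using that linear_mapD(3)[OF lin]
    by (auto simp: matrix_def fun_eq_iff tuples_def[of M C] product_module_def)
qed (use assms carrier_HomMod matrix_in in auto)

lemma extended_module_simps:
  "omap (extended_module M) A = (tuples M A)\<lparr>carrier := fixed_tuples A\<rparr>"
  "t \<in> fixed_tuples A \<Longrightarrow> amap (extended_module M) A C f t = matrix M A C f t"
  by (simp_all add: extended_module_def)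

lemma linear_extended_module:
  fixes V :: "(nat \<Rightarrow> 'm) itself"
  shows "is_linear_functor R K (mod_category V R) (extended_module M)"
proof (intro is_linear_functor_modI is_functor_modI linear_category_axioms category_axioms)
  fix A C f assume A: "A \<in> Ob K" and C: "C \<in> Ob K" and f: "f \<in> Hom K A C"
  have "linear_map R ((tuples M A)\<lparr>carrier := fixed_tuples A\<rparr>) ((tuples M C)\<lparr>carrier := fixed_tuples C\<rparr>) (matrix M A C f)"
    using linear_mapD[OF matrix_linear[OF A C f]] matrix_fixed[OF A C f]
    by (intro linear_mapI) auto
  from linear_map_cong[OF this module_fixed_tuples[OF A]]
  show "linear_map R (omap (extended_module M) A) (omap (extended_module M) C) (amap (extended_module M) A C f)"
    by (simp add: extended_module_simps)
next
  fix A C f g t assume "A \<in> Ob K" "C \<in> Ob K" "f \<in> Hom K A C" "g \<in> Hom K A C"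
    and "t \<in> carrier (omap (extended_module M) A)"
  then show "amap (extended_module M) A C (f \<oplus>\<^bsub>HomMod K A C\<^esub> g) t =
      amap (extended_module M) A C f t \<oplus>\<^bsub>omap (extended_module M) C\<^esub> amap (extended_module M) A C g t"
    using linear_mapD(2)[OF matrix_linear_left] by (simp add: extended_module_simps carrier_HomMod)
next
  fix A C r f t assume "A \<in> Ob K" "C \<in> Ob K" "r \<in> carrier R" "f \<in> Hom K A C"
    and "t \<in> carrier (omap (extended_module M) A)"
  then show "amap (extended_module M) A C (r \<odot>\<^bsub>HomMod K A C\<^esub> f) t =
      r \<odot>\<^bsub>omap (extended_module M) C\<^esub> amap (extended_module M) A C f t"
    using linear_mapD(3)[OF matrix_linear_left] by (simp add: extended_module_simps carrier_HomMod)
next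
  fix A C D f g t assume "A \<in> Ob K" "C \<in> Ob K" "D \<in> Ob K" "f \<in> Hom K A C" "g \<in> Hom K C D"
    and "t \<in> carrier (omap (extended_module M) A)"
  then show "amap (extended_module M) A D (Comp K A C D g f) t =
      amap (extended_module M) C D g (amap (extended_module M) A C f t)"
    using matrix_fixed[of A C f t] by (simp add: extended_module_simps matrix_matrix)
qed (auto simp: extended_module_def module_fixed_tuples)

lemma col_in:
  assumes A: "A \<in> Ob K" and y: "y \<in> carrier (omap M A)"
  shows "col M A y \<in> carrier (tuples M A)"
  using assms by (auto simp: col_def tuples_def product_module_def
      intro!: M_in B_in corner_Hom_Comp e_in w_in e_w e_idem)

lemma matrix_col:
  assumes A: "A \<in> Ob K" and C: "C \<in> Ob K" and f: "f \<in> Hom K A C" and y: "y \<in> carrier (omap M A)"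
  shows "matrix M A C f (col M A y) =
    (\<lambda>i\<in>{..<n C}. amap M A (B C i) (post_w C i A (Comp K A A C f (e A))) y)"
  unfolding matrix_def
proof (rule restrict_ext)
  fix i assume "i \<in> {..<n C}"
  then have i: "i < n C" by simp
  show "row M A (B C i) (post_w C i A f) (col M A y) =
      amap M A (B C i) (post_w C i A (Comp K A A C f (e A))) y"
    using row_col[OF A B_in[OF C i] w_Comp[OF A C f i] y] A C f i by (simp add: Comp_assoc B_in w_in e_in)
qed

lemma col_fixed:
  assumes A: "A \<in> Ob K" and y: "y \<in> carrier (omap M A)"
  shows "col M A y \<in> fixed_tuples A" "matrix M A A (e A) (col M A y) = col M A y"
  using assms col_in[OF A y]
  by (simp_all add: matrix_col Idm_in Comp_Idm_left e_in e_idem) (simp_all add: col_def)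

lemma col_linear:
  assumes A: "A \<in> Ob K"
  shows "linear_map R (omap M A) (tuples M A) (col M A)"
proof (intro linear_mapI)
  have we: "post_w A j A (e A) \<in> corner_Hom A (B A j)" if "j < n A" for j
    by (intro corner_Hom_Comp A B_in that e_in w_in e_w e_idem)
  note lin = M_linear[OF A B_in[OF A] we]
  show "col M A (x \<oplus>\<^bsub>omap M A\<^esub> y) = col M A x \<oplus>\<^bsub>tuples M A\<^esub> col M A y"
    if "x \<in> carrier (omap M A)" "y \<in> carrier (omap M A)" for x y
    using that linear_mapD(2)[OF lin]
    by (auto simp: col_def fun_eq_iff tuples_def product_module_def)
  show "col M A (r \<odot>\<^bsub>omap M A\<^esub> x) = r \<odot>\<^bsub>tuples M A\<^esub> col M A x"
    if "r \<in> carrier R" "x \<in> carrier (omap M A)" for r x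
    using that linear_mapD(3)[OF lin]
    by (auto simp: col_def fun_eq_iff tuples_def product_module_def)
qed (intro col_in A)

lemma row_e_col:
  assumes A: "A \<in> Ob K" and y: "y \<in> carrier (omap M A)"
  shows "row M A A (e A) (col M A y) = y"
  using row_col[OF A A e_in[OF A] e_idem[OF A] y] A y by (simp add: e_idem M_Idm)

lemma col_row_e:
  assumes A: "A \<in> Ob K" and t: "t \<in> carrier (tuples M A)"
  shows "col M A (row M A A (e A) t) = matrix M A A (e A) t"
  unfolding col_def matrix_def
proof (rule restrict_ext)
  fix i assume "i \<in> {..<n A}"
  then have i: "i < n A" by simp
  have we: "post_w A i A (e A) \<in> corner_Hom A (B A i)"
    by (intro corner_Hom_Comp A B_in i e_in w_in e_w e_idem)
  show "amap M A (B A i) (post_w A i A (e A)) (row M A A (e A) t) =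
      row M A (B A i) (post_w A i A (e A)) t"
    using act_row[OF A A B_in[OF A i] e_in[OF A] e_idem[OF A] we t] corner_HomD(2)[OF we] by simp
qed

lemma col_natural:
  assumes A: "A \<in> Ob K" and C: "C \<in> Ob K" and f: "f \<in> corner_Hom A C" and y: "y \<in> carrier (omap M A)"
  shows "col M C (amap M A C f y) = matrix M A C f (col M A y)"
  unfolding matrix_col[OF A C corner_HomD(1)[OF f] y] col_def[of M C]
proof (rule restrict_ext)
  fix i assume "i \<in> {..<n C}"
  then have i: "i < n C" by simp
  have we: "post_w C i C (e C) \<in> corner_Hom C (B C i)"
    by (intro corner_Hom_Comp C B_in i e_in w_in e_w e_idem)
  have "Comp K A C (B C i) (post_w C i C (e C)) f = post_w C i A (Comp K A A C f (e A))"
    using A C i B_in w_in e_in corner_HomD[OF f] by (simp add: Comp_assoc)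
  then show "amap M C (B C i) (post_w C i C (e C)) (amap M A C f y) =
      amap M A (B C i) (post_w C i A (Comp K A A C f (e A))) y"
    using M_Comp[OF A C B_in[OF C i] f we y] by simp
qed

text \<open>The restriction of the extended module to the corner consists of the tuples fixed by the matrix
  of \<open>e A\<close>.  These are exactly the columns of elements of \<open>M A\<close>, and the row of \<open>e A\<close> recovers the
  element from its column.\<close>

lemma corner_of_extended_module:
  assumes inf: "infinite (UNIV :: 'm set)"
  shows "\<exists>N. is_linear_functor R K (mod_category U R) N \<and>
    (\<exists>\<eta>. is_iso_in (linear_Mod_over U R corner) M (corner_module N) \<eta>)"
proof -
  have "\<forall>A. \<exists>h :: (nat \<Rightarrow> 'm) \<Rightarrow> 'm. inj_on h (extensional {..<n A})"
    using infinite_inj_tuples[OF inf] by blast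
  then obtain h :: "'o \<Rightarrow> (nat \<Rightarrow> 'm) \<Rightarrow> 'm" where h0: "\<And>A. inj_on (h A) (extensional {..<n A})"
    by metis
  have h: "inj_on (h A) (fixed_tuples A)" for A
    by (rule inj_on_subset[OF h0]) (auto simp: tuples_def product_module_def PiE_def)
  let ?X = "extended_module M"
  define N where "N = transport_functor h ?X"
  define k where "k A = inv_into (fixed_tuples A) (h A)" for A
  note lX = linear_extended_module[where V = "TYPE(nat \<Rightarrow> 'm)"]
  have kh: "k A (h A t) = t" if "t \<in> fixed_tuples A" for A t
    unfolding k_def using inv_into_f_f[OF h that] .
  have N: "is_linear_functor R K (mod_category U R) N"
    unfolding N_def
    by (rule linear_transport_functor[OF linear_category_axioms lX]) (simp add: extended_module_simps h)
  have N_omap: "omap N A = transport_module (h A) ((tuples M A)\<lparr>carrier := fixed_tuples A\<rparr>)" for A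
    by (simp add: N_def transport_functor_def extended_module_simps)
  have N_carrier: "carrier (omap N A) = h A ` fixed_tuples A" for A
    by (simp add: N_omap transport_module_def Let_def)
  have N_amap: "amap N A C f (h A t) = h C (matrix M A C f t)" if "t \<in> fixed_tuples A" for A C f t
    using that kh[OF that] by (simp add: N_def transport_functor_def extended_module_simps k_def)
  have points: "corner_points N A = h A ` {t \<in> fixed_tuples A. matrix M A A (e A) t = t}" if A: "A \<in> Ob K" for A
  proof -
    have "h A (matrix M A A (e A) t) = h A t \<longleftrightarrow> matrix M A A (e A) t = t" if "t \<in> fixed_tuples A" for t
      using that A matrix_fixed[OF A A e_in[OF A], of t] inj_on_eq_iff[OF h] by blast
    then show ?thesis by (auto simp: corner_points_def N_carrier N_amap)
  qed
  have "\<exists>\<eta>. is_iso_in (linear_Mod_over U R corner) M (corner_module N) \<eta>"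
  proof (rule linear_Mod_over_iso[OF linear_category_corner lM linear_corner_module[OF N],
        where \<eta> = "\<lambda>A y. h A (col M A y)" and \<theta> = "\<lambda>A x. row M A A (e A) (k A x)"])
    fix A assume "A \<in> Ob corner"
    then have A: "A \<in> Ob K" by simp
    let ?T = "(tuples M A)\<lparr>carrier := fixed_tuples A\<rparr>"
    have T: "module R ?T" by (rule module_fixed_tuples[OF A])
    have hA: "inj_on (h A) (carrier ?T)" using h by simp
    have 1: "linear_map R (omap M A) ?T (col M A)"
      using linear_mapD[OF col_linear[OF A]] col_fixed[OF A] by (intro linear_mapI) auto
    have 2: "linear_map R ?T (omap M A) (row M A A (e A))"
      using linear_mapD[OF row_linear[OF A A e_in[OF A] e_idem[OF A]]] by (intro linear_mapI) auto
    have "linear_map R (omap M A) (omap N A) (\<lambda>y. h A (col M A y))"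
      unfolding N_omap by (rule linear_map_compose[OF 1 linear_transport_module(1)[OF T hA]])
    then show "linear_map R (omap M A) (omap (corner_module N) A) (\<lambda>y. h A (col M A y))"
      using col_fixed[OF A] by (auto simp: linear_map_def corner_module_simps points[OF A])
    have "linear_map R (omap N A) (omap M A) (\<lambda>x. row M A A (e A) (k A x))"
      unfolding N_omap k_def using linear_map_compose[OF linear_transport_module(2)[OF T hA] 2] by simp
    then show "linear_map R (omap (corner_module N) A) (omap M A) (\<lambda>x. row M A A (e A) (k A x))"
      by (auto simp: linear_map_def corner_module_simps corner_points_def)
    show "row M A A (e A) (k A (h A (col M A y))) = y" if "y \<in> carrier (omap M A)" for y
      using that A by (simp add: kh[OF col_fixed(1)] row_e_col)
    show "h A (col M A (row M A A (e A) (k A x))) = x" if "x \<in> carrier (omap (corner_module N) A)" for x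
      using that A kh[of _ A] by (auto simp: corner_module_simps points[OF A] col_row_e)
  next
    fix A C f y assume "A \<in> Ob corner" "C \<in> Ob corner" "f \<in> Hom corner A C" and y: "y \<in> carrier (omap M A)"
    then have A: "A \<in> Ob K" and C: "C \<in> Ob K" and f: "f \<in> corner_Hom A C" by auto
    have "h A (col M A y) \<in> corner_points N A"
      using col_fixed[OF A y] by (auto simp: points[OF A])
    then show "h C (col M C (amap M A C f y)) = amap (corner_module N) A C f (h A (col M A y))"
      using col_natural[OF A C f y] N_amap[OF col_fixed(1)[OF A y]] by (simp add: corner_module_simps)
  qed
  with N show ?thesis by blast
qed

end

lemma is_iso_in_sym: "is_iso_in C X Y f \<Longrightarrow> \<exists>g. is_iso_in C Y X g"
  by (auto simp: is_iso_in_def)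

lemma essentially_surjective_corner_functor:
  fixes U :: "'m itself"
  assumes "infinite (UNIV :: 'm set)" "cring R"
  shows "essentially_surjective (linear_Mod_over U R K) (linear_Mod_over U R corner) corner_functor"
  unfolding essentially_surjective_def
proof
  fix M assume "M \<in> Ob (linear_Mod_over U R corner)"
  then have M: "is_linear_functor R corner (mod_category U R) M"
    by (simp add: linear_Mod_over_simps[OF linear_category_corner])
  from corner_of_extended_module[OF M assms(2,1)] obtain N \<eta> where N: "is_linear_functor R K (mod_category U R) N"
    and "is_iso_in (linear_Mod_over U R corner) M (corner_module N) \<eta>" by blast
  from is_iso_in_sym[OF this(2)] N
  show "\<exists>N\<in>Ob (linear_Mod_over U R K). \<exists>f. is_iso_in (linear_Mod_over U R corner) (omap corner_functor N) M f"
    by (auto simp: linear_Mod_over_simps[OF linear_category_axioms] corner_functor_def)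
qed

end


section \<open>The linearization of a category with finite hom-sets\<close>

text \<open>Composition is the bilinear extension of composition in \<open>C\<close>.  The hom-sets are assumed
  finite, so that all coefficient functions are allowed.\<close>

definition linearization :: "('r, 'x) ring_scheme \<Rightarrow> ('o, 'a, 'z) cat_scheme \<Rightarrow> ('o, 'a \<Rightarrow> 'r, 'r) lincat" where
  "linearization R C = \<lparr>Ob = Ob C,
    Hom = (\<lambda>X Y. carrier (free_module R (Hom C X Y))),
    Idm = (\<lambda>X. single R (Hom C X X) (Idm C X)),
    Comp = (\<lambda>X Y Z v u. lin_ext (Hom C Y Z) (free_module R (Hom C X Z))
      (\<lambda>g. lin_ext (Hom C X Y) (free_module R (Hom C X Z))
        (\<lambda>f. single R (Hom C X Z) (Comp C X Y Z g f)) u) v),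
    HomMod = (\<lambda>X Y. free_module R (Hom C X Y))\<rparr>"

definition linearize_module ::
  "('o, 'a, 'z) cat_scheme \<Rightarrow> ('o, 'a, 'r, 'm) module_functor \<Rightarrow>
   ('o, 'a \<Rightarrow> 'r, ('r, 'm) module, 'm \<Rightarrow> 'm) fctr" where
  "linearize_module C F = \<lparr>omap = omap F,
    amap = (\<lambda>X Y u. \<lambda>x\<in>carrier (omap F X). lin_ext (Hom C X Y) (omap F Y) (\<lambda>f. amap F X Y f x) u)\<rparr>"

definition linearize_functor ::
  "('o, 'a, 'z) cat_scheme \<Rightarrow> (('o, 'a, 'r, 'm) module_functor, 'o \<Rightarrow> 'm \<Rightarrow> 'm,
    ('o, 'a \<Rightarrow> 'r, ('r, 'm) module, 'm \<Rightarrow> 'm) fctr, 'o \<Rightarrow> 'm \<Rightarrow> 'm) fctr" where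
  "linearize_functor C = \<lparr>omap = linearize_module C, amap = (\<lambda>F G \<eta>. \<eta>)\<rparr>"

locale hom_finite_category = category C
  for C :: "('o, 'a, 'z) cat_scheme" +
  fixes R :: "('r, 'x) ring_scheme"
  assumes cring: "cring R"
    and finite_Hom: "X \<in> Ob C \<Longrightarrow> Y \<in> Ob C \<Longrightarrow> finite (Hom C X Y)"
begin

abbreviation "L \<equiv> linearization R C"
abbreviation "basis X Y \<equiv> single R (Hom C X Y)"

lemma L_simps [simp]:
  "Ob L = Ob C" "Hom L X Y = carrier (free_module R (Hom C X Y))" "Idm L X = basis X X (Idm C X)"
  "HomMod L X Y = free_module R (Hom C X Y)"
  by (simp_all add: linearization_def)

lemmas module_free = module_free_module[OF cring] and basis_in = single_in[OF cring]

lemma Comp_L: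
  "Comp L X Y Z v u = lin_ext (Hom C Y Z) (free_module R (Hom C X Z))
      (\<lambda>g. lin_ext (Hom C X Y) (free_module R (Hom C X Z)) (\<lambda>f. basis X Z (Comp C X Y Z g f)) u) v"
  by (simp add: linearization_def)

lemma Comp_L_left:
  assumes "X \<in> Ob C" "Y \<in> Ob C" "Z \<in> Ob C" "u \<in> carrier (free_module R (Hom C X Y))"
  shows "linear_map R (free_module R (Hom C Y Z)) (free_module R (Hom C X Z)) (\<lambda>v. Comp L X Y Z v u)"
  unfolding Comp_L using assms(1-3)
  by (intro lin_ext_linear module_free finite_Hom linear_mapD(1)[OF lin_ext_linear assms(4)] basis_in)

lemma Comp_L_right:
  assumes "X \<in> Ob C" "Y \<in> Ob C" "Z \<in> Ob C" "v \<in> carrier (free_module R (Hom C Y Z))"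
  shows "linear_map R (free_module R (Hom C X Y)) (free_module R (Hom C X Z)) (\<lambda>u. Comp L X Y Z v u)"
proof -
  have "v g \<in> carrier R" if "g \<in> Hom C Y Z" for g using assms(4) that by (auto simp: free_module_def)
  then show ?thesis
    unfolding Comp_L lin_ext_def[of "Hom C Y Z"] using assms(1-3)
    by (intro linear_map_sum linear_map_smult module_free finite_Hom lin_ext_linear basis_in)
qed

lemma Comp_basis:
  assumes "X \<in> Ob C" "Y \<in> Ob C" "Z \<in> Ob C" "f \<in> Hom C X Y" "g \<in> Hom C Y Z"
  shows "Comp L X Y Z (basis Y Z g) (basis X Y f) = basis X Z (Comp C X Y Z g f)"
  unfolding Comp_L using assms
  by (subst lin_ext_single) (auto intro!: finite_Hom module_free basis_in linear_mapD(1)[OF lin_ext_linear] lin_ext_single)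

lemma Comp_L_in:
  assumes "X \<in> Ob C" "Y \<in> Ob C" "Z \<in> Ob C"
    "u \<in> carrier (free_module R (Hom C X Y))" "v \<in> carrier (free_module R (Hom C Y Z))"
  shows "Comp L X Y Z v u \<in> carrier (free_module R (Hom C X Z))"
  using linear_mapD(1)[OF Comp_L_left] assms by blast

lemma linear_category_linearization: "linear_category R L"
proof (intro linear_category.intro category.intro linear_category_axioms.intro)
  fix X Y u assume "X \<in> Ob L" "Y \<in> Ob L" and u: "u \<in> Hom L X Y"
  then have X: "X \<in> Ob C" and Y: "Y \<in> Ob C" by auto
  have id: "linear_map R (free_module R (Hom C X Y)) (free_module R (Hom C X Y)) (\<lambda>u. u)"
    by (intro linear_mapI) auto
  show "Comp L X Y Y (Idm L Y) u = u"
    by (rule linear_map_eq_on_single[OF Comp_L_right[OF X Y Y] id module_free finite_Hom[OF X Y]])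
      (use u X Y Idm_in in \<open>auto simp: basis_in Comp_basis Comp_Idm_left\<close>)
  show "Comp L X X Y u (Idm L X) = u"
    by (rule linear_map_eq_on_single[OF Comp_L_left[OF X X Y] id module_free finite_Hom[OF X Y]])
      (use u X Y Idm_in in \<open>auto simp: basis_in Comp_basis Comp_Idm_right\<close>)
next
  fix W X Y Z f g h assume "W \<in> Ob L" "X \<in> Ob L" "Y \<in> Ob L" "Z \<in> Ob L"
    and f: "f \<in> Hom L W X" and g: "g \<in> Hom L X Y" and h: "h \<in> Hom L Y Z"
  then have O: "W \<in> Ob C" "X \<in> Ob C" "Y \<in> Ob C" "Z \<in> Ob C" by auto
  have 1: "Comp L W X Z (Comp L X Y Z (basis Y Z h) (basis X Y g)) (basis W X f) =
      Comp L W Y Z (basis Y Z h) (Comp L W X Y (basis X Y g) (basis W X f))"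
    if "f \<in> Hom C W X" "g \<in> Hom C X Y" "h \<in> Hom C Y Z" for f g h
    using that O by (simp add: Comp_basis Comp_in Comp_assoc)
  have 2: "Comp L W X Z (Comp L X Y Z (basis Y Z h) (basis X Y g)) f =
      Comp L W Y Z (basis Y Z h) (Comp L W X Y (basis X Y g) f)"
    if "f \<in> Hom L W X" "g \<in> Hom C X Y" "h \<in> Hom C Y Z" for f g h
    using that O
    by (intro linear_map_eq_on_single[OF Comp_L_right linear_map_compose[OF Comp_L_right Comp_L_right]
          module_free finite_Hom 1]) (auto intro!: Comp_L_in basis_in)
  have 3: "Comp L W X Z (Comp L X Y Z (basis Y Z h) g) f = Comp L W Y Z (basis Y Z h) (Comp L W X Y g f)"
    if "f \<in> Hom L W X" "g \<in> Hom L X Y" "h \<in> Hom C Y Z" for f g h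
    using that O
    by (intro linear_map_eq_on_single[where u = g, OF linear_map_compose[OF Comp_L_right Comp_L_left]
          linear_map_compose[OF Comp_L_left Comp_L_right] module_free finite_Hom 2]) (auto intro!: Comp_L_in basis_in)
  show "Comp L W X Z (Comp L X Y Z h g) f = Comp L W Y Z h (Comp L W X Y g f)"
    using f g h O
    by (intro linear_map_eq_on_single[where u = h, OF linear_map_compose[OF Comp_L_left Comp_L_left]
          Comp_L_left module_free finite_Hom 3]) (auto intro!: Comp_L_in basis_in)
qed (auto intro: basis_in Comp_L_in module_free Comp_L_left Comp_L_right)

context
  fixes U :: "'m itself" and F :: "('o, 'a, 'r, 'm) module_functor"
  assumes F: "is_functor C (mod_category U R) F"
begin

lemma linearize_basis:
  assumes "X \<in> Ob C" "Y \<in> Ob C" "f \<in> Hom C X Y" "x \<in> carrier (omap F X)"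
  shows "amap (linearize_module C F) X Y (basis X Y f) x = amap F X Y f x"
  using assms is_functor_modD[OF F]
  by (simp add: linearize_module_def lin_ext_single finite_Hom)

lemma linearize_linear_left:
  assumes "X \<in> Ob C" "Y \<in> Ob C" "x \<in> carrier (omap F X)"
  shows "linear_map R (free_module R (Hom C X Y)) (omap F Y) (\<lambda>u. amap (linearize_module C F) X Y u x)"
  using assms is_functor_modD[OF F]
  by (simp add: linearize_module_def lin_ext_linear[unfolded lin_ext_def] finite_Hom lin_ext_def)

lemma linearize_linear_right:
  assumes X: "X \<in> Ob C" and Y: "Y \<in> Ob C" and u: "u \<in> carrier (free_module R (Hom C X Y))"
  shows "linear_map R (omap F X) (omap F Y) (amap (linearize_module C F) X Y u)"
proof -
  note m = is_functor_modD(2)[OF F]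
  have "u f \<in> carrier R" if "f \<in> Hom C X Y" for f using u that by (auto simp: free_module_def)
  then have "linear_map R (omap F X) (omap F Y) (\<lambda>x. lin_ext (Hom C X Y) (omap F Y) (\<lambda>f. amap F X Y f x) u)"
    unfolding lin_ext_def using X Y
    by (intro linear_map_sum linear_map_smult m finite_Hom is_functor_modD(4)[OF F])
  from linear_map_cong[OF this m[OF X]] show ?thesis by (simp add: linearize_module_def)
qed

lemma linear_linearize_module: "is_linear_functor R L (mod_category U R) (linearize_module C F)"
proof (intro is_linear_functor_modI is_functor_modI linear_category_linearization)
  show "category L" using linear_category_linearization by (simp add: linear_category_def)
next
  fix X Y u assume "X \<in> Ob L" "Y \<in> Ob L" "u \<in> Hom L X Y"
  then show "linear_map R (omap (linearize_module C F) X) (omap (linearize_module C F) Y)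
      (amap (linearize_module C F) X Y u)"
    using linearize_linear_right by (simp add: linearize_module_def)
next
  fix X Y Z u v x assume "X \<in> Ob L" "Y \<in> Ob L" "Z \<in> Ob L" and uv: "u \<in> Hom L X Y" "v \<in> Hom L Y Z"
    and "x \<in> carrier (omap (linearize_module C F) X)"
  then have O: "X \<in> Ob C" "Y \<in> Ob C" "Z \<in> Ob C" and x: "x \<in> carrier (omap F X)"
    by (auto simp: linearize_module_def)
  note act_in = linear_mapD(1)[OF linearize_linear_right] and m = is_functor_modD(2)[OF F]
  have 1: "amap (linearize_module C F) X Z (Comp L X Y Z (basis Y Z g) (basis X Y f)) x =
      amap (linearize_module C F) Y Z (basis Y Z g) (amap (linearize_module C F) X Y (basis X Y f) x)"
    if "f \<in> Hom C X Y" "g \<in> Hom C Y Z" for f g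
    using that O x is_functor_modD(6,7)[OF F] by (simp add: Comp_basis linearize_basis Comp_in)
  have 2: "amap (linearize_module C F) X Z (Comp L X Y Z (basis Y Z g) u) x =
      amap (linearize_module C F) Y Z (basis Y Z g) (amap (linearize_module C F) X Y u x)"
    if "u \<in> Hom L X Y" "g \<in> Hom C Y Z" for u g
    using that O x
    by (intro linear_map_eq_on_single[OF linear_map_compose[OF Comp_L_right linearize_linear_left]
          linear_map_compose[OF linearize_linear_left linearize_linear_right] m finite_Hom 1]) (auto intro!: basis_in)
  show "amap (linearize_module C F) X Z (Comp L X Y Z v u) x =
      amap (linearize_module C F) Y Z v (amap (linearize_module C F) X Y u x)"
    using uv O x
    by (intro linear_map_eq_on_single[where u = v, OF linear_map_compose[OF Comp_L_left linearize_linear_left]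
          linearize_linear_left m finite_Hom 2]) (auto intro!: basis_in act_in)
next
  fix X x assume X: "X \<in> Ob L" and "x \<in> carrier (omap (linearize_module C F) X)"
  then show "amap (linearize_module C F) X X (Idm L X) x = x"
    using is_functor_modD(5)[OF F] Idm_in by (simp add: linearize_module_def[of C F, THEN arg_cong[of _ _ omap]] linearize_basis)
next
  fix X Y u v x assume "X \<in> Ob L" "Y \<in> Ob L" "u \<in> Hom L X Y" "v \<in> Hom L X Y"
    and "x \<in> carrier (omap (linearize_module C F) X)"
  then show "amap (linearize_module C F) X Y (u \<oplus>\<^bsub>HomMod L X Y\<^esub> v) x =
      amap (linearize_module C F) X Y u x \<oplus>\<^bsub>omap (linearize_module C F) Y\<^esub> amap (linearize_module C F) X Y v x"
    using linear_mapD(2)[OF linearize_linear_left, of X Y x u v] by (simp add: linearize_module_def)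
next
  fix X Y r u x assume "X \<in> Ob L" "Y \<in> Ob L" "r \<in> carrier R" "u \<in> Hom L X Y"
    and "x \<in> carrier (omap (linearize_module C F) X)"
  then show "amap (linearize_module C F) X Y (r \<odot>\<^bsub>HomMod L X Y\<^esub> u) x =
      r \<odot>\<^bsub>omap (linearize_module C F) Y\<^esub> amap (linearize_module C F) X Y u x"
    using linear_mapD(3)[OF linearize_linear_left, of X Y x r u] by (simp add: linearize_module_def)
qed (use is_functor_modD(2)[OF F] in \<open>auto simp: linearize_module_def\<close>)

end

text \<open>This makes the extension of modules from \<open>C\<close> to its linearization fully faithful: it leaves the
  components of natural transformations unchanged.\<close>

lemma nat_trans_linearize_iff:
  fixes U :: "'m itself"
  assumes F: "is_functor C (mod_category U R) F" and G: "is_functor C (mod_category U R) G"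
  shows "is_nat_trans L (mod_category U R) (linearize_module C F) (linearize_module C G) \<eta> \<longleftrightarrow>
    is_nat_trans C (mod_category U R) F G \<eta>"
proof
  have om: "omap (linearize_module C F) X = omap F X" "omap (linearize_module C G) X = omap G X" for X
    by (simp_all add: linearize_module_def)
  {
    assume \<eta>: "is_nat_trans L (mod_category U R) (linearize_module C F) (linearize_module C G) \<eta>"
    have "\<eta> Y (amap F X Y f x) = amap G X Y f (\<eta> X x)"
      if "X \<in> Ob C" "Y \<in> Ob C" "f \<in> Hom C X Y" "x \<in> carrier (omap F X)" for X Y f x
    proof -
      have "\<eta> X x \<in> carrier (omap G X)"
        using \<eta> that by (auto simp: is_nat_trans_mod_iff om dest: linear_mapD(1))
      moreover have "\<eta> Y (amap (linearize_module C F) X Y (basis X Y f) x) =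
          amap (linearize_module C G) X Y (basis X Y f) (\<eta> X x)"
        using \<eta> that by (auto simp: is_nat_trans_mod_iff om basis_in)
      ultimately show ?thesis using that by (simp add: linearize_basis[OF F] linearize_basis[OF G])
    qed
    with \<eta> show "is_nat_trans C (mod_category U R) F G \<eta>" by (auto simp: is_nat_trans_mod_iff om)
  next
    assume \<eta>: "is_nat_trans C (mod_category U R) F G \<eta>"
    have lin: "linear_map R (omap F X) (omap G X) (\<eta> X)" if "X \<in> Ob C" for X
      using \<eta> that by (auto simp: is_nat_trans_mod_iff)
    have "\<eta> Y (amap (linearize_module C F) X Y u x) = amap (linearize_module C G) X Y u (\<eta> X x)"
      if "X \<in> Ob C" "Y \<in> Ob C" "u \<in> Hom L X Y" "x \<in> carrier (omap F X)" for X Y u x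
    proof (rule linear_map_eq_on_single[OF linear_map_compose[OF linearize_linear_left[OF F] lin]
          linearize_linear_left[OF G] is_functor_modD(2)[OF G] finite_Hom])
      show "\<eta> X x \<in> carrier (omap G X)" using linear_mapD(1)[OF lin] that by simp
      then show "\<eta> Y (amap (linearize_module C F) X Y (basis X Y f) x) =
          amap (linearize_module C G) X Y (basis X Y f) (\<eta> X x)" if "f \<in> Hom C X Y" for f
        using \<eta> \<open>X \<in> Ob C\<close> \<open>Y \<in> Ob C\<close> \<open>x \<in> carrier (omap F X)\<close> that
        by (simp add: linearize_basis[OF F] linearize_basis[OF G] is_nat_trans_mod_iff)
    qed (use that in auto)
    then show "is_nat_trans L (mod_category U R) (linearize_module C F) (linearize_module C G) \<eta>"
      using \<eta> by (auto simp: is_nat_trans_mod_iff om)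
  }
qed

lemma is_functor_linearize_functor:
  fixes U :: "'m itself"
  shows "is_functor (Mod_over U R C) (linear_Mod_over U R L) (linearize_functor C)"
  unfolding is_functor_def
  using category_Mod_over[OF category_axioms] category_linear_Mod_over[OF linear_category_linearization]
    linear_linearize_module
  by (auto simp: nat_trans_linearize_iff Mod_over_simps linear_Mod_over_simps[OF linear_category_linearization] linearize_functor_def
      linearize_module_def[THEN arg_cong[of _ _ omap]])

lemma fully_faithful_linearize_functor:
  fixes U :: "'m itself"
  shows "fully_faithful (Mod_over U R C) (linear_Mod_over U R L) (linearize_functor C)"
  unfolding fully_faithful_def
  by (auto simp: Mod_over_simps linear_Mod_over_simps[OF linear_category_linearization] linearize_functor_def
      nat_trans_linearize_iff bij_betw_def)

lemma essentially_surjective_linearize_functor: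
  fixes U :: "'m itself"
  shows "essentially_surjective (Mod_over U R C) (linear_Mod_over U R L) (linearize_functor C)"
  unfolding essentially_surjective_def
proof
  fix N assume "N \<in> Ob (linear_Mod_over U R L)"
  then have N: "is_linear_functor R L (mod_category U R) N"
    by (simp add: linear_Mod_over_simps[OF linear_category_linearization])
  note N1 = is_linear_functor_modD[OF linear_category_linearization N]
  note N2 = is_functor_modD[OF N1(1), simplified]
  define F where "F = \<lparr>omap = omap N, amap = (\<lambda>X Y f. amap N X Y (basis X Y f))\<rparr>"
  have F: "is_functor C (mod_category U R) F"
    using category_axioms N2
    by (intro is_functor_modI) (simp_all add: F_def Comp_basis[symmetric] basis_in)
  have om: "omap (linearize_module C F) X = omap N X" for X by (simp add: linearize_module_def F_def)
  have "\<exists>\<eta>. is_iso_in (linear_Mod_over U R L) (linearize_module C F) N \<eta>"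
  proof (rule linear_Mod_over_iso[OF linear_category_linearization linear_linearize_module[OF F] N,
        where \<eta> = "\<lambda>X x. x" and \<theta> = "\<lambda>X x. x"])
    fix X Y u x assume "X \<in> Ob L" "Y \<in> Ob L" and u: "u \<in> Hom L X Y" and "x \<in> carrier (omap (linearize_module C F) X)"
    then have X: "X \<in> Ob C" and Y: "Y \<in> Ob C" and x: "x \<in> carrier (omap F X)"
      by (auto simp: linearize_module_def)
    show "amap (linearize_module C F) X Y u x = amap N X Y u x"
    proof (rule linear_map_eq_on_single[OF linearize_linear_left[OF F X Y x]])
      show "linear_map R (free_module R (Hom C X Y)) (omap F Y) (\<lambda>u. amap N X Y u x)"
        using N1(2)[of X Y x] X Y x by (simp add: F_def)
      show "amap (linearize_module C F) X Y (basis X Y f) x = amap N X Y (basis X Y f) x" if "f \<in> Hom C X Y" for f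
        using linearize_basis[OF F X Y that x] by (simp add: F_def)
    qed (use is_functor_modD(2)[OF F Y] finite_Hom X Y u in auto)
  qed (auto intro!: linear_mapI simp: om)
  with F show "\<exists>F\<in>Ob (Mod_over U R C). \<exists>f. is_iso_in (linear_Mod_over U R L) (omap (linearize_functor C) F) N f"
    by (auto simp: Mod_over_simps linearize_functor_def)
qed

end


section \<open>Ordered products of complementary idempotents\<close>

context ring
begin

text \<open>The first element of the list is the rightmost factor: \<open>compl_prod [p\<^sub>1, \<dots>, p\<^sub>n]\<close> is
  \<open>(1 - p\<^sub>n) \<cdots> (1 - p\<^sub>1)\<close>.\<close>

fun compl_prod :: "'a list \<Rightarrow> 'a" where
  "compl_prod [] = \<one>"
| "compl_prod (p # ps) = compl_prod ps \<otimes> (\<one> \<ominus> p)"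

text \<open>The relations of Kiselman's semigroup, satisfied by commuting idempotents and also by the
  degeneracy idempotents of a chain.  They are not symmetric in \<open>p\<close> and \<open>q\<close>, which is why the order
  of the factors matters.\<close>

definition kiselman :: "'a list \<Rightarrow> bool" where
  "kiselman ps \<longleftrightarrow> set ps \<subseteq> carrier R \<and> (\<forall>p\<in>set ps. p \<otimes> p = p) \<and>
    sorted_wrt (\<lambda>p q. p \<otimes> q \<otimes> p = p \<otimes> q \<and> q \<otimes> p \<otimes> q = p \<otimes> q) ps"

lemma kiselman_Cons:
  "kiselman (q # ps) \<longleftrightarrow> q \<in> carrier R \<and> q \<otimes> q = q \<and> kiselman ps \<and>
    (\<forall>p\<in>set ps. q \<otimes> p \<otimes> q = q \<otimes> p \<and> p \<otimes> q \<otimes> p = q \<otimes> p)"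
  by (auto simp: kiselman_def)

lemma compl_prod_closed: "set ps \<subseteq> carrier R \<Longrightarrow> compl_prod ps \<in> carrier R"
  by (induction ps) auto

lemma compl_right: "p \<in> carrier R \<Longrightarrow> q \<in> carrier R \<Longrightarrow> (\<one> \<ominus> p) \<otimes> q = q \<ominus> p \<otimes> q"
  by (simp add: a_minus_def l_distr l_minus)

lemma compl_left: "p \<in> carrier R \<Longrightarrow> q \<in> carrier R \<Longrightarrow> q \<otimes> (\<one> \<ominus> p) = q \<ominus> q \<otimes> p"
  by (simp add: a_minus_def r_distr r_minus)

lemma minus_self: "p \<in> carrier R \<Longrightarrow> p \<ominus> p = \<zero>"
  by (simp add: a_minus_def r_neg)

text \<open>For \<open>q\<close> before \<open>p\<close>, the relation \<open>q p = p q p\<close> gives \<open>(1 - q) p = p (1 - q p)\<close>.  So \<open>p\<close> moves to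
  the left until it meets its own factor \<open>1 - p\<close>.\<close>

lemma compl_prod_mult_zero:
  assumes "kiselman ps" "p \<in> set ps"
  shows "compl_prod ps \<otimes> p = \<zero>"
  using assms
proof (induction ps)
  case (Cons q ps)
  then have q: "q \<in> carrier R" "q \<otimes> q = q" and ps: "set ps \<subseteq> carrier R" "kiselman ps"
    by (auto simp: kiselman_Cons kiselman_def)
  note c = compl_prod_closed[OF ps(1)]
  show ?case
  proof (cases "p = q")
    case True
    then show ?thesis using q c by (simp add: m_assoc compl_right minus_self)
  next
    case False
    then have p: "p \<in> set ps" "p \<in> carrier R" and rel: "p \<otimes> q \<otimes> p = q \<otimes> p"
      using Cons ps by (auto simp: kiselman_Cons)
    have "(\<one> \<ominus> q) \<otimes> p = p \<otimes> (\<one> \<ominus> q \<otimes> p)"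
      using p q rel by (simp add: compl_right compl_left m_assoc)
    then have "compl_prod (q # ps) \<otimes> p = compl_prod ps \<otimes> p \<otimes> (\<one> \<ominus> q \<otimes> p)"
      using p q c by (simp add: m_assoc)
    then show ?thesis using Cons.IH[OF ps(2) p(1)] p q by simp
  qed
qed simp

lemma mult_compl_prod_mult:
  assumes "q \<in> carrier R" "q \<otimes> q = q" "\<And>p. p \<in> set ps \<Longrightarrow> p \<in> carrier R \<and> q \<otimes> p \<otimes> q = q \<otimes> p"
  shows "q \<otimes> compl_prod ps \<otimes> q = q \<otimes> compl_prod ps"
  using assms(3)
proof (induction ps)
  case Nil
  then show ?case using assms by simp
next
  case (Cons p ps)
  then have p: "p \<in> carrier R" "q \<otimes> p \<otimes> q = q \<otimes> p" and ps: "set ps \<subseteq> carrier R" by auto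
  note c = compl_prod_closed[OF ps]
  have IH: "q \<otimes> compl_prod ps \<otimes> q = q \<otimes> compl_prod ps" by (rule Cons.IH) (use Cons.prems in auto)
  have "q \<otimes> compl_prod (p # ps) \<otimes> q = q \<otimes> compl_prod ps \<otimes> (\<one> \<ominus> p) \<otimes> q"
    using p c assms(1) by (simp add: m_assoc)
  also have "\<dots> = q \<otimes> compl_prod ps \<otimes> q \<otimes> (\<one> \<ominus> p) \<otimes> q"
    by (simp only: IH)
  also have "\<dots> = q \<otimes> compl_prod ps \<otimes> (q \<otimes> (\<one> \<ominus> p) \<otimes> q)"
    using p c assms(1) by (simp add: m_assoc)
  also have "q \<otimes> (\<one> \<ominus> p) \<otimes> q = q \<otimes> (\<one> \<ominus> p)"
    using p assms(1,2) by (simp add: compl_left) (simp add: a_minus_def l_distr l_minus)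
  also have "q \<otimes> compl_prod ps \<otimes> (q \<otimes> (\<one> \<ominus> p)) = q \<otimes> compl_prod ps \<otimes> q \<otimes> (\<one> \<ominus> p)"
    using p c assms(1) by (simp add: m_assoc)
  also have "\<dots> = q \<otimes> compl_prod (p # ps)"
    unfolding IH using p c assms(1) by (simp add: m_assoc)
  finally show ?case .
qed

text \<open>If \<open>p\<close> is the first element of the list, the relation \<open>p q p = p q\<close> allows a second copy of \<open>p\<close> to
  be inserted to the right of the later factors, in front of \<open>1 - p\<close>.\<close>

lemma mult_compl_prod_zero:
  assumes "kiselman ps" "p \<in> set ps"
  shows "p \<otimes> compl_prod ps = \<zero>"
  using assms
proof (induction ps)
  case (Cons q ps)
  then have q: "q \<in> carrier R" "q \<otimes> q = q" "\<And>p. p \<in> set ps \<Longrightarrow> q \<otimes> p \<otimes> q = q \<otimes> p"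
    and ps: "set ps \<subseteq> carrier R" "kiselman ps"
    by (auto simp: kiselman_Cons kiselman_def)
  note c = compl_prod_closed[OF ps(1)]
  show ?case
  proof (cases "p = q")
    case True
    have "q \<otimes> compl_prod ps \<otimes> q = q \<otimes> compl_prod ps"
      by (rule mult_compl_prod_mult) (use q ps in auto)
    then have "q \<otimes> compl_prod (q # ps) = q \<otimes> compl_prod ps \<otimes> q \<otimes> (\<one> \<ominus> q)"
      using q c by (simp add: m_assoc[symmetric])
    then show ?thesis using True q c by (simp add: m_assoc compl_left minus_self)
  next
    case False
    then have "p \<in> set ps" "p \<in> carrier R" using Cons.prems ps by auto
    then show ?thesis using Cons.IH[OF ps(2)] q c by (simp add: m_assoc[symmetric])
  qed
qed simp

lemma compl_prod_idem:
  assumes "kiselman ps"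
  shows "compl_prod ps \<otimes> compl_prod ps = compl_prod ps"
proof -
  have "compl_prod qs \<otimes> x = x" if "set qs \<subseteq> carrier R" "x \<in> carrier R" "\<And>p. p \<in> set qs \<Longrightarrow> p \<otimes> x = \<zero>" for qs x
    using that
  proof (induction qs)
    case (Cons q qs)
    then have "(\<one> \<ominus> q) \<otimes> x = x" by (simp add: compl_right) (simp add: a_minus_def)
    then show ?case using Cons compl_prod_closed[of qs] by (simp add: m_assoc)
  qed simp
  then show ?thesis
    using assms mult_compl_prod_zero compl_prod_closed by (auto simp: kiselman_def)
qed

text \<open>Expanding the product, every term but \<open>1\<close> ends in some \<open>p\<close>.  The set \<open>J\<close> will be a trace ideal
  or the combinations of non-injective maps.\<close>

lemma compl_prod_ideal:
  assumes "set ps \<subseteq> carrier R" "\<zero> \<in> J" "J \<subseteq> carrier R"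
    and "\<And>x y. x \<in> J \<Longrightarrow> y \<in> J \<Longrightarrow> x \<oplus> y \<in> J"
    and "\<And>y p. y \<in> carrier R \<Longrightarrow> p \<in> set ps \<Longrightarrow> y \<otimes> p \<in> J"
  shows "\<one> \<ominus> compl_prod ps \<in> J"
  using assms
proof (induction ps)
  case Nil
  then show ?case by (simp add: minus_self)
next
  case (Cons p ps)
  then have p: "p \<in> carrier R" and c: "compl_prod ps \<in> carrier R" by (auto intro: compl_prod_closed)
  have "\<one> \<ominus> compl_prod (p # ps) = (\<one> \<ominus> compl_prod ps) \<oplus> compl_prod ps \<otimes> p"
    using p c by (simp add: compl_left) (simp add: a_minus_def minus_add a_assoc)
  then show ?case using Cons c by auto
qed

end


section \<open>Finite rooted trees\<close>

lemma rooted_treeD: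
  assumes "rooted_tree A"
  shows "finite (Field A)"
    and "x \<in> Field A \<Longrightarrow> (x, x) \<in> A"
    and "(x, y) \<in> A \<Longrightarrow> (y, z) \<in> A \<Longrightarrow> (x, z) \<in> A"
    and "(x, y) \<in> A \<Longrightarrow> (y, x) \<in> A \<Longrightarrow> x = y"
    and "(x, z) \<in> A \<Longrightarrow> (y, z) \<in> A \<Longrightarrow> (x, y) \<in> A \<or> (y, x) \<in> A"
    and "is_root A x \<Longrightarrow> is_root A y \<Longrightarrow> x = y"
proof -
  have po: "Partial_order A" and ch: "\<forall>x\<in>Field A. {y. (y, x) \<in> A} \<in> Chains A"
    using assms by (auto simp: rooted_tree_def)
  show "finite (Field A)" using assms by (simp add: rooted_tree_def)
  show "x \<in> Field A \<Longrightarrow> (x, x) \<in> A"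
    using po by (auto simp: partial_order_on_def preorder_on_def refl_on_def)
  show "(x, y) \<in> A \<Longrightarrow> (y, z) \<in> A \<Longrightarrow> (x, z) \<in> A"
    using po by (auto simp: partial_order_on_def preorder_on_def dest: transD)
  show "(x, y) \<in> A \<Longrightarrow> (y, x) \<in> A \<Longrightarrow> x = y"
    using po by (auto simp: partial_order_on_def dest: antisymD)
  show "(x, z) \<in> A \<Longrightarrow> (y, z) \<in> A \<Longrightarrow> (x, y) \<in> A \<or> (y, x) \<in> A"
    using ch by (auto simp: Chains_def Field_def)
  show "is_root A x \<Longrightarrow> is_root A y \<Longrightarrow> x = y"
    using assms by (auto simp: rooted_tree_def)
qed

definition height :: "'v rel \<Rightarrow> 'v \<Rightarrow> nat" where
  "height A x = card {y. (y, x) \<in> A}"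

lemma height_less:
  assumes A: "rooted_tree A" and xy: "(x, y) \<in> A" "x \<noteq> y"
  shows "height A x < height A y"
  unfolding height_def
proof (rule psubset_card_mono)
  note t = rooted_treeD[OF A]
  show "finite {z. (z, y) \<in> A}"
    by (rule finite_subset[OF _ t(1)]) (auto simp: Field_def)
  have "(y, x) \<notin> A" using xy t(4) by blast
  moreover have "(y, y) \<in> A" using xy t(2) by (auto simp: Field_def)
  ultimately show "{z. (z, x) \<in> A} \<subset> {z. (z, y) \<in> A}" using t(3)[OF _ xy(1)] by blast
qed

lemma root_least:
  assumes A: "rooted_tree A" and r: "is_root A r" and x: "x \<in> Field A"
  shows "(r, x) \<in> A"
proof -
  note t = rooted_treeD[OF A]
  obtain y where y: "(y, x) \<in> A" and min: "\<And>z. (z, x) \<in> A \<Longrightarrow> height A y \<le> height A z"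
    using ex_has_least_nat[of "\<lambda>y. (y, x) \<in> A" x "height A"] t(2)[OF x] by blast
  have "z = y" if "(z, y) \<in> A" for z
  proof (rule ccontr)
    assume "z \<noteq> y"
    then show False using height_less[OF A that] min[OF t(3)[OF that y]] by simp
  qed
  then have "is_root A y" using y by (auto simp: is_root_def Field_def)
  then show ?thesis using t(6)[OF r] y by blast
qed

lemma ex_root: "rooted_tree A \<Longrightarrow> \<exists>r. is_root A r"
  by (auto simp: rooted_tree_def)

lemma coversD:
  assumes "covers A a b"
  shows "(a, b) \<in> A" "a \<noteq> b" "a \<in> Field A" "b \<in> Field A"
  using assms by (auto simp: covers_def Field_def)

lemma below_cover:
  assumes A: "rooted_tree A" and c: "covers A a b" and x: "(x, b) \<in> A" "x \<noteq> b"
  shows "(x, a) \<in> A"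
proof -
  have "(x, a) \<in> A \<or> (a, x) \<in> A"
    using rooted_treeD(5)[OF A x(1) coversD(1)[OF c]] .
  then show ?thesis
    using c x rooted_treeD(2)[OF A] coversD(3)[OF c] by (auto simp: covers_def)
qed

lemma covers_unique:
  assumes "rooted_tree A" "covers A a b" "covers A a' b"
  shows "a = a'"
proof -
  have "(a, a') \<in> A" "(a', a) \<in> A"
    using below_cover[OF assms(1,3)] below_cover[OF assms(1,2)] coversD(1,2)[OF assms(2)] coversD(1,2)[OF assms(3)]
    by blast+
  then show ?thesis using rooted_treeD(4)[OF assms(1)] by blast
qed

lemma ex_cover_above:
  assumes A: "rooted_tree A" and x: "(a, x) \<in> A" "a \<noteq> x"
  shows "\<exists>b. covers A a b \<and> (b, x) \<in> A"
proof -
  note t = rooted_treeD[OF A]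
  obtain b where b: "(a, b) \<in> A" "a \<noteq> b" "(b, x) \<in> A"
    and min: "\<And>z. (a, z) \<in> A \<Longrightarrow> a \<noteq> z \<Longrightarrow> (z, x) \<in> A \<Longrightarrow> height A b \<le> height A z"
    using ex_has_least_nat[of "\<lambda>b. (a, b) \<in> A \<and> a \<noteq> b \<and> (b, x) \<in> A" x "height A"] x t(2)
    by (auto simp: Field_def)
  have "c = a \<or> c = b" if "(a, c) \<in> A" "(c, b) \<in> A" for c
  proof (rule ccontr)
    assume c: "\<not> (c = a \<or> c = b)"
    then have "height A c < height A b" using height_less[OF A that(2)] by simp
    moreover have "height A b \<le> height A c"
      using c by (intro min that(1) t(3)[OF that(2) b(3)]) auto
    ultimately show False by simp
  qed
  then show ?thesis using b by (auto simp: covers_def)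
qed


subsection \<open>Merging a vertex into its parent\<close>

definition remove_vertex :: "'v rel \<Rightarrow> 'v \<Rightarrow> 'v rel" where
  "remove_vertex A b = {(x, y) \<in> A. x \<noteq> b \<and> y \<noteq> b}"

text \<open>For an edge \<open>a \<lessdot> b\<close>, the contraction followed by its section through \<open>a\<close>.\<close>

definition push_down :: "'v rel \<Rightarrow> 'v \<Rightarrow> 'v \<Rightarrow> 'v \<Rightarrow> 'v" where
  "push_down A a b = (\<lambda>x\<in>Field A. if x = b then a else x)"

definition contract_section :: "'v rel \<Rightarrow> 'v \<Rightarrow> 'v \<Rightarrow> 'v set \<Rightarrow> 'v" where
  "contract_section A a b = (\<lambda>X\<in>Field (contract A a b). if a \<in> X then a else the_elem X)"

lemma Field_remove_vertex:
  assumes "rooted_tree A"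
  shows "Field (remove_vertex A b) = Field A - {b}"
proof
  show "Field A - {b} \<subseteq> Field (remove_vertex A b)"
    using rooted_treeD(2)[OF assms] by (auto simp: remove_vertex_def Field_def)
qed (auto simp: remove_vertex_def Field_def)

lemma Field_contract: "Field (contract A a b) = quotient_map a b ` Field A"
  by (force simp: contract_def Field_def)

lemma contract_iff: "(X, Y) \<in> contract A a b \<longleftrightarrow>
    (\<exists>x y. (x, y) \<in> A \<and> X = quotient_map a b x \<and> Y = quotient_map a b y)"
  by (force simp: contract_def)

lemma contract_section_quotient_map:
  assumes "x \<in> Field A" "a \<noteq> b"
  shows "contract_section A a b (quotient_map a b x) = push_down A a b x"
  using assms by (auto simp: contract_section_def Field_contract quotient_map_def push_down_def)

lemma push_down_mono:
  assumes A: "rooted_tree A" and c: "covers A a b" and xy: "(x, y) \<in> A"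
  shows "(push_down A a b x, push_down A a b y) \<in> A"
proof -
  have F: "x \<in> Field A" "y \<in> Field A" using xy by (auto simp: Field_def)
  have "(a, y) \<in> A" if "x = b" using rooted_treeD(3)[OF A coversD(1)[OF c]] xy that by simp
  moreover have "(x, a) \<in> A" if "y = b" "x \<noteq> b" using below_cover[OF A c] xy that by simp
  moreover have "(a, a) \<in> A" using rooted_treeD(2)[OF A] coversD(3)[OF c] by simp
  ultimately show ?thesis using F xy by (simp add: push_down_def)
qed

text \<open>Choosing the lower vertex of the merged pair as representative always gives a section,
  because the parent lies below exactly what the pair lies below.\<close>

lemma isomorphism_contract_section:
  assumes A: "rooted_tree A" and c: "covers A a b"
  shows "isomorphism (contract A a b) (remove_vertex A b) (contract_section A a b)"
proof -
  note ab = coversD[OF c]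
  note sq = contract_section_quotient_map[OF _ ab(2)]
  have q_push: "quotient_map a b (push_down A a b x) = quotient_map a b x" if "x \<in> Field A" for x
    using that by (simp add: push_down_def quotient_map_def)
  have push_in: "push_down A a b x \<in> Field A - {b}" if "x \<in> Field A" for x
    using that ab by (auto simp: push_down_def)
  have "embedding (contract A a b) (remove_vertex A b) (contract_section A a b)"
    unfolding embedding_def
  proof (intro conjI ballI)
    show "contract_section A a b \<in> Field (contract A a b) \<rightarrow>\<^sub>E Field (remove_vertex A b)"
      using push_in by (auto simp: Field_contract Field_remove_vertex[OF A] sq)
        (auto simp: contract_section_def Field_contract)
    show "inj_on (contract_section A a b) (Field (contract A a b))"
      unfolding Field_contract by (rule inj_onI) (metis imageE q_push sq)
  next
    fix X Y assume "X \<in> Field (contract A a b)" "Y \<in> Field (contract A a b)"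
    then obtain x y where x: "x \<in> Field A" "X = quotient_map a b x" and y: "y \<in> Field A" "Y = quotient_map a b y"
      by (auto simp: Field_contract)
    show "(X, Y) \<in> contract A a b \<longleftrightarrow> (contract_section A a b X, contract_section A a b Y) \<in> remove_vertex A b"
    proof
      assume "(X, Y) \<in> contract A a b"
      then obtain x' y' where xy: "(x', y') \<in> A" "X = quotient_map a b x'" "Y = quotient_map a b y'"
        by (auto simp: contract_iff)
      then have "x' \<in> Field A" "y' \<in> Field A" by (auto simp: Field_def)
      then show "(contract_section A a b X, contract_section A a b Y) \<in> remove_vertex A b"
        using push_down_mono[OF A c xy(1)] push_in by (auto simp: xy sq remove_vertex_def)
    next
      assume "(contract_section A a b X, contract_section A a b Y) \<in> remove_vertex A b"
      then have "(push_down A a b x, push_down A a b y) \<in> A"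
        using x y by (simp add: sq remove_vertex_def)
      then show "(X, Y) \<in> contract A a b"
        using x y q_push by (metis contract_iff)
    qed
  qed
  moreover have "contract_section A a b ` Field (contract A a b) = Field (remove_vertex A b)"
  proof
    show "Field (remove_vertex A b) \<subseteq> contract_section A a b ` Field (contract A a b)"
    proof
      fix x assume "x \<in> Field (remove_vertex A b)"
      then have "x \<in> Field A" "x = push_down A a b x"
        by (auto simp: Field_remove_vertex[OF A] push_down_def)
      then show "x \<in> contract_section A a b ` Field (contract A a b)"
        using sq by (metis Field_contract imageI)
    qed
  qed (use push_in in \<open>auto simp: Field_contract Field_remove_vertex[OF A] sq\<close>)
  ultimately show ?thesis by (simp add: isomorphism_def)
qed

lemma rooted_tree_remove_vertex:
  assumes A: "rooted_tree A" and c: "covers A a b"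
  shows "rooted_tree (remove_vertex A b)"
proof -
  note t = rooted_treeD[OF A] and F = Field_remove_vertex[OF A]
  obtain r where r: "is_root A r" using ex_root[OF A] by blast
  have rb: "r \<noteq> b" using r coversD[OF c] by (auto simp: is_root_def)
  have "is_root (remove_vertex A b) r" using r rb by (auto simp: is_root_def F) (auto simp: remove_vertex_def)
  moreover have "x = r" if "is_root (remove_vertex A b) x" for x
    using that root_least[OF A r] rb by (auto simp: is_root_def F) (auto simp: remove_vertex_def)
  ultimately have "\<exists>!r. is_root (remove_vertex A b) r" by blast
  moreover have "Partial_order (remove_vertex A b)"
    unfolding partial_order_on_def preorder_on_def
  proof (intro conjI)
    show "refl_on (Field (remove_vertex A b)) (remove_vertex A b)"
      using t(2) by (auto simp: refl_on_def F) (auto simp: remove_vertex_def)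
    show "trans (remove_vertex A b)" using t(3) by (auto simp: remove_vertex_def intro!: transI)
    show "antisym (remove_vertex A b)" using t(4) by (auto simp: remove_vertex_def intro!: antisymI)
    show "remove_vertex A b \<subseteq> Field (remove_vertex A b) \<times> Field (remove_vertex A b)"
      by (auto simp: Field_def)
  qed
  moreover have "{y. (y, x) \<in> remove_vertex A b} \<in> Chains (remove_vertex A b)" for x
    using t(5) by (auto simp: remove_vertex_def Chains_def)
  ultimately show ?thesis using t(1) by (simp add: rooted_tree_def F)
qed


subsection \<open>Embeddings\<close>

lemma embeddingD:
  assumes "embedding A B f"
  shows "f \<in> Field A \<rightarrow>\<^sub>E Field B" "inj_on f (Field A)" "x \<in> Field A \<Longrightarrow> f x \<in> Field B"
    and "x \<in> Field A \<Longrightarrow> y \<in> Field A \<Longrightarrow> (f x, f y) \<in> B \<longleftrightarrow> (x, y) \<in> A"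
    and "x \<in> Field A \<Longrightarrow> y \<in> Field A \<Longrightarrow> f x = f y \<longleftrightarrow> x = y"
  using assms by (auto simp: embedding_def inj_on_eq_iff)

lemma embedding_compose:
  assumes "embedding A B f" "embedding B C g"
  shows "embedding A C (compose (Field A) g f)"
  using embeddingD[OF assms(1)] embeddingD[OF assms(2)]
  by (auto simp: embedding_def compose_def inj_on_def)

lemma embedding_id: "embedding A A (\<lambda>x\<in>Field A. x)"
  by (auto simp: embedding_def)

lemma isomorphism_inverse:
  assumes "isomorphism A B f"
  shows "embedding B A (\<lambda>y\<in>Field B. inv_into (Field A) f y)"
proof -
  have f: "embedding A B f" and im: "f ` Field A = Field B" using assms by (auto simp: isomorphism_def)
  have i: "inv_into (Field A) f y \<in> Field A" "f (inv_into (Field A) f y) = y" if "y \<in> Field B" for y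
    using that im inv_into_into[of y f "Field A"] f_inv_into_f[of y f "Field A"] by auto
  then have "(y, z) \<in> B \<longleftrightarrow> (inv_into (Field A) f y, inv_into (Field A) f z) \<in> A"
    if "y \<in> Field B" "z \<in> Field B" for y z
    using that embeddingD(4)[OF f i(1)[OF that(1)] i(1)[OF that(2)]] by simp
  with i show ?thesis by (auto simp: embedding_def inj_on_def) (metis i(2))
qed

lemma embedding_covers:
  assumes f: "embedding A B f" and xy: "x \<in> Field A" "y \<in> Field A" and c: "covers B (f x) (f y)"
  shows "covers A x y"
proof -
  have "z = x \<or> z = y" if "(x, z) \<in> A" "(z, y) \<in> A" for z
  proof -
    have z: "z \<in> Field A" using that by (auto simp: Field_def)
    then have "f z = f x \<or> f z = f y"
      using c that xy embeddingD(4)[OF f] by (auto simp: covers_def)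
    then show ?thesis using z xy embeddingD(5)[OF f] by simp
  qed
  then show ?thesis using c xy embeddingD(4,5)[OF f] by (auto simp: covers_def)
qed

lemma embedding_admissible_edge:
  assumes B: "rooted_tree B" and f: "embedding A B f" and xy: "x \<in> Field A" "y \<in> Field A"
    and adm: "admissible_edge B (f x) (f y)"
  shows "admissible_edge A x y"
proof -
  have c: "covers A x y" using embedding_covers[OF f xy] adm by (simp add: admissible_edge_def)
  have "is_root A x" if r: "is_root B (f x)"
  proof -
    have "z = x" if "(z, x) \<in> A" for z
    proof -
      have z: "z \<in> Field A" using that by (auto simp: Field_def)
      then have "(f z, f x) \<in> B" using that xy embeddingD(4)[OF f] by simp
      then have "f z = f x" using r by (simp add: is_root_def)
      then show ?thesis using z xy embeddingD(5)[OF f] by simp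
    qed
    then show ?thesis using xy by (simp add: is_root_def)
  qed
  moreover have "z = y" if u: "\<forall>d. covers B (f x) d \<longrightarrow> d = f y" and z: "covers A x z" for z
  proof -
    have zF: "z \<in> Field A" using coversD[OF z] by simp
    then have "(f x, f z) \<in> B" "f x \<noteq> f z" using coversD[OF z] xy embeddingD(4,5)[OF f] by auto
    then obtain d where "covers B (f x) d" "(d, f z) \<in> B" using ex_cover_above[OF B] by blast
    then have "(f y, f z) \<in> B" using u by auto
    then have "(y, z) \<in> A" using xy zF embeddingD(4)[OF f] by simp
    then show ?thesis using z coversD[OF c] by (auto simp: covers_def)
  qed
  ultimately show ?thesis using adm c by (auto simp: admissible_edge_def)
qed


subsection \<open>Morphisms that are not embeddings collapse an admissible edge\<close>

definition collapses :: "'v rel \<Rightarrow> ('v \<Rightarrow> 'w) \<Rightarrow> bool" where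
  "collapses A f \<longleftrightarrow> (\<exists>a b. admissible_edge A a b \<and> f a = f b)"

text \<open>If the image of \<open>C\<close> misses one end of the contracted edge, contracting does not identify
  anything; but it could create a relation \<open>d \<le> y\<close> from \<open>c \<le> y\<close> when \<open>c\<close> is missed and \<open>d\<close> is hit.
  Admissibility excludes this.  Either \<open>d\<close> is the only successor of \<open>c\<close>, or \<open>c\<close> is the root, and then
  the root of \<open>C\<close> must go to \<open>d\<close>, below the whole image.\<close>

lemma embedding_quotient_map:
  assumes B: "rooted_tree B" and C: "rooted_tree C" and g: "embedding C B g" and adm: "admissible_edge B c d"
  shows "embedding C (contract B c d) (\<lambda>x\<in>Field C. quotient_map c d (g x)) \<or>
    collapses C (\<lambda>x\<in>Field C. quotient_map c d (g x))"
proof (cases "c \<in> g ` Field C \<and> d \<in> g ` Field C")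
  case True
  then obtain x y where xy: "x \<in> Field C" "y \<in> Field C" "c = g x" "d = g y" by blast
  then have "admissible_edge C x y" using embedding_admissible_edge[OF B g] adm by simp
  then show ?thesis using xy by (auto simp: collapses_def quotient_map_def)
next
  case False
  note t = rooted_treeD[OF B] and G = embeddingD[OF g]
  have cov: "covers B c d" using adm by (simp add: admissible_edge_def)
  note cd = coversD[OF cov]
  have above: "(d, g y) \<in> B" if d: "d \<in> g ` Field C" and y: "y \<in> Field C" "(c, g y) \<in> B" for y
  proof -
    have cy: "c \<noteq> g y" using False d y by blast
    obtain x where x: "x \<in> Field C" "d = g x" using d by blast
    show ?thesis
    proof (cases "is_root B c")
      case True
      obtain r where r: "is_root C r" using ex_root[OF C] by blast
      then have rF: "r \<in> Field C" by (simp add: is_root_def)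
      have "(g r, d) \<in> B" "(g r, g y) \<in> B"
        using root_least[OF C r] x y G(4)[OF rF] by auto
      moreover have "g r = d"
      proof (rule ccontr)
        assume "g r \<noteq> d"
        then have "(g r, c) \<in> B" using below_cover[OF B cov] \<open>(g r, d) \<in> B\<close> by simp
        then have "g r = c" using True by (simp add: is_root_def)
        then show False using False d rF by blast
      qed
      ultimately show ?thesis by simp
    next
      case False
      then show ?thesis
        using adm ex_cover_above[OF B y(2) cy] by (auto simp: admissible_edge_def)
    qed
  qed
  have refl: "(g x, g x) \<in> B" if "x \<in> Field C" for x using t(2) G(3)[OF that] by simp
  have order: "(g x, g y) \<in> B" if x: "x \<in> Field C" and y: "y \<in> Field C"
    and q: "(quotient_map c d (g x), quotient_map c d (g y)) \<in> contract B c d" for x y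
  proof -
    obtain x' y' where xy: "(x', y') \<in> B" "quotient_map c d (g x) = quotient_map c d x'"
      "quotient_map c d (g y) = quotient_map c d y'"
      using q by (auto simp: contract_iff)
    have x': "g x = x' \<or> (g x \<in> {c, d} \<and> x' \<in> {c, d})" and y': "g y = y' \<or> (g y \<in> {c, d} \<and> y' \<in> {c, d})"
      using xy(2,3) by (auto simp: quotient_map_def split: if_splits)
    consider (both) "g x = x'" "g y = y'" | (right) "g x = x'" "g x \<notin> {c, d}" "g y \<in> {c, d}" "y' \<in> {c, d}"
      | (left) "g x \<in> {c, d}" "x' \<in> {c, d}" "g y = y'" "g y \<notin> {c, d}" | (cd) "g x \<in> {c, d}" "g y \<in> {c, d}"
      using x' y' by blast
    then show ?thesis
    proof cases
      case both
      then show ?thesis using xy by simp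
    next
      case right
      then have "(g x, c) \<in> B" using xy(1) below_cover[OF B cov] by auto
      then show ?thesis using right cd t(3) by blast
    next
      case left
      then have "(c, g y) \<in> B" using xy(1) cd t(3) by blast
      then show ?thesis using left(1) above[OF _ y] x by auto
    next
      case cd
      then have "g x = g y" using False x y by auto
      then show ?thesis using refl[OF x] by simp
    qed
  qed
  have "(quotient_map c d (g x), quotient_map c d (g y)) \<in> contract B c d \<longleftrightarrow> (x, y) \<in> C"
    if "x \<in> Field C" "y \<in> Field C" for x y
    using order[OF that] G(4)[OF that] by (auto simp: contract_iff)
  moreover have "x = y" if "x \<in> Field C" "y \<in> Field C" "quotient_map c d (g x) = quotient_map c d (g y)" for x y
    using that False G(5)[OF that(1,2)] by (auto simp: quotient_map_def split: if_splits)
  ultimately have "embedding C (contract B c d) (\<lambda>x\<in>Field C. quotient_map c d (g x))"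
    using G(3) by (auto simp: embedding_def Field_contract inj_on_def)
  then show ?thesis ..
qed

text \<open>A contraction after an embedding may be injective, so the claim is not inductive for \<open>f\<close> alone.
  Precomposing with an arbitrary embedding \<open>g\<close> makes it so: in a composite, an embedding produced
  by the first factor becomes the \<open>g\<close> of the second one.\<close>

lemma tree_morphism_embedding_or_collapses:
  assumes "tree_morphism Obs Mins B A f" "Obs \<subseteq> {A. rooted_tree A}"
    and "rooted_tree C" "embedding C B g"
  shows "embedding C A (compose (Field C) f g) \<or> collapses C (compose (Field C) f g)"
  using assms(1,3,4)
proof (induction arbitrary: C g rule: tree_morphism.induct)
  case (emb A B f)
  then show ?case using embedding_compose by blast
next
  case (contr A B p)
  then obtain a b \<phi> where adm: "admissible_edge A a b" and \<phi>: "isomorphism (contract A a b) B \<phi>"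
    and p: "p = (\<lambda>x\<in>Field A. \<phi> (quotient_map a b x))"
    unfolding admissible_contraction_def by blast
  have A: "rooted_tree A" using contr assms(2) by blast
  let ?q = "\<lambda>x\<in>Field C. quotient_map a b (g x)"
  have eq: "compose (Field C) p g = compose (Field C) \<phi> ?q"
    using embeddingD(3)[OF contr.prems(2)] by (auto simp: p compose_def fun_eq_iff)
  from embedding_quotient_map[OF A contr.prems(1,2) adm] show ?case
  proof
    assume "embedding C (contract A a b) ?q"
    then show ?thesis using embedding_compose \<phi> unfolding eq isomorphism_def by blast
  next
    assume "collapses C ?q"
    then obtain x y where xy: "admissible_edge C x y" "?q x = ?q y" by (auto simp: collapses_def)
    then have "x \<in> Field C" "y \<in> Field C"
      using coversD(3,4)[of C x y] by (simp_all add: admissible_edge_def)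
    then have "compose (Field C) \<phi> ?q x = compose (Field C) \<phi> ?q y"
      using xy(2) by (simp only: compose_eq)
    then show ?thesis using xy(1) unfolding eq collapses_def by blast
  qed
next
  case (comp A B f D h)
  have eq: "compose (Field C) (compose (Field A) h f) g = compose (Field C) h (compose (Field C) f g)"
    using embeddingD(3)[OF comp.prems(2)] by (auto simp: compose_def fun_eq_iff)
  from comp.IH(1)[OF comp.prems] show ?case
  proof
    assume "embedding C B (compose (Field C) f g)"
    from comp.IH(2)[OF comp.prems(1) this] show ?thesis unfolding eq .
  next
    assume "collapses C (compose (Field C) f g)"
    then obtain a b where ab: "admissible_edge C a b" "compose (Field C) f g a = compose (Field C) f g b"
      by (auto simp: collapses_def)
    then have "a \<in> Field C" "b \<in> Field C"
      using coversD(3,4)[of C a b] by (simp_all add: admissible_edge_def)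
    then have "compose (Field C) h (compose (Field C) f g) a = compose (Field C) h (compose (Field C) f g) b"
      using ab(2) by (simp only: compose_eq)
    then show ?thesis using ab(1) unfolding eq collapses_def by blast
  qed
qed

lemma all_trees_embedding_or_collapses:
  assumes B: "rooted_tree B" and f: "f \<in> Hom all_trees B A"
  shows "embedding B A f \<or> collapses B f"
proof -
  have tm: "tree_morphism {A. rooted_tree A} {} B A f" using f by (simp add: all_trees_def tree_category_def)
  have "compose (Field B) f (\<lambda>x\<in>Field B. x) = f"
    using tree_morphism_funcset[OF tm] by (auto simp: compose_def fun_eq_iff PiE_iff extensional_def)
  then show ?thesis
    using tree_morphism_embedding_or_collapses[OF tm _ B embedding_id[of B]] by simp
qed


section \<open>Endomorphism rings and trace ideals\<close>

context linear_category
begin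

lemma End_algebra_simps:
  "X \<in> Ob E \<Longrightarrow> carrier (End_algebra E X) = Hom E X X"
  "mult (End_algebra E X) = Comp E X X X" "one (End_algebra E X) = Idm E X"
  "zero (End_algebra E X) = zero (HomMod E X X)" "add (End_algebra E X) = add (HomMod E X X)"
  by (simp_all add: End_algebra_def carrier_HomMod)

lemma ring_End_algebra:
  assumes X: "X \<in> Ob E"
  shows "ring (End_algebra E X)"
proof -
  interpret H: module R "HomMod E X X" by (rule module_HomMod[OF X X])
  note car = carrier_HomMod[OF X X, symmetric]
  have neg: "\<exists>y\<in>carrier (HomMod E X X). y \<oplus>\<^bsub>HomMod E X X\<^esub> x = \<zero>\<^bsub>HomMod E X X\<^esub>"
    if "x \<in> carrier (HomMod E X X)" for x
    using that H.M.l_neg by (intro bexI[of _ "\<ominus>\<^bsub>HomMod E X X\<^esub> x"]) auto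
  have "abelian_group (End_algebra E X)"
    using neg by (intro abelian_groupI) (simp_all add: End_algebra_simps X car H.M.a_ac)
  moreover have "monoid (End_algebra E X)"
    using X by (intro monoidI) (auto simp: End_algebra_simps Idm_in Comp_in Comp_Idm_left Comp_Idm_right Comp_assoc)
  ultimately show ?thesis
    using X Comp_add_left Comp_add_right
    by (intro ringI) (auto simp: End_algebra_simps abelian_group_def)
qed

lemma Comp_zero:
  assumes "X \<in> Ob E" "Y \<in> Ob E" "Z \<in> Ob E"
  shows "f \<in> Hom E X Y \<Longrightarrow> Comp E X Y Z \<zero>\<^bsub>HomMod E Y Z\<^esub> f = \<zero>\<^bsub>HomMod E X Z\<^esub>"
    and "g \<in> Hom E Y Z \<Longrightarrow> Comp E X Y Z g \<zero>\<^bsub>HomMod E X Y\<^esub> = \<zero>\<^bsub>HomMod E X Z\<^esub>"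
  using linear_map_zero[OF linear_Comp_left] linear_map_zero[OF linear_Comp_right] module_HomMod assms by auto

end

context idempotent_family
begin

text \<open>The combinations of arrows \<open>A \<rightarrow> B \<rightarrow> A\<close> that factor through some \<open>e B\<close>.  The idempotents are full if
  all identities belong to it.\<close>

inductive_set trace :: "'o \<Rightarrow> 'a set" for A where
  trace_zero: "\<zero>\<^bsub>HomMod K A A\<^esub> \<in> trace A"
| trace_step: "\<lbrakk>x \<in> trace A; B \<in> Ob K; u \<in> Hom K B A; w \<in> Hom K A B;
    Comp K B B A u (e B) = u; Comp K A B B (e B) w = w\<rbrakk>
    \<Longrightarrow> Comp K A B A u w \<oplus>\<^bsub>HomMod K A A\<^esub> x \<in> trace A"

lemma trace_in:
  assumes "x \<in> trace A" "A \<in> Ob K"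
  shows "x \<in> Hom K A A"
proof -
  interpret H: module R "HomMod K A A" using assms by (intro module_HomMod)
  note car = carrier_HomMod[OF assms(2) assms(2)]
  show ?thesis using assms(1)
  proof induction
    case trace_zero
    show ?case using H.M.zero_closed car by simp
  next
    case (trace_step x B u w)
    then show ?case using H.M.a_closed Comp_in assms(2) car by simp
  qed
qed

lemma trace_add:
  assumes "x \<in> trace A" "y \<in> trace A" "A \<in> Ob K"
  shows "x \<oplus>\<^bsub>HomMod K A A\<^esub> y \<in> trace A"
proof -
  interpret H: module R "HomMod K A A" using assms by (intro module_HomMod)
  note car = carrier_HomMod[OF assms(3) assms(3)]
  note yin = trace_in[OF assms(2,3)]
  show ?thesis using assms(1)
  proof induction
    case trace_zero
    show ?case using assms(2) yin car by simp
  next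
    case (trace_step x B u w)
    have "Comp K A B A u w \<in> carrier (HomMod K A A)" "x \<in> carrier (HomMod K A A)"
      using trace_step Comp_in assms(3) car trace_in by auto
    then show ?case
      using trace.trace_step[OF trace_step.IH trace_step.hyps(2-)] yin car by (simp add: H.M.a_assoc)
  qed
qed

lemma trace_conjugate:
  assumes "x \<in> trace A" "A \<in> Ob K" "C \<in> Ob K" "f \<in> Hom K A C" "g \<in> Hom K C A"
  shows "Comp K C A C f (Comp K C A A x g) \<in> trace C"
  using assms(1)
proof induction
  case trace_zero
  show ?case using assms trace.trace_zero by (simp add: Comp_zero)
next
  case (trace_step x B u w)
  note I = assms(2-) trace_step.hyps trace_in[OF trace_step.hyps(1) assms(2)]
  have "Comp K C A C f (Comp K C A A (Comp K A B A u w \<oplus>\<^bsub>HomMod K A A\<^esub> x) g) =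
      Comp K C A C f (Comp K C A A (Comp K A B A u w) g) \<oplus>\<^bsub>HomMod K C C\<^esub> Comp K C A C f (Comp K C A A x g)"
    using I by (simp add: Comp_add_left Comp_add_right Comp_in)
  also have "Comp K C A C f (Comp K C A A (Comp K A B A u w) g) = Comp K C B C (Comp K B A C f u) (Comp K C A B w g)"
    using I by (simp add: Comp_assoc Comp_in)
  also have "Comp K C B C (Comp K B A C f u) (Comp K C A B w g) \<oplus>\<^bsub>HomMod K C C\<^esub> Comp K C A C f (Comp K C A A x g) \<in> trace C"
    using I e_in[of B] trace_step.IH
    by (intro trace.trace_step) (auto simp: Comp_in Comp_assoc, auto simp: Comp_assoc[symmetric])
  finally show ?case .
qed

lemma trace_sum:
  assumes "x \<in> trace A" "A \<in> Ob K"
  shows "\<exists>(n::nat) B u w. (\<forall>i<n. B i \<in> Ob K \<and> u i \<in> Hom K (B i) A \<and> w i \<in> Hom K A (B i) \<and>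
      Comp K (B i) (B i) A (u i) (e (B i)) = u i \<and> Comp K A (B i) (B i) (e (B i)) (w i) = w i) \<and>
    (\<Oplus>\<^bsub>HomMod K A A\<^esub>i\<in>{..<n}. Comp K A (B i) A (u i) (w i)) = x"
proof -
  interpret H: module R "HomMod K A A" using assms by (intro module_HomMod)
  note car = carrier_HomMod[OF assms(2) assms(2)]
  show ?thesis using assms(1)
  proof induction
    case trace_zero
    show ?case by (intro exI[of _ "0::nat"]) simp
  next
    case (trace_step x C v z)
    then obtain n :: nat and B u w where *: "\<forall>i<n. B i \<in> Ob K \<and> u i \<in> Hom K (B i) A \<and> w i \<in> Hom K A (B i) \<and>
      Comp K (B i) (B i) A (u i) (e (B i)) = u i \<and> Comp K A (B i) (B i) (e (B i)) (w i) = w i"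
      "(\<Oplus>\<^bsub>HomMod K A A\<^esub>i\<in>{..<n}. Comp K A (B i) A (u i) (w i)) = x" by blast
    let ?B = "B(n := C)" and ?u = "u(n := v)" and ?w = "w(n := z)"
    let ?c = "\<lambda>i. Comp K A (?B i) A (?u i) (?w i)"
    have c: "?c i \<in> carrier (HomMod K A A)" if "i \<le> n" for i
      using that * trace_step.hyps Comp_in assms(2) car by (cases "i = n") auto
    have "(\<Oplus>\<^bsub>HomMod K A A\<^esub>i\<in>{..<Suc n}. ?c i) = ?c n \<oplus>\<^bsub>HomMod K A A\<^esub> (\<Oplus>\<^bsub>HomMod K A A\<^esub>i\<in>{..<n}. ?c i)"
      unfolding lessThan_Suc by (intro H.M.finsum_insert Pi_I c) auto
    also have "(\<Oplus>\<^bsub>HomMod K A A\<^esub>i\<in>{..<n}. ?c i) = (\<Oplus>\<^bsub>HomMod K A A\<^esub>i\<in>{..<n}. Comp K A (B i) A (u i) (w i))"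
    proof (intro H.M.finsum_cong' refl Pi_I)
      fix i assume "i \<in> {..<n}"
      then show "Comp K A (B i) A (u i) (w i) \<in> carrier (HomMod K A A)" using c[of i] by auto
    qed auto
    finally have "(\<Oplus>\<^bsub>HomMod K A A\<^esub>i\<in>{..<Suc n}. ?c i) = Comp K A C A v z \<oplus>\<^bsub>HomMod K A A\<^esub> x"
      using *(2) by simp
    moreover have "\<forall>i<Suc n. ?B i \<in> Ob K \<and> ?u i \<in> Hom K (?B i) A \<and> ?w i \<in> Hom K A (?B i) \<and>
      Comp K (?B i) (?B i) A (?u i) (e (?B i)) = ?u i \<and> Comp K A (?B i) (?B i) (e (?B i)) (?w i) = ?w i"
      using *(1) trace_step.hyps by (auto simp: less_Suc_eq)
    ultimately show ?case by blast
  qed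
qed

lemma full_idempotent_familyI:
  assumes "\<And>A. A \<in> Ob K \<Longrightarrow> Idm K A \<in> trace A"
  shows "\<exists>n B u w. full_idempotent_family R K e n B u w"
proof -
  define P where "P A d \<longleftrightarrow> (\<forall>i<fst d. fst (snd d) i \<in> Ob K \<and>
      fst (snd (snd d)) i \<in> Hom K (fst (snd d) i) A \<and> snd (snd (snd d)) i \<in> Hom K A (fst (snd d) i) \<and>
      Comp K (fst (snd d) i) (fst (snd d) i) A (fst (snd (snd d)) i) (e (fst (snd d) i)) = fst (snd (snd d)) i \<and>
      Comp K A (fst (snd d) i) (fst (snd d) i) (e (fst (snd d) i)) (snd (snd (snd d)) i) = snd (snd (snd d)) i) \<and>
    (\<Oplus>\<^bsub>HomMod K A A\<^esub>i\<in>{..<fst d}. Comp K A (fst (snd d) i) A (fst (snd (snd d)) i) (snd (snd (snd d)) i)) = Idm K A"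
    for A and d :: "nat \<times> (nat \<Rightarrow> 'o) \<times> (nat \<Rightarrow> 'a) \<times> (nat \<Rightarrow> 'a)"
  have "\<exists>d. P A d" if A: "A \<in> Ob K" for A
  proof -
    from trace_sum[OF assms[OF A] A] obtain n :: nat and B u w where "(\<forall>i<n. B i \<in> Ob K \<and> u i \<in> Hom K (B i) A \<and> w i \<in> Hom K A (B i) \<and>
        Comp K (B i) (B i) A (u i) (e (B i)) = u i \<and> Comp K A (B i) (B i) (e (B i)) (w i) = w i) \<and>
      (\<Oplus>\<^bsub>HomMod K A A\<^esub>i\<in>{..<n}. Comp K A (B i) A (u i) (w i)) = Idm K A" by blast
    then have "P A (n, B, u, w)" by (simp add: P_def)
    then show ?thesis by blast
  qed
  then obtain d where d: "P A (d A)" if "A \<in> Ob K" for A by metis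
  have "full_idempotent_family R K e (\<lambda>A. fst (d A)) (\<lambda>A. fst (snd (d A)))
      (\<lambda>A. fst (snd (snd (d A)))) (\<lambda>A. snd (snd (snd (d A))))"
    using d unfolding P_def by unfold_locales blast+
  then show ?thesis by blast
qed

end


section \<open>Idempotents for categories of trees\<close>

locale tree_setting =
  fixes R :: "('r, 'x) ring_scheme" and \<D> \<D>min :: "'v rel set"
  assumes cring: "cring R"
    and trees: "\<D> \<subseteq> {A. rooted_tree A}"
    and uncontracted: "minimal_uncontracted \<D> \<D>min"
    and C1: "condition_C1 \<D> \<D>min"
    and C2: "condition_C2 \<D> \<D>min"
begin

abbreviation "H A B \<equiv> {f. tree_morphism \<D> \<D>min A B f}"
abbreviation "kH A B \<equiv> free_module R (H A B)"

lemma tree: "A \<in> \<D> \<Longrightarrow> rooted_tree A"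
  using trees by blast

lemma TC_simps [simp]:
  "Ob (tree_category \<D> \<D>min) = \<D>" "Hom (tree_category \<D> \<D>min) A B = H A B"
  "Idm (tree_category \<D> \<D>min) A = (\<lambda>x\<in>Field A. x)"
  "Comp (tree_category \<D> \<D>min) A B C g f = compose (Field A) g f"
  by (simp_all add: tree_category_def)

sublocale hom_finite_category "tree_category \<D> \<D>min" R
proof (intro hom_finite_category.intro hom_finite_category_axioms.intro category_tree_category cring)
  fix A B assume "A \<in> Ob (tree_category \<D> \<D>min)" "B \<in> Ob (tree_category \<D> \<D>min)"
  then have "finite (Field A \<rightarrow>\<^sub>E Field B)"
    using rooted_treeD(1)[OF tree] by (auto intro!: finite_PiE)
  then show "finite (Hom (tree_category \<D> \<D>min) A B)"
    by (rule rev_finite_subset) (auto dest: tree_morphism_funcset)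
qed

lemma funcset: "f \<in> H A B \<Longrightarrow> f \<in> Field A \<rightarrow>\<^sub>E Field B"
  using tree_morphism_funcset by blast

lemma embedding_in: "A \<in> \<D> \<Longrightarrow> B \<in> \<D> \<Longrightarrow> embedding A B f \<Longrightarrow> f \<in> H A B"
  by (auto intro: tree_morphism.emb)

lemma Hom_all_trees: "f \<in> H A B \<Longrightarrow> f \<in> Hom all_trees A B"
  using Hom_tree_category_subset[OF trees, of \<D>min A B] by auto

lemma collapsing_factors_through_push_down:
  assumes "admissible_edge A a b" "f \<in> Field A \<rightarrow>\<^sub>E Field B" "f a = f b"
  shows "compose (Field A) f (push_down A a b) = f"
  using assms coversD(3)[of A a b] by (auto simp: compose_def push_down_def fun_eq_iff PiE_iff extensional_def admissible_edge_def)

text \<open>A morphism that collapses an admissible edge factors, in the category of all trees, through the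
  contraction of that edge: the other factor is its restriction to the tree without the upper vertex
  of the edge.  For minimal objects the assumption on them excludes this.\<close>

lemma Hom_cases:
  assumes A: "A \<in> \<D>" and B: "B \<in> \<D>" and f: "f \<in> H A B"
  shows "embedding A B f \<or> (A \<notin> \<D>min \<and> collapses A f)"
proof -
  have "\<not> collapses A f" if min: "A \<in> \<D>min"
  proof
    assume "collapses A f"
    then obtain a b where ab: "admissible_edge A a b" "f a = f b" by (auto simp: collapses_def)
    then have c: "covers A a b" by (simp add: admissible_edge_def)
    note t = tree[OF A]
    let ?C = "remove_vertex A b" and ?p = "push_down A a b"
    have "?p = (\<lambda>x\<in>Field A. contract_section A a b (quotient_map a b x))"
      using contract_section_quotient_map[of _ A a b] coversD[OF c]
      by (auto simp: fun_eq_iff) (auto simp: push_down_def)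
    then have p: "admissible_contraction A ?C ?p"
      unfolding admissible_contraction_def using ab(1) isomorphism_contract_section[OF t c] by blast
    have incl: "embedding ?C A (\<lambda>x\<in>Field ?C. x)"
      by (auto simp: embedding_def Field_remove_vertex[OF t]) (auto simp: remove_vertex_def)
    have "tree_morphism {A. rooted_tree A} {} ?C B (compose (Field ?C) f (\<lambda>x\<in>Field ?C. x))"
      using Hom_all_trees[OF f] t rooted_tree_remove_vertex[OF t c]
      by (intro tree_morphism.comp[OF tree_morphism.emb[OF _ _ incl]])
        (auto simp: all_trees_def tree_category_def)
    then have g: "compose (Field ?C) f (\<lambda>x\<in>Field ?C. x) \<in> Hom all_trees ?C B"
      by (simp add: all_trees_def tree_category_def)
    have "compose (Field A) (compose (Field ?C) f (\<lambda>x\<in>Field ?C. x)) ?p = compose (Field A) f ?p"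
      using coversD[OF c] by (auto simp: compose_def push_down_def Field_remove_vertex[OF t] fun_eq_iff)
    then have "f = compose (Field A) (compose (Field ?C) f (\<lambda>x\<in>Field ?C. x)) ?p"
      using collapsing_factors_through_push_down[OF ab(1) funcset[OF f] ab(2)] by simp
    then show False
      using uncontracted min B f p g unfolding minimal_uncontracted_def TC_simps by blast
  qed
  then show ?thesis
    using all_trees_embedding_or_collapses[OF tree[OF A] Hom_all_trees[OF f]] by blast
qed

text \<open>The upper ends of the admissible edges of non-minimal objects.  Minimal objects have none, so
  that their idempotent will be the identity.\<close>

definition movable :: "'v rel \<Rightarrow> 'v set" where
  "movable A = (if A \<in> \<D>min then {} else {b. \<exists>a. admissible_edge A a b})"

definition parent :: "'v rel \<Rightarrow> 'v \<Rightarrow> 'v" where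
  "parent A b = (THE a. covers A a b)"

definition push :: "'v rel \<Rightarrow> 'v \<Rightarrow> 'v \<Rightarrow> 'v" where
  "push A b = push_down A (parent A b) b"

lemma parent_eq: "A \<in> \<D> \<Longrightarrow> covers A a b \<Longrightarrow> parent A b = a"
  unfolding parent_def using covers_unique[OF tree] by blast

lemma movableD:
  assumes "A \<in> \<D>" "b \<in> movable A"
  shows "A \<notin> \<D>min" "admissible_edge A (parent A b) b" "covers A (parent A b) b"
    "parent A b \<in> Field A" "b \<in> Field A" "height A (parent A b) < height A b"
proof -
  show m: "A \<notin> \<D>min" using assms(2) by (auto simp: movable_def split: if_splits)
  show a: "admissible_edge A (parent A b) b"
    using assms parent_eq[OF assms(1)] m by (auto simp: movable_def admissible_edge_def)
  then show c: "covers A (parent A b) b" by (simp add: admissible_edge_def)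
  show "parent A b \<in> Field A" "b \<in> Field A" "height A (parent A b) < height A b"
    using coversD[OF c] height_less[OF tree[OF assms(1)]] by auto
qed

lemma movable_Field: "A \<in> \<D> \<Longrightarrow> movable A \<subseteq> Field A"
  using movableD(5) by blast

text \<open>By condition (C1) the contraction at \<open>b\<close> exists in the category, so the idempotent map
  \<open>push A b\<close> factors through a smaller object of it.\<close>

lemma push_factors:
  assumes A: "A \<in> \<D>" and b: "b \<in> movable A"
  obtains B p j where "B \<in> \<D>" "p \<in> H A B" "embedding B A j" "j \<in> H B A" "compose (Field A) j p = push A b"
    "j ` Field B = Field A - {b}" "card (Field B) < card (Field A)"
proof -
  let ?a = "parent A b"
  note m = movableD[OF A b] and t = tree[OF A]
  obtain B \<phi> where B: "B \<in> \<D>" and \<phi>: "isomorphism (contract A ?a b) B \<phi>"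
    using C1 A m(1,2) unfolding condition_C1_def by blast
  define p where "p = (\<lambda>x\<in>Field A. \<phi> (quotient_map ?a b x))"
  let ?s = "contract_section A ?a b" and ?\<psi> = "\<lambda>y\<in>Field B. inv_into (Field (contract A ?a b)) \<phi> y"
  have s: "isomorphism (contract A ?a b) (remove_vertex A b) ?s"
    by (rule isomorphism_contract_section[OF t m(3)])
  have "embedding (remove_vertex A b) A (\<lambda>x\<in>Field (remove_vertex A b). x)"
    by (auto simp: embedding_def Field_remove_vertex[OF t]) (auto simp: remove_vertex_def)
  then have s': "embedding (contract A ?a b) A ?s"
    using s by (auto simp: embedding_def isomorphism_def Field_remove_vertex[OF t] remove_vertex_def)
  define j where "j = compose (Field B) ?s ?\<psi>"
  have j: "embedding B A j"
    unfolding j_def by (rule embedding_compose[OF isomorphism_inverse[OF \<phi>] s'])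
  have \<phi>': "inj_on \<phi> (Field (contract A ?a b))" "\<phi> ` Field (contract A ?a b) = Field B"
    using \<phi> by (auto simp: isomorphism_def embedding_def)
  have p_in: "p \<in> H A B"
  proof -
    have "admissible_contraction A B p" unfolding admissible_contraction_def p_def using m(2) \<phi> by blast
    then show ?thesis using A m(1) B by (auto intro: tree_morphism.contr)
  qed
  have "compose (Field A) j p = push A b"
  proof -
    have "j (p x) = push_down A ?a b x" if x: "x \<in> Field A" for x
    proof -
      have q: "quotient_map ?a b x \<in> Field (contract A ?a b)" using x by (simp add: Field_contract)
      then have "\<phi> (quotient_map ?a b x) \<in> Field B" using \<phi>'(2) by blast
      then show ?thesis
        using x q inv_into_f_f[OF \<phi>'(1) q] contract_section_quotient_map[OF x coversD(2)[OF m(3)]]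
        by (simp add: j_def p_def compose_eq)
    qed
    then show ?thesis by (auto simp: compose_def push_def fun_eq_iff) (auto simp: push_down_def)
  qed
  moreover have im: "j ` Field B = Field A - {b}"
  proof -
    have "?\<psi> ` Field B = Field (contract A ?a b)"
      using \<phi>' by (metis (no_types, lifting) image_restrict_eq inv_into_image_cancel order_refl restrict_apply' image_cong)
    then have "j ` Field B = ?s ` Field (contract A ?a b)"
      unfolding j_def by (metis (no_types, lifting) compose_eq image_cong image_image)
    then show ?thesis using s by (simp add: isomorphism_def Field_remove_vertex[OF t])
  qed
  moreover have "card (Field B) < card (Field A)"
  proof -
    have "card (Field B) = card (Field A - {b})" using im card_image[OF embeddingD(2)[OF j]] by simp
    also have "\<dots> < card (Field A)" using rooted_treeD(1)[OF t] m(5) by (rule card_Diff1_less)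
    finally show ?thesis .
  qed
  ultimately show ?thesis using that B p_in j embedding_in[OF B A j] by blast
qed

lemma push_in: "A \<in> \<D> \<Longrightarrow> b \<in> movable A \<Longrightarrow> push A b \<in> H A A"
  using push_factors[of A b] Comp_in[of A _ A] by (metis TC_simps)

lemma push_apply: "x \<in> Field A \<Longrightarrow> push A b x = (if x = b then parent A b else x)"
  by (simp add: push_def push_down_def)

text \<open>Pushing \<open>v\<close> and \<open>w\<close> commutes unless one is the parent of the other.  If \<open>v\<close> is the parent of
  \<open>w\<close>, all three products send both vertices to the parent of \<open>v\<close>.\<close>

lemma push_relations:
  assumes A: "A \<in> \<D>" and v: "v \<in> movable A" and w: "w \<in> movable A"
  shows "compose (Field A) (push A v) (push A v) = push A v"
    and "height A v \<le> height A w \<Longrightarrow> v \<noteq> w \<Longrightarrow>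
      compose (Field A) (compose (Field A) (push A v) (push A w)) (push A v) = compose (Field A) (push A v) (push A w)"
    and "height A v \<le> height A w \<Longrightarrow> v \<noteq> w \<Longrightarrow>
      compose (Field A) (compose (Field A) (push A w) (push A v)) (push A w) = compose (Field A) (push A v) (push A w)"
proof -
  note V = movableD(4-6)[OF A v] and W = movableD(4-6)[OF A w]
  note ext = push_def push_down_def
  show "compose (Field A) (push A v) (push A v) = push A v"
    using V by (auto simp: fun_eq_iff compose_def ext)
  assume h: "height A v \<le> height A w" "v \<noteq> w"
  then have "parent A v \<noteq> w" using V by auto
  then show "compose (Field A) (compose (Field A) (push A v) (push A w)) (push A v) = compose (Field A) (push A v) (push A w)"
    and "compose (Field A) (compose (Field A) (push A w) (push A v)) (push A w) = compose (Field A) (push A v) (push A w)"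
    using V W h(2) by (auto simp: fun_eq_iff compose_def ext)
qed

text \<open>Parents come before their children, as the relations require; they become factors further to
  the right.\<close>

definition movable_list :: "'v rel \<Rightarrow> 'v list" where
  "movable_list A = sort_key (height A) (SOME vs. set vs = movable A \<and> distinct vs)"

lemma movable_list:
  assumes "A \<in> \<D>"
  shows "set (movable_list A) = movable A"
    and "sorted_wrt (\<lambda>v w. height A v \<le> height A w \<and> v \<noteq> w) (movable_list A)"
proof -
  have "finite (movable A)"
    using finite_subset[OF movable_Field rooted_treeD(1)[OF tree]] assms by blast
  then have "\<exists>vs. set vs = movable A \<and> distinct vs" using finite_distinct_list by blast
  from someI_ex[OF this] have *: "set (movable_list A) = movable A" "distinct (movable_list A)"
    by (auto simp: movable_list_def)
  then show "set (movable_list A) = movable A" by simp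
  have "sorted (map (height A) (movable_list A))" by (simp add: movable_list_def)
  then show "sorted_wrt (\<lambda>v w. height A v \<le> height A w \<and> v \<noteq> w) (movable_list A)"
    using *(2) by (auto simp: sorted_wrt_iff_nth_less sorted_iff_nth_mono_less nth_eq_iff_index_eq)
qed

abbreviation "bas A B \<equiv> single R (H A B)"
abbreviation "push_list A \<equiv> map (\<lambda>v. bas A A (push A v)) (movable_list A)"

definition idem :: "'v rel \<Rightarrow> ('v \<Rightarrow> 'v) \<Rightarrow> 'r" where
  "idem A = ring.compl_prod (End_algebra L A) (push_list A)"

lemma linear_category_L: "linear_category R L"
  by (rule linear_category_linearization)

lemma ring_End: "A \<in> \<D> \<Longrightarrow> ring (End_algebra L A)"
  by (intro linear_category.ring_End_algebra[OF linear_category_L]) simp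

lemma End_simps:
  "A \<in> \<D> \<Longrightarrow> carrier (End_algebra L A) = carrier (kH A A)"
  "mult (End_algebra L A) = Comp L A A A" "one (End_algebra L A) = bas A A (\<lambda>x\<in>Field A. x)"
  "zero (End_algebra L A) = zero (kH A A)" "add (End_algebra L A) = add (kH A A)"
  using linear_category.End_algebra_simps[OF linear_category_L, of A] by simp_all

lemma Comp_L_closed:
  assumes "A \<in> \<D>" "B \<in> \<D>" "C \<in> \<D>" "u \<in> carrier (kH A B)" "v \<in> carrier (kH B C)"
  shows "Comp L A B C v u \<in> carrier (kH A C)"
  using Comp_L_in[of A B C u v] assms by simp

lemma Comp_bas:
  assumes "A \<in> \<D>" "B \<in> \<D>" "C \<in> \<D>" "f \<in> H A B" "g \<in> H B C"
  shows "Comp L A B C (bas B C g) (bas A B f) = bas A C (compose (Field A) g f)"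
  using Comp_basis[of A B C f g] assms by simp

lemma kiselman_push_list:
  assumes A: "A \<in> \<D>"
  shows "ring.kiselman (End_algebra L A) (push_list A)"
proof -
  interpret ring "End_algebra L A" by (rule ring_End[OF A])
  note m = movable_list[OF A] and rel = push_relations[OF A] and p = push_in[OF A]
  have c: "compose (Field A) g f \<in> H A A" if "f \<in> H A A" "g \<in> H A A" for f g
    using Comp_in[of A A A f g] A that by simp
  have "sorted_wrt (\<lambda>v w. height A v \<le> height A w \<and> v \<noteq> w \<and> v \<in> movable A \<and> w \<in> movable A) (movable_list A)"
    using m by (auto simp: sorted_wrt_iff_nth_less)
  then have "sorted_wrt (\<lambda>v w. Comp L A A A (Comp L A A A (bas A A (push A v)) (bas A A (push A w))) (bas A A (push A v)) =
        Comp L A A A (bas A A (push A v)) (bas A A (push A w)) \<and>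
      Comp L A A A (Comp L A A A (bas A A (push A w)) (bas A A (push A v))) (bas A A (push A w)) =
        Comp L A A A (bas A A (push A v)) (bas A A (push A w))) (movable_list A)"
  proof (rule sorted_wrt_mono_rel[rotated])
    fix v w assume "height A v \<le> height A w \<and> v \<noteq> w \<and> v \<in> movable A \<and> w \<in> movable A"
    then show "Comp L A A A (Comp L A A A (bas A A (push A v)) (bas A A (push A w))) (bas A A (push A v)) =
        Comp L A A A (bas A A (push A v)) (bas A A (push A w)) \<and>
      Comp L A A A (Comp L A A A (bas A A (push A w)) (bas A A (push A v))) (bas A A (push A w)) =
        Comp L A A A (bas A A (push A v)) (bas A A (push A w))"
      using rel(2,3)[of v w] p c A by (simp add: Comp_bas del: mem_Collect_eq)
  qed
  moreover have "Comp L A A A (bas A A (push A v)) (bas A A (push A v)) = bas A A (push A v)" if "v \<in> movable A" for v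
    using that rel(1)[OF that that] p A by (simp add: Comp_bas del: mem_Collect_eq)
  ultimately show ?thesis
    by (auto simp: kiselman_def End_simps A m sorted_wrt_map basis_in)
qed

lemma idem_in: "A \<in> \<D> \<Longrightarrow> idem A \<in> carrier (kH A A)"
  using ring.compl_prod_closed[OF ring_End, of A "push_list A"] by (simp add: idem_def End_simps basis_in image_subset_iff)

lemma idem_idem: "A \<in> \<D> \<Longrightarrow> Comp L A A A (idem A) (idem A) = idem A"
  using ring.compl_prod_idem[OF ring_End kiselman_push_list, of A] by (simp add: idem_def End_simps)

lemma push_idem:
  assumes "A \<in> \<D>" "v \<in> movable A"
  shows "Comp L A A A (bas A A (push A v)) (idem A) = \<zero>\<^bsub>kH A A\<^esub>"
    and "Comp L A A A (idem A) (bas A A (push A v)) = \<zero>\<^bsub>kH A A\<^esub>"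
  using ring.mult_compl_prod_zero[OF ring_End kiselman_push_list, of A "bas A A (push A v)"]
    ring.compl_prod_mult_zero[OF ring_End kiselman_push_list, of A "bas A A (push A v)"]
    assms movable_list[OF assms(1)] by (auto simp: idem_def End_simps)

lemma one_minus_idem:
  assumes A: "A \<in> \<D>" and J: "\<zero>\<^bsub>kH A A\<^esub> \<in> J" "J \<subseteq> carrier (kH A A)"
    "\<And>x y. x \<in> J \<Longrightarrow> y \<in> J \<Longrightarrow> x \<oplus>\<^bsub>kH A A\<^esub> y \<in> J"
    "\<And>y v. y \<in> carrier (kH A A) \<Longrightarrow> v \<in> movable A \<Longrightarrow> Comp L A A A y (bas A A (push A v)) \<in> J"
  obtains z where "z \<in> J" "bas A A (\<lambda>x\<in>Field A. x) = z \<oplus>\<^bsub>kH A A\<^esub> idem A"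
proof -
  interpret E: ring "End_algebra L A" by (rule ring_End[OF A])
  have id: "idem A \<in> carrier (End_algebra L A)" using idem_in[OF A] by (simp add: End_simps A)
  have "\<one>\<^bsub>End_algebra L A\<^esub> \<ominus>\<^bsub>End_algebra L A\<^esub> idem A \<in> J"
    unfolding idem_def by (rule E.compl_prod_ideal) (use J movable_list[OF A] in \<open>auto simp: End_simps A basis_in\<close>)
  moreover have "\<one>\<^bsub>End_algebra L A\<^esub> = (\<one>\<^bsub>End_algebra L A\<^esub> \<ominus>\<^bsub>End_algebra L A\<^esub> idem A) \<oplus>\<^bsub>End_algebra L A\<^esub> idem A"
    using id by (simp add: a_minus_def E.a_assoc E.l_neg)
  ultimately show ?thesis using that by (simp add: End_simps)
qed

sublocale idempotent_family R L idem
  using linear_category_L idem_in idem_idem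
  by (intro idempotent_family.intro idempotent_family_axioms.intro) auto

text \<open>By induction on the number of vertices.  The identity of \<open>A\<close> is \<open>idem A\<close> plus combinations of
  maps \<open>y push\<^sub>v\<close>; each of those passes through the identity of a smaller object.\<close>

lemma Idm_in_trace: "A \<in> \<D> \<Longrightarrow> bas A A (\<lambda>x\<in>Field A. x) \<in> trace A"
proof (induction "card (Field A)" arbitrary: A rule: less_induct)
  case less
  note A = less.prems
  have one: "bas A A (\<lambda>x\<in>Field A. x) \<in> carrier (kH A A)" by (simp add: basis_in)
  have "\<zero>\<^bsub>kH A A\<^esub> \<in> trace A" using trace_zero[of A] by simp
  moreover have "Comp L A A A y (bas A A (push A v)) \<in> trace A"
    if y: "y \<in> carrier (kH A A)" and v: "v \<in> movable A" for y v
  proof -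
    obtain B p j where B: "B \<in> \<D>" "p \<in> H A B" "j \<in> H B A" "compose (Field A) j p = push A v"
      "card (Field B) < card (Field A)"
      using push_factors[OF A v] by metis
    have "Comp L A A A y (bas A A (push A v)) = Comp L A A A y (Comp L A B A (bas B A j) (bas A B p))"
      using A B by (simp add: Comp_bas)
    also have "\<dots> = Comp L A B A (Comp L B A A y (bas B A j)) (bas A B p)"
      using linear_category.axioms(1)[OF linear_category_L, THEN category.Comp_assoc, of A B A A "bas A B p" "bas B A j" y]
        A B y by (simp add: basis_in)
    also have "bas A B p = Comp L A B B (bas B B (\<lambda>x\<in>Field B. x)) (bas A B p)"
      using linear_category.axioms(1)[OF linear_category_L, THEN category.Comp_Idm_left, of A B "bas A B p"]
        A B by (simp add: basis_in)
    also have "Comp L A B A (Comp L B A A y (bas B A j)) \<dots> \<in> trace A"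
      using less.hyps[OF B(5,1)] A B y by (intro trace_conjugate) (auto simp: basis_in Comp_L_closed)
    finally show ?thesis .
  qed
  ultimately obtain z where z: "z \<in> trace A" "bas A A (\<lambda>x\<in>Field A. x) = z \<oplus>\<^bsub>kH A A\<^esub> idem A"
    using one_minus_idem[OF A, of "trace A"] trace_add[of _ A] trace_in[of _ A] A by (simp add: subset_iff) metis
  have "idem A \<in> trace A"
  proof -
    interpret M: module R "free_module R (H A A)" by (rule module_free)
    have "Comp L A A A (idem A) (idem A) \<oplus>\<^bsub>HomMod L A A\<^esub> \<zero>\<^bsub>HomMod L A A\<^esub> \<in> trace A"
      using A idem_in[OF A] idem_idem[OF A] by (intro trace_step trace_zero) auto
    then show ?thesis using idem_idem[OF A] idem_in[OF A] by simp
  qed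
  then show ?case unfolding z(2) using trace_add[OF z(1), of "idem A"] A by simp
qed

end


context tree_setting
begin

subsection \<open>Maps killed by the idempotents\<close>

lemma Comp_L_assoc:
  assumes "A \<in> \<D>" "B \<in> \<D>" "C \<in> \<D>" "D \<in> \<D>" "u \<in> carrier (kH A B)"
    "v \<in> carrier (kH B C)" "w \<in> carrier (kH C D)"
  shows "Comp L A B D (Comp L B C D w v) u = Comp L A C D w (Comp L A B C v u)"
  using category.Comp_assoc[OF linear_category.axioms(1)[OF linear_category_L], of A B C D u v w] assms by simp

lemma Comp_L_zero:
  assumes "A \<in> \<D>" "B \<in> \<D>" "C \<in> \<D>"
  shows "u \<in> carrier (kH A B) \<Longrightarrow> Comp L A B C \<zero>\<^bsub>kH B C\<^esub> u = \<zero>\<^bsub>kH A C\<^esub>"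
    and "v \<in> carrier (kH B C) \<Longrightarrow> Comp L A B C v \<zero>\<^bsub>kH A B\<^esub> = \<zero>\<^bsub>kH A C\<^esub>"
  using linear_category.Comp_zero[OF linear_category_L, of A B C] assms by auto

text \<open>A map that collapses the edge below \<open>b\<close> absorbs \<open>push A b\<close>, which \<open>idem A\<close> kills.\<close>

lemma collapsing_idem:
  assumes A: "A \<in> \<D>" and B: "B \<in> \<D>" and f: "f \<in> H A B" and not: "\<not> embedding A B f"
  shows "Comp L A A B (bas A B f) (idem A) = \<zero>\<^bsub>kH A B\<^esub>"
proof -
  obtain a b where min: "A \<notin> \<D>min" and ab: "admissible_edge A a b" "f a = f b"
    using Hom_cases[OF A B f] not by (auto simp: collapses_def)
  then have b: "b \<in> movable A" by (auto simp: movable_def)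
  have "push A b = push_down A a b"
    using ab(1) parent_eq[OF A, of a b] by (simp add: push_def admissible_edge_def)
  then have "compose (Field A) f (push A b) = f"
    using collapsing_factors_through_push_down[OF ab(1) funcset[OF f] ab(2)] by simp
  then have "Comp L A A B (bas A B f) (idem A) = Comp L A A B (Comp L A A B (bas A B f) (bas A A (push A b))) (idem A)"
    using Comp_bas[OF A A B push_in[OF A b] f] by simp
  also have "\<dots> = Comp L A A B (bas A B f) (Comp L A A A (bas A A (push A b)) (idem A))"
    using A B by (intro Comp_L_assoc) (auto simp: basis_in idem_in)
  finally show ?thesis using A B push_idem[OF A b] by (simp add: Comp_L_zero basis_in)
qed

text \<open>A map whose image avoids \<open>v\<close> is unchanged by composition with \<open>push A v\<close>, which \<open>idem A\<close> kills.\<close>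

lemma missing_idem:
  assumes A: "A \<in> \<D>" and B: "B \<in> \<D>" and f: "f \<in> H B A" and v: "v \<in> movable A" "v \<notin> f ` Field B"
  shows "Comp L B A A (idem A) (bas B A f) = \<zero>\<^bsub>kH B A\<^esub>"
proof -
  have "compose (Field B) (push A v) f = f"
    using funcset[OF f] v(2) by (auto simp: compose_def fun_eq_iff push_def push_down_def PiE_iff extensional_def)
  then have "Comp L B A A (idem A) (bas B A f) = Comp L B A A (idem A) (Comp L B A A (bas A A (push A v)) (bas B A f))"
    using Comp_bas[OF B A A f push_in[OF A v(1)]] by simp
  also have "\<dots> = Comp L B A A (Comp L A A A (idem A) (bas A A (push A v))) (bas B A f)"
    using A B by (intro Comp_L_assoc[symmetric]) (auto simp: basis_in idem_in)
  finally show ?thesis using A B push_idem[OF A v(1)] by (simp add: Comp_L_zero basis_in)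
qed


subsection \<open>Flexible vertices\<close>

lemma movable_flexible:
  assumes A: "A \<in> \<D>" and b: "b \<in> movable A"
  shows "flexible \<D> A b"
proof -
  obtain B p j where B: "B \<in> \<D>" "embedding B A j" "j ` Field B = Field A - {b}"
    using push_factors[OF A b] by metis
  then have "proper_embedding B A j" "b \<notin> j ` Field B"
    using movableD(5)[OF A b] by (auto simp: proper_embedding_def isomorphism_def)
  then show ?thesis using B(1) movableD(5)[OF A b] by (auto simp: flexible_def)
qed

text \<open>The child of the root at or below a vertex \<open>v \<noteq> root\<close> is flexible, so condition (C2) joins \<open>v\<close> to it
  by admissible edges.  If that child is not \<open>v\<close> itself, the path has to leave the subtree above \<open>v\<close>,
  and the only edge leading out of it is the one below \<open>v\<close>.\<close>

lemma flexible_cases: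
  assumes A: "A \<in> \<D>" "A \<notin> \<D>min" and v: "flexible \<D> A v"
  shows "is_root A v \<or> v \<in> movable A"
proof (rule disjCI)
  assume nm: "v \<notin> movable A"
  note t = rooted_treeD[OF tree[OF A(1)]]
  have vF: "v \<in> Field A" using v by (simp add: flexible_def)
  obtain r where r: "is_root A r" using ex_root[OF tree[OF A(1)]] by blast
  show "is_root A v"
  proof (rule ccontr)
    assume "\<not> is_root A v"
    then have rv: "(r, v) \<in> A" "r \<noteq> v" using root_least[OF tree[OF A(1)] r vF] r by auto
    obtain c where c: "covers A r c" "(c, v) \<in> A" using ex_cover_above[OF tree[OF A(1)] rv] by blast
    have cm: "c \<in> movable A" using c(1) r A(2) by (auto simp: movable_def admissible_edge_def)
    have path: "(v, c) \<in> {(a, b). admissible_edge A a b \<or> admissible_edge A b a}\<^sup>*"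
      using C2 A v movable_flexible[OF A(1) cm] by (auto simp: condition_C2_def)
    have "(v, w) \<in> A" if "(v, w) \<in> {(a, b). admissible_edge A a b \<or> admissible_edge A b a}\<^sup>*" for w
      using that
    proof (induction rule: rtrancl_induct)
      case base
      then show ?case using t(2)[OF vF] .
    next
      case (step w z)
      then consider "admissible_edge A w z" | "admissible_edge A z w" by blast
      then show ?case
      proof cases
        case 1
        then show ?thesis using t(3)[OF step.IH] coversD(1)[of A w z] by (simp add: admissible_edge_def)
      next
        case 2
        then have "w \<noteq> v" using nm A(2) by (auto simp: movable_def)
        then show ?thesis using below_cover[OF tree[OF A(1)] _ step.IH, of z] 2 by (auto simp: admissible_edge_def)
      qed
    qed
    from this[OF path] have "c = v" using t(4) c(2) by blast
    then show False using nm cm by simp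
  qed
qed

text \<open>The hom-module is spanned by the \<open>e\<^sub>A f e\<^sub>B\<close>.  A nonzero one comes from an embedding \<open>f\<close> that hits
  all movable vertices; the vertices missed by \<open>f\<close> are flexible, so only the root can be missed.\<close>

lemma card_of_nonzero_Hom:
  assumes A: "A \<in> \<D>" and B: "B \<in> \<D>" and x: "x \<in> corner_Hom B A" "x \<noteq> \<zero>\<^bsub>kH B A\<^esub>"
  shows "card (Field A) = card (Field B) \<or> card (Field A) = card (Field B) + 1"
proof -
  let ?M = "free_module R (H B A)"
  let ?c = "\<lambda>z. Comp L B A A (idem A) (Comp L B B A z (idem B))"
  interpret M: module R ?M by (rule module_free)
  have lin: "linear_map R ?M ?M ?c"
    using linear_map_compose[OF Comp_L_left[of B B A "idem B"] Comp_L_right[of B A A "idem A"]] A B idem_in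
    by simp
  have zero: "linear_map R ?M ?M (\<lambda>z. \<zero>\<^bsub>?M\<^esub>)" by (intro linear_mapI) auto
  have xM: "x \<in> carrier ?M" and xe: "?c x = x"
    using corner_HomD[OF x(1)] by auto
  have "\<exists>f\<in>H B A. ?c (bas B A f) \<noteq> \<zero>\<^bsub>?M\<^esub>"
  proof (rule ccontr)
    assume "\<not> ?thesis"
    then have "?c x = \<zero>\<^bsub>?M\<^esub>"
      using linear_map_eq_on_single[OF lin zero M.module_axioms _ _ xM] finite_Hom[of B A] A B by auto
    then show False using x(2) xe by simp
  qed
  then obtain f where f: "f \<in> H B A" and ne: "?c (bas B A f) \<noteq> \<zero>\<^bsub>?M\<^esub>" by blast
  have emb: "embedding B A f"
    using ne collapsing_idem[OF B A f] Comp_L_zero(2)[of B A A "idem A"] idem_in A B by auto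
  have hit: "movable A \<subseteq> f ` Field B"
  proof
    fix v assume v: "v \<in> movable A"
    have "?c (bas B A f) = Comp L B B A (Comp L B A A (idem A) (bas B A f)) (idem B)"
      using A B by (intro Comp_L_assoc[symmetric]) (auto simp: basis_in idem_in)
    then show "v \<in> f ` Field B"
      using ne missing_idem[OF A B f v] Comp_L_zero(1)[of B B A "idem B"] idem_in A B by auto
  qed
  have card: "card (f ` Field B) = card (Field B)" by (rule card_image[OF embeddingD(2)[OF emb]])
  have sub: "f ` Field B \<subseteq> Field A" using embeddingD(3)[OF emb] by blast
  obtain r where r: "is_root A r" using ex_root[OF tree[OF A]] by blast
  have "Field A - f ` Field B \<subseteq> {r}"
  proof
    fix v assume v: "v \<in> Field A - f ` Field B"
    then have pe: "proper_embedding B A f" using emb by (auto simp: proper_embedding_def isomorphism_def)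
    then have "A \<notin> \<D>min" using C1 A B by (auto simp: condition_C1_def)
    moreover have "flexible \<D> A v" using v pe B by (auto simp: flexible_def)
    ultimately have "is_root A v" using flexible_cases[OF A] hit v by blast
    then show "v \<in> {r}" using rooted_treeD(6)[OF tree[OF A]] r by blast
  qed
  then have "card (Field A - f ` Field B) \<le> 1"
    using card_mono[of "{r}" "Field A - f ` Field B"] by simp
  moreover have "card (Field A) = card (f ` Field B) + card (Field A - f ` Field B)"
    using card_Diff_subset[of "f ` Field B" "Field A"] sub rooted_treeD(1)[OF tree[OF A]]
      card_mono[OF _ sub] finite_subset[OF sub] by simp
  ultimately show ?thesis using card by linarith
qed


subsection \<open>Endomorphism algebras\<close>

abbreviation "Aut A \<equiv> {f. isomorphism A A f}"

lemma Aut_simps [simp]: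
  "carrier (Aut_group A) = Aut A" "\<one>\<^bsub>Aut_group A\<^esub> = (\<lambda>x\<in>Field A. x)"
  "g \<otimes>\<^bsub>Aut_group A\<^esub> f = compose (Field A) g f"
  by (simp_all add: Aut_group_def)

lemma Aut_in: "A \<in> \<D> \<Longrightarrow> f \<in> Aut A \<Longrightarrow> f \<in> H A A"
  using embedding_in by (simp add: isomorphism_def)

text \<open>Morphisms that are not embeddings collapse an edge, so an injective endomorphism is an embedding,
  and it is bijective because the tree is finite.\<close>

lemma Aut_iff:
  assumes A: "A \<in> \<D>" and f: "f \<in> H A A"
  shows "f \<in> Aut A \<longleftrightarrow> embedding A A f" and "f \<in> Aut A \<longleftrightarrow> inj_on f (Field A)"
proof -
  have iso: "f \<in> Aut A" if "embedding A A f"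
    using that endo_inj_surj[OF rooted_treeD(1)[OF tree[OF A]], of f] embeddingD[OF that]
    by (auto simp: isomorphism_def)
  then show "f \<in> Aut A \<longleftrightarrow> embedding A A f" by (auto simp: isomorphism_def)
  have "\<not> collapses A f" if inj: "inj_on f (Field A)"
  proof
    assume "collapses A f"
    then obtain a b where ab: "covers A a b" "f a = f b" by (auto simp: collapses_def admissible_edge_def)
    then show False using inj_onD[OF inj ab(2)] coversD[OF ab(1)] by simp
  qed
  then show "f \<in> Aut A \<longleftrightarrow> inj_on f (Field A)"
    using iso Hom_cases[OF A A f] by (auto simp: isomorphism_def embedding_def)
qed

lemma compose_Aut_iff:
  assumes A: "A \<in> \<D>" and f: "f \<in> H A A" and g: "g \<in> H A A"
  shows "compose (Field A) g f \<in> Aut A \<longleftrightarrow> g \<in> Aut A \<and> f \<in> Aut A"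
proof -
  note fin = rooted_treeD(1)[OF tree[OF A]]
  have gf: "compose (Field A) g f \<in> H A A" using f g by (auto intro: tree_morphism.comp)
  have sub: "f ` Field A \<subseteq> Field A" using funcset[OF f] by auto
  have "inj_on (compose (Field A) g f) (Field A) \<longleftrightarrow> inj_on (g \<circ> f) (Field A)"
    by (rule inj_on_cong) (simp add: compose_def)
  also have "\<dots> \<longleftrightarrow> inj_on g (Field A) \<and> inj_on f (Field A)"
    using endo_inj_surj[OF fin sub] comp_inj_on_iff[of f "Field A" g] inj_on_imageI2[of g f "Field A"]
    by (metis comp_inj_on)
  finally show ?thesis by (simp only: Aut_iff(2)[OF A gf] Aut_iff(2)[OF A f] Aut_iff(2)[OF A g])
qed

lemma group_Aut:
  assumes A: "A \<in> \<D>"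
  shows "group (Aut_group A)"
proof (rule groupI)
  show id: "\<one>\<^bsub>Aut_group A\<^esub> \<in> carrier (Aut_group A)"
    using embedding_id by (auto simp: isomorphism_def)
  show "x \<otimes>\<^bsub>Aut_group A\<^esub> y \<in> carrier (Aut_group A)"
    if "x \<in> carrier (Aut_group A)" "y \<in> carrier (Aut_group A)" for x y
    using that compose_Aut_iff[OF A] Aut_in[OF A] by simp
  show "\<exists>y\<in>carrier (Aut_group A). y \<otimes>\<^bsub>Aut_group A\<^esub> x = \<one>\<^bsub>Aut_group A\<^esub>"
    if "x \<in> carrier (Aut_group A)" for x
  proof -
    have x: "isomorphism A A x" using that by simp
    let ?y = "\<lambda>y\<in>Field A. inv_into (Field A) x y"
    have y: "embedding A A ?y" by (rule isomorphism_inverse[OF x])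
    then have "?y \<in> Aut A" using Aut_iff(1)[OF A embedding_in[OF A A]] by blast
    moreover have "compose (Field A) ?y x = (\<lambda>x\<in>Field A. x)"
      using x inv_into_f_f[of x "Field A"] by (auto simp: isomorphism_def embedding_def compose_def fun_eq_iff)
    ultimately show ?thesis by auto
  qed
  show "x \<otimes>\<^bsub>Aut_group A\<^esub> y \<otimes>\<^bsub>Aut_group A\<^esub> z = x \<otimes>\<^bsub>Aut_group A\<^esub> (y \<otimes>\<^bsub>Aut_group A\<^esub> z)"
    if "z \<in> carrier (Aut_group A)" for x y z
    using that by (auto simp: isomorphism_def embedding_def compose_def fun_eq_iff)
  show "\<one>\<^bsub>Aut_group A\<^esub> \<otimes>\<^bsub>Aut_group A\<^esub> x = x" if "x \<in> carrier (Aut_group A)" for x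
    using that by (auto simp: isomorphism_def embedding_def compose_def fun_eq_iff PiE_iff extensional_def)
qed

text \<open>A product \<open>g f\<close> is an automorphism only if both factors are.  So the coefficients at automorphisms
  multiply as in the group algebra, and the non-invertible maps span an ideal.\<close>

lemma coefficient_Comp:
  assumes A: "A \<in> \<D>" and u: "u \<in> carrier (kH A A)" and v: "v \<in> carrier (kH A A)"
    and \<alpha>: "\<alpha> \<in> Aut A"
  shows "Comp L A A A v u \<alpha> = (\<Oplus>\<^bsub>R\<^esub>g\<in>Aut A. v g \<otimes>\<^bsub>R\<^esub> u (inv\<^bsub>Aut_group A\<^esub> g \<otimes>\<^bsub>Aut_group A\<^esub> \<alpha>))"
proof -
  interpret R: cring R by (rule cring)
  interpret G: group "Aut_group A" by (rule group_Aut[OF A])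
  let ?M = "free_module R (H A A)"
  interpret M: module R ?M by (rule module_free)
  have fin: "finite (H A A)" using finite_Hom[of A A] A by simp
  have \<alpha>H: "\<alpha> \<in> H A A" by (rule Aut_in[OF A \<alpha>])
  have uR: "u f \<in> carrier R" and vR: "v f \<in> carrier R" if "f \<in> H A A" for f
    using u v that by (auto simp: free_module_def)
  let ?inner = "\<lambda>g. lin_ext (H A A) ?M (\<lambda>f. bas A A (compose (Field A) g f)) u"
  have inner_in: "?inner g \<in> carrier ?M" for g
    using u fin by (intro linear_mapD(1)[OF lin_ext_linear[where R = R]] M.module_axioms basis_in)
  have "Comp L A A A v u = lin_ext (H A A) ?M ?inner v" by (simp add: Comp_L)
  then have "Comp L A A A v u \<alpha> = (\<Oplus>\<^bsub>R\<^esub>g\<in>H A A. (v g \<odot>\<^bsub>?M\<^esub> ?inner g) \<alpha>)"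
    using finsum_free_module_eval[OF cring \<alpha>H, of "H A A" "\<lambda>g. v g \<odot>\<^bsub>?M\<^esub> ?inner g"] vR inner_in M.smult_closed
    by (simp add: lin_ext_def[of "H A A" ?M ?inner v])
  also have "\<dots> = (\<Oplus>\<^bsub>R\<^esub>g\<in>H A A. if g \<in> Aut A then v g \<otimes>\<^bsub>R\<^esub> u (inv\<^bsub>Aut_group A\<^esub> g \<otimes>\<^bsub>Aut_group A\<^esub> \<alpha>) else \<zero>\<^bsub>R\<^esub>)"
  proof (intro R.finsum_cong' refl Pi_I)
    fix g assume g: "g \<in> H A A"
    have "?inner g \<alpha> = (\<Oplus>\<^bsub>R\<^esub>f\<in>H A A. (u f \<odot>\<^bsub>?M\<^esub> bas A A (compose (Field A) g f)) \<alpha>)"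
      using finsum_free_module_eval[OF cring \<alpha>H, of "H A A" "\<lambda>f. u f \<odot>\<^bsub>?M\<^esub> bas A A (compose (Field A) g f)"]
        uR M.smult_closed by (simp add: lin_ext_def basis_in)
    also have "\<dots> = (\<Oplus>\<^bsub>R\<^esub>f\<in>H A A. if g \<in> Aut A then (if inv\<^bsub>Aut_group A\<^esub> g \<otimes>\<^bsub>Aut_group A\<^esub> \<alpha> = f then u f else \<zero>\<^bsub>R\<^esub>) else \<zero>\<^bsub>R\<^esub>)"
    proof (intro R.finsum_cong' refl Pi_I)
      fix f assume f: "f \<in> H A A"
      show "(u f \<odot>\<^bsub>?M\<^esub> bas A A (compose (Field A) g f)) \<alpha> =
        (if g \<in> Aut A then (if inv\<^bsub>Aut_group A\<^esub> g \<otimes>\<^bsub>Aut_group A\<^esub> \<alpha> = f then u f else \<zero>\<^bsub>R\<^esub>) else \<zero>\<^bsub>R\<^esub>)"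
      proof -
        have "\<alpha> = compose (Field A) g f \<longleftrightarrow> g \<in> Aut A \<and> inv\<^bsub>Aut_group A\<^esub> g \<otimes>\<^bsub>Aut_group A\<^esub> \<alpha> = f"
        proof
          assume eq: "\<alpha> = compose (Field A) g f"
          then have gf: "g \<in> Aut A" "f \<in> Aut A" using compose_Aut_iff[OF A f g] \<alpha> by auto
          then show "g \<in> Aut A \<and> inv\<^bsub>Aut_group A\<^esub> g \<otimes>\<^bsub>Aut_group A\<^esub> \<alpha> = f"
            using G.inv_solve_left[of \<alpha> g f] G.inv_solve_left'[of f g \<alpha>] \<alpha> eq by auto
        next
          assume *: "g \<in> Aut A \<and> inv\<^bsub>Aut_group A\<^esub> g \<otimes>\<^bsub>Aut_group A\<^esub> \<alpha> = f"
          then have "f \<in> Aut A" using G.m_closed[OF G.inv_closed, of g \<alpha>] \<alpha> by auto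
          then show "\<alpha> = compose (Field A) g f"
            using * G.inv_solve_left'[of f g \<alpha>] \<alpha> by auto
        qed
        then show ?thesis
          using uR[OF f] f \<alpha>H by (auto simp: free_module_def single_def)
      qed
    qed (use uR in auto)
    also have "\<dots> = (if g \<in> Aut A then u (inv\<^bsub>Aut_group A\<^esub> g \<otimes>\<^bsub>Aut_group A\<^esub> \<alpha>) else \<zero>\<^bsub>R\<^esub>)"
    proof (cases "g \<in> Aut A")
      case True
      then have "inv\<^bsub>Aut_group A\<^esub> g \<otimes>\<^bsub>Aut_group A\<^esub> \<alpha> \<in> H A A"
        using G.m_closed[OF G.inv_closed, of g \<alpha>] \<alpha> Aut_in[OF A] by simp
      then show ?thesis using True R.finsum_singleton[OF _ fin, of _ u] uR by (auto simp: Pi_iff)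
    qed simp
    finally show "(v g \<odot>\<^bsub>?M\<^esub> ?inner g) \<alpha> =
        (if g \<in> Aut A then v g \<otimes>\<^bsub>R\<^esub> u (inv\<^bsub>Aut_group A\<^esub> g \<otimes>\<^bsub>Aut_group A\<^esub> \<alpha>) else \<zero>\<^bsub>R\<^esub>)"
      using vR[OF g] \<alpha>H by (simp add: free_module_def)
    show "(if g \<in> Aut A then v g \<otimes>\<^bsub>R\<^esub> u (inv\<^bsub>Aut_group A\<^esub> g \<otimes>\<^bsub>Aut_group A\<^esub> \<alpha>) else \<zero>\<^bsub>R\<^esub>) \<in> carrier R"
      using vR[OF g] uR[OF Aut_in[OF A]] G.m_closed[OF G.inv_closed, of g \<alpha>] \<alpha> by auto
  qed
  also have "\<dots> = (\<Oplus>\<^bsub>R\<^esub>g\<in>Aut A. v g \<otimes>\<^bsub>R\<^esub> u (inv\<^bsub>Aut_group A\<^esub> g \<otimes>\<^bsub>Aut_group A\<^esub> \<alpha>))"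
    using vR uR Aut_in[OF A] G.m_closed[OF G.inv_closed, of _ \<alpha>] \<alpha> fin
    by (intro R.add.finprod_mono_neutral_cong_right) auto
  finally show ?thesis .
qed

text \<open>The idempotent differs from the identity by combinations of maps \<open>y push\<^sub>v\<close>, which are not injective.\<close>

lemma idem_on_Aut:
  assumes A: "A \<in> \<D>" and \<alpha>: "\<alpha> \<in> Aut A"
  shows "idem A \<alpha> = (if \<alpha> = (\<lambda>x\<in>Field A. x) then \<one>\<^bsub>R\<^esub> else \<zero>\<^bsub>R\<^esub>)"
proof -
  interpret R: cring R by (rule cring)
  let ?M = "free_module R (H A A)"
  interpret M: module R ?M by (rule module_free)
  note \<alpha>H = Aut_in[OF A \<alpha>]
  define J where "J = {x \<in> carrier ?M. x \<alpha> = \<zero>\<^bsub>R\<^esub>}"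
  have "Comp L A A A y (bas A A (push A v)) \<in> J" if y: "y \<in> carrier ?M" and v: "v \<in> movable A" for y v
  proof -
    let ?p = "push A v"
    note m = movableD(4-6)[OF A v]
    have "?p v = ?p (parent A v)" using m by (simp add: push_apply)
    then have "\<not> inj_on ?p (Field A)" using inj_onD[of ?p "Field A" v "parent A v"] m by auto
    then have "?p \<notin> Aut A" by (auto simp: isomorphism_def embedding_def)
    then have ne: "\<alpha> \<noteq> compose (Field A) g ?p" if "g \<in> H A A" for g
      using compose_Aut_iff[OF A push_in[OF A v] that] \<alpha> by blast
    have lin: "linear_map R ?M (ring_module R) (\<lambda>y. Comp L A A A y (bas A A ?p) \<alpha>)"
      using Comp_L_left[of A A A "bas A A ?p"] A
      by (intro linear_map_compose[OF _ linear_map_eval[OF \<alpha>H]]) (simp add: basis_in)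
    have zero: "linear_map R ?M (ring_module R) (\<lambda>y. \<zero>\<^bsub>R\<^esub>)"
      by (intro linear_mapI) (auto simp: ring_module_def)
    have "Comp L A A A y (bas A A ?p) \<alpha> = \<zero>\<^bsub>R\<^esub>"
      using linear_map_eq_on_single[OF lin zero module_ring_module[OF cring] _ _ y] finite_Hom[of A A] A ne \<alpha>H
        Comp_bas[OF A A A push_in[OF A v]] by (auto simp: single_def)
    then show ?thesis using y A by (simp add: J_def Comp_L_closed basis_in)
  qed
  note J = this
  have J': "\<zero>\<^bsub>?M\<^esub> \<in> J" "\<And>x y. x \<in> J \<Longrightarrow> y \<in> J \<Longrightarrow> x \<oplus>\<^bsub>?M\<^esub> y \<in> J"
    using \<alpha>H M.M.zero_closed M.M.a_closed by (auto simp: J_def) (simp_all add: free_module_def)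
  have "J \<subseteq> carrier ?M" by (auto simp: J_def)
  from one_minus_idem[OF A J'(1) this J'(2) J] obtain z
    where z: "z \<in> J" "bas A A (\<lambda>x\<in>Field A. x) = z \<oplus>\<^bsub>?M\<^esub> idem A" by blast
  have "idem A \<alpha> \<in> carrier R" using idem_in[OF A] \<alpha>H by (auto simp: free_module_def)
  then have "idem A \<alpha> = bas A A (\<lambda>x\<in>Field A. x) \<alpha>"
    unfolding z(2) using z(1) \<alpha>H by (simp add: J_def free_module_def)
  then show ?thesis using \<alpha>H by (simp add: single_def)
qed

lemma idem_Comp_on_Aut:
  assumes A: "A \<in> \<D>" and u: "u \<in> carrier (kH A A)" and \<alpha>: "\<alpha> \<in> Aut A"
  shows "Comp L A A A (idem A) u \<alpha> = u \<alpha>" and "Comp L A A A u (idem A) \<alpha> = u \<alpha>"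
proof -
  interpret R: cring R by (rule cring)
  interpret G: group "Aut_group A" by (rule group_Aut[OF A])
  have fin: "finite (Aut A)"
    using finite_subset[of "Aut A" "H A A"] finite_Hom[of A A] A Aut_in[OF A] by auto
  have uR: "u f \<in> carrier R" if "f \<in> Aut A" for f
    using u Aut_in[OF A that] by (auto simp: free_module_def)
  have mem: "inv\<^bsub>Aut_group A\<^esub> g \<otimes>\<^bsub>Aut_group A\<^esub> \<alpha> \<in> Aut A" if "g \<in> Aut A" for g
    using G.m_closed[OF G.inv_closed, of g \<alpha>] that \<alpha> by simp
  have one: "(\<lambda>x\<in>Field A. x) \<in> Aut A" using G.one_closed by simp
  have inv_one: "inv\<^bsub>Aut_group A\<^esub> (\<lambda>x\<in>Field A. x) = (\<lambda>x\<in>Field A. x)" using G.inv_one by simp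
  have l_one: "(\<lambda>x\<in>Field A. x) \<otimes>\<^bsub>Aut_group A\<^esub> \<alpha> = \<alpha>" using G.l_one[of \<alpha>] \<alpha> by simp
  have "Comp L A A A (idem A) u \<alpha> = (\<Oplus>\<^bsub>R\<^esub>g\<in>Aut A. if (\<lambda>x\<in>Field A. x) = g then u (inv\<^bsub>Aut_group A\<^esub> g \<otimes>\<^bsub>Aut_group A\<^esub> \<alpha>) else \<zero>\<^bsub>R\<^esub>)"
    unfolding coefficient_Comp[OF A u idem_in[OF A] \<alpha>]
    using uR[OF mem] by (intro R.finsum_cong') (auto simp: idem_on_Aut[OF A] simp del: Aut_simps(3))
  also have "\<dots> = u \<alpha>"
    using R.finsum_singleton[OF one fin, of "\<lambda>g. u (inv\<^bsub>Aut_group A\<^esub> g \<otimes>\<^bsub>Aut_group A\<^esub> \<alpha>)"] uR[OF mem]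
    by (simp add: inv_one l_one Pi_iff del: Aut_simps(3))
  finally show "Comp L A A A (idem A) u \<alpha> = u \<alpha>" .
  have "inv\<^bsub>Aut_group A\<^esub> g \<otimes>\<^bsub>Aut_group A\<^esub> \<alpha> = (\<lambda>x\<in>Field A. x) \<longleftrightarrow> \<alpha> = g" if "g \<in> Aut A" for g
    using G.inv_solve_left'[of "(\<lambda>x\<in>Field A. x)" g \<alpha>] G.r_one[of g] that \<alpha> one by (auto simp del: Aut_simps(3)) 
  then have "Comp L A A A u (idem A) \<alpha> = (\<Oplus>\<^bsub>R\<^esub>g\<in>Aut A. if \<alpha> = g then u g else \<zero>\<^bsub>R\<^esub>)"
    unfolding coefficient_Comp[OF A idem_in[OF A] u \<alpha>]
    using uR mem by (intro R.finsum_cong') (auto simp: idem_on_Aut[OF A] simp del: Aut_simps(3))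
  also have "\<dots> = u \<alpha>"
    using R.finsum_singleton[OF \<alpha> fin, of u] uR by (simp add: Pi_iff)
  finally show "Comp L A A A u (idem A) \<alpha> = u \<alpha>" .
qed

text \<open>In \<open>z = z e\<close> the non-injective terms of \<open>z\<close> are killed by \<open>e\<close>.\<close>

lemma corner_Hom_zero_on_Aut:
  assumes A: "A \<in> \<D>" and z: "z \<in> corner_Hom A A" and zero: "\<And>\<alpha>. \<alpha> \<in> Aut A \<Longrightarrow> z \<alpha> = \<zero>\<^bsub>R\<^esub>"
  shows "z = \<zero>\<^bsub>kH A A\<^esub>"
proof -
  let ?M = "free_module R (H A A)"
  interpret M: module R ?M by (rule module_free)
  have fin: "finite (H A A)" using finite_Hom[of A A] A by simp
  have zM: "z \<in> carrier ?M" and ze: "Comp L A A A z (idem A) = z" using corner_HomD[OF z] by auto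
  have zR: "z f \<in> carrier R" if "f \<in> H A A" for f using zM that by (auto simp: free_module_def)
  have lin: "linear_map R ?M ?M (\<lambda>y. Comp L A A A y (idem A))"
    using Comp_L_left[of A A A "idem A"] A idem_in by simp
  have "z = Comp L A A A (lin_ext (H A A) ?M (bas A A) z) (idem A)"
    using lin_ext_single_self[OF cring fin zM] ze by simp
  also have "\<dots> = (\<Oplus>\<^bsub>?M\<^esub>f\<in>H A A. Comp L A A A (z f \<odot>\<^bsub>?M\<^esub> bas A A f) (idem A))"
    unfolding lin_ext_def using zR
    by (intro linear_map_finsum[OF lin M.module_axioms M.module_axioms] M.smult_closed basis_in)
  also have "\<dots> = (\<Oplus>\<^bsub>?M\<^esub>f\<in>H A A. \<zero>\<^bsub>?M\<^esub>)"
  proof (intro M.M.finsum_cong' refl Pi_I M.M.zero_closed)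
    fix f assume f: "f \<in> H A A"
    have eq: "Comp L A A A (z f \<odot>\<^bsub>?M\<^esub> bas A A f) (idem A) = z f \<odot>\<^bsub>?M\<^esub> Comp L A A A (bas A A f) (idem A)"
      using linear_mapD(3)[OF lin zR[OF f] basis_in] .
    show "Comp L A A A (z f \<odot>\<^bsub>?M\<^esub> bas A A f) (idem A) = \<zero>\<^bsub>?M\<^esub>"
    proof (cases "f \<in> Aut A")
      case True
      have "Comp L A A A (bas A A f) (idem A) \<in> carrier ?M" using A by (simp add: Comp_L_closed basis_in idem_in)
      then show ?thesis by (subst eq) (simp add: zero[OF True])
    next
      case False
      then have "\<not> embedding A A f" using Aut_iff(1)[OF A f] by simp
      then show ?thesis using collapsing_idem[OF A A f] zR[OF f] by (simp add: eq)
    qed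
  qed
  finally show ?thesis by simp
qed

text \<open>Restricting coefficient functions to the automorphisms is multiplicative, sends \<open>e\<close> to \<open>1\<close>, and is
  injective on the corner.  A function \<open>u\<close> on the automorphisms is the restriction of \<open>e u e\<close>.\<close>

lemma End_corner_iso:
  assumes A: "A \<in> \<D>"
  shows "algebra_isomorphic R (End_algebra corner A) (group_algebra R (Aut_group A))"
proof -
  interpret R: cring R by (rule cring)
  let ?M = "free_module R (H A A)" and ?G = "group_algebra R (Aut_group A)"
  interpret M: module R ?M by (rule module_free)
  interpret G: group "Aut_group A" by (rule group_Aut[OF A])
  let ?h = "\<lambda>x. restrict x (Aut A)"
  have fin: "finite (H A A)" using finite_Hom[of A A] A by simp
  have finA: "finite (Aut A)" using finite_subset[OF _ fin, of "Aut A"] Aut_in[OF A] by blast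
  have cM: "x \<in> carrier ?M" if "x \<in> corner_Hom A A" for x using corner_HomD(1)[OF that] by simp
  have xR: "x f \<in> carrier R" if "x \<in> carrier ?M" "f \<in> Aut A" for x f
    using that Aut_in[OF A that(2)] by (auto simp: free_module_def)
  have simps: "carrier (End_algebra corner A) = corner_Hom A A" "mult (End_algebra corner A) = Comp L A A A"
    "one (End_algebra corner A) = idem A" "add (End_algebra corner A) = add ?M" "smult (End_algebra corner A) = smult ?M"
    by (simp_all add: End_algebra_def)
  have h_in: "?h x \<in> carrier ?G" if "x \<in> corner_Hom A A" for x
    using xR[OF cM[OF that]] finA by (auto simp: group_algebra_def)
  have h_add: "?h (x \<oplus>\<^bsub>?M\<^esub> y) = ?h x \<oplus>\<^bsub>?G\<^esub> ?h y" for x y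
    using Aut_in[OF A] by (auto simp: group_algebra_def free_module_def fun_eq_iff)
  have h_smult: "?h (r \<odot>\<^bsub>?M\<^esub> x) = r \<odot>\<^bsub>?G\<^esub> ?h x" for r x
    using Aut_in[OF A] by (auto simp: group_algebra_def free_module_def fun_eq_iff)
  have h_mult: "?h (Comp L A A A x y) = ?h x \<otimes>\<^bsub>?G\<^esub> ?h y" if x: "x \<in> corner_Hom A A" and y: "y \<in> corner_Hom A A" for x y
  proof -
    have "Comp L A A A x y \<alpha> = (\<Oplus>\<^bsub>R\<^esub>g\<in>{g \<in> Aut A. ?h x g \<noteq> \<zero>\<^bsub>R\<^esub>}. ?h x g \<otimes>\<^bsub>R\<^esub> ?h y (inv\<^bsub>Aut_group A\<^esub> g \<otimes>\<^bsub>Aut_group A\<^esub> \<alpha>))"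
      if \<alpha>: "\<alpha> \<in> Aut A" for \<alpha>
    proof -
      have mem: "inv\<^bsub>Aut_group A\<^esub> g \<otimes>\<^bsub>Aut_group A\<^esub> \<alpha> \<in> Aut A" if "g \<in> Aut A" for g
        using G.m_closed[OF G.inv_closed, of g \<alpha>] that \<alpha> by simp
      show ?thesis
        unfolding coefficient_Comp[OF A cM[OF y] cM[OF x] \<alpha>]
        using xR[OF cM[OF x]] xR[OF cM[OF y] mem] mem finA
        by (intro R.add.finprod_mono_neutral_cong_right) (auto simp del: Aut_simps(3))
    qed
    then show ?thesis by (auto simp: group_algebra_def fun_eq_iff simp del: Aut_simps(3))
  qed
  have h_one: "?h (idem A) = \<one>\<^bsub>?G\<^esub>"
    by (auto simp: group_algebra_def fun_eq_iff idem_on_Aut[OF A])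
  have C: "module R ((HomMod L A A)\<lparr>carrier := corner_Hom A A\<rparr>)"
    using module_corner_Hom[of A A] A by simp
  then interpret C: module R "?M\<lparr>carrier := corner_Hom A A\<rparr>" by simp
  have inj: "inj_on ?h (corner_Hom A A)"
  proof (rule inj_onI)
    fix x y assume x: "x \<in> corner_Hom A A" and y: "y \<in> corner_Hom A A" and eq: "?h x = ?h y"
    have "linear_map R (?M\<lparr>carrier := corner_Hom A A\<rparr>) ?M (\<lambda>z. z)"
      using cM by (intro linear_mapI) auto
    from linear_map_minus[OF this C.module_axioms M.module_axioms, of x y] x y
    have diff: "x \<ominus>\<^bsub>?M\<^esub> y \<in> corner_Hom A A"
      using C.M.minus_closed[of x y] by simp
    have "(x \<ominus>\<^bsub>?M\<^esub> y) \<alpha> = \<zero>\<^bsub>R\<^esub>" if \<alpha>: "\<alpha> \<in> Aut A" for \<alpha>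
    proof -
      interpret RM: module R "ring_module R" by (rule module_ring_module[OF cring])
      have "(x \<ominus>\<^bsub>?M\<^esub> y) \<alpha> = x \<alpha> \<ominus>\<^bsub>ring_module R\<^esub> y \<alpha>"
        using linear_map_minus[OF linear_map_eval[OF Aut_in[OF A \<alpha>]] M.module_axioms RM.module_axioms] cM x y by blast
      also have "x \<alpha> = y \<alpha>" using fun_cong[OF eq, of \<alpha>] \<alpha> by simp
      finally show ?thesis
        using xR[OF cM[OF y] \<alpha>] RM.M.r_neg[of "y \<alpha>"] by (simp add: a_minus_def ring_module_def)
    qed
    from corner_Hom_zero_on_Aut[OF A diff this] have "x \<ominus>\<^bsub>?M\<^esub> y \<oplus>\<^bsub>?M\<^esub> y = y"
      using cM[OF y] by simp
    then show "x = y"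
      using cM x y by (simp add: a_minus_def M.M.a_assoc M.M.l_neg)
  qed
  have surj: "carrier ?G \<subseteq> ?h ` corner_Hom A A"
  proof
    fix u assume u: "u \<in> carrier ?G"
    define x where "x = (\<lambda>f\<in>H A A. if f \<in> Aut A then u f else \<zero>\<^bsub>R\<^esub>)"
    have xM: "x \<in> carrier ?M" using u by (auto simp: x_def free_module_def group_algebra_def)
    let ?y = "Comp L A A A (idem A) (Comp L A A A x (idem A))"
    have y: "?y \<in> corner_Hom A A"
      using xM A idem_in idem_idem
      by (intro corner_Hom_Comp) (auto simp: Comp_L_closed Comp_L_assoc)
    have "?y \<alpha> = u \<alpha>" if "\<alpha> \<in> Aut A" for \<alpha>
      using that idem_Comp_on_Aut[OF A _ that] xM A idem_in Aut_in[OF A that]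
      by (simp add: Comp_L_closed x_def)
    then have "?h ?y = u"
      using u by (auto simp: fun_eq_iff group_algebra_def PiE_iff extensional_def)
    then show "u \<in> ?h ` corner_Hom A A" using y by blast
  qed
  have "?h \<in> ring_iso (End_algebra corner A) ?G"
    using h_in h_add h_mult h_one inj surj
    by (auto simp: ring_iso_def ring_hom_def simps bij_betw_def)
  moreover have "linear_map R (End_algebra corner A) ?G ?h"
    using h_in h_add h_smult by (intro linear_mapI) (auto simp: simps)
  ultimately show ?thesis unfolding algebra_isomorphic_def by blast
qed

subsection \<open>The equivalence\<close>

lemma equivalent_corner:
  assumes "infinite (UNIV :: 'm set)"
  shows "equivalent_categories (Mod_over TYPE('m) R (tree_category \<D> \<D>min)) (linear_Mod_over TYPE('m) R corner)"
proof -
  obtain n B u w where full: "full_idempotent_family R L idem n B u w"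
    using full_idempotent_familyI Idm_in_trace by auto
  note lin = is_functor_linearize_functor[where U = "TYPE('m)"] fully_faithful_linearize_functor[where U = "TYPE('m)"]
    essentially_surjective_linearize_functor[where U = "TYPE('m)"]
  note cor = is_functor_corner_functor[where U = "TYPE('m)"]
    full_idempotent_family.fully_faithful_corner_functor[OF full, where U = "TYPE('m)"]
    full_idempotent_family.essentially_surjective_corner_functor[OF full assms cring, where U = "TYPE('m)"]
  show ?thesis
    by (rule equivalent_categoriesI[OF is_functor_comp_functor[OF lin(1) cor(1)]
          fully_faithful_comp_functor[OF lin(1,2) cor(2)]
          essentially_surjective_comp_functor[OF lin(1,3) cor(1,3)]])
qed

end

theorem theorem1p4:
  fixes k :: "('r, 'x) ring_scheme"
    and \<D> \<D>min :: "'v rel set"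
  assumes "cring k"
    and "\<D> \<subseteq> {A. rooted_tree A}"
    and "\<D>min \<subseteq> \<D>"
    and "minimal_uncontracted \<D> \<D>min"
    and "condition_C1 \<D> \<D>min"
    and "condition_C2 \<D> \<D>min"
    and "infinite (UNIV :: 'm set)"
  shows "\<exists>E :: ('v rel, ('v \<Rightarrow> 'v) \<Rightarrow> 'r, 'r) lincat.
    linear_category k E \<and> Ob E = \<D> \<and>
    equivalent_categories
      (Mod_over TYPE('m) k (tree_category \<D> \<D>min))
      (linear_Mod_over TYPE('m) k E) \<and>
    (\<forall>A\<in>\<D>. algebra_isomorphic k (End_algebra E A) (group_algebra k (Aut_group A))) \<and>
    (\<forall>A\<in>\<D>. \<forall>B\<in>\<D>. Hom E B A \<noteq> {\<zero>\<^bsub>HomMod E B A\<^esub>} \<longrightarrow>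
      card (Field A) = card (Field B) \<or> card (Field A) = card (Field B) + 1)"
proof -
  interpret tree_setting k \<D> \<D>min by (intro tree_setting.intro assms)
  have "card (Field A) = card (Field B) \<or> card (Field A) = card (Field B) + 1"
    if A: "A \<in> \<D>" and B: "B \<in> \<D>" and ne: "Hom corner B A \<noteq> {\<zero>\<^bsub>HomMod corner B A\<^esub>}" for A B
  proof -
    have "\<zero>\<^bsub>HomMod corner B A\<^esub> \<in> corner_Hom B A"
      using module_corner_Hom[of B A] A B abelian_monoid.zero_closed[OF abelian_group.axioms(1)[OF module.axioms(2)]]
      by fastforce
    then obtain x where "x \<in> corner_Hom B A" "x \<noteq> \<zero>\<^bsub>HomMod corner B A\<^esub>"
      using ne by auto
    then show ?thesis using card_of_nonzero_Hom[OF A B] by simp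
  qed
  then show ?thesis
    using linear_category_corner equivalent_corner[OF assms(7)] End_corner_iso
    by (intro exI[of _ corner]) auto
qed

end
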